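(* Let $p:R^3\to R^2$ be the projection $(x,y,z)\mapsto(x,y)$, and let $S^t,B^t\in\mathcal{D}'_c(R^3)$ be the sphere and ball distributions in dimension 3 given in the context. The function $R\to\mathcal{D}'_c(R^2)$ given by $t\mapsto\frac{1}{4\pi}\cdot p(t\cdot S^t)$ is a solution of the wave equation $\ddot Q(t)=\Delta(Q(t))$ (for all $t\in R$) in dimension 2; its initial value and initial speed are, respectively, $0$ and $\delta(0)$. The function $R\to\mathcal{D}'_c(R^2)$ given by $t\mapsto\frac{1}{4\pi}\cdot p(S^t+t^2\cdot\Delta(B^t))$ is also a solution of the wave equation in dimension 2; its initial value and initial speed are, respectively, $\delta(0)$ and $0$.
   Context: Setting: synthetic differential geometry. $R$ is the number line (a commutative ring object containing $\mathbb{Q}$ satisfying the Kock–Lawvere axiom, with the integration axiom: every $f$ has a unique antiderivative with given value at a point) in a well-adapted model; statements are read in the internal logic. $D=\{d\in R:d^2=0\}$. $\mathcal{D}'_c(R^n)$, the distributions of compact support on $R^n$, is the $R$-module of $R$-linear maps $R^{(R^n)}\to R$; evaluation is written $\langle\mu,\psi\rangle$. $\delta(0)$ is the Dirac distribution $\psi\mapsto\psi(0)$. The Laplace operator $\Delta=\sum\partial^2/\partial x_i^2$ acts on distributions by $\langle\Delta(\mu),\psi\rangle=\langle\mu,\Delta\psi\rangle$. For a map $f:R^m\to R^n$ and $\mu\in\mathcal{D}'_c(R^m)$, $f(\mu)\in\mathcal{D}'_c(R^n)$ is defined by $\langle f(\mu),\psi\rangle=\langle\mu,\psi\circ f\rangle$.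 For $Q:R\to\mathcal{D}'_c(R^n)$, $\dot Q=\frac{d}{dt}Q$ is determined by $Q(t+d)=Q(t)+d\cdot\dot Q(t)$ for all $d\in D$, i.e. $\langle\dot Q(t),\psi\rangle=\frac{d}{dt}\langle Q(t),\psi\rangle$. The initial value is $Q(0)$ and the initial speed is $\dot Q(0)$. In dimension 3, for every $t\in R$: $$\langle S^t,\psi\rangle=\int_0^{\pi}\int_0^{2\pi}\psi(t\cos\theta\sin\phi,t\sin\theta\sin\phi,t\cos\phi)\sin\phi\,d\theta\,d\phi,$$ $$\langle B^t,\psi\rangle=\int_0^1\int_0^{\pi}\int_0^{2\pi}\psi(ts\cos\theta\sin\phi,ts\sin\theta\sin\phi,ts\cos\phi)\,s^2\sin\phi\,d\theta\,d\phi\,ds.$$ *)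

theory Defs
  imports "HOL-Analysis.Analysis"
begin

text \<open>
  The axioms of synthetic differential geometry have only trivial models in classical logic, so
  sentences about the number line are not stated about a HOL type. They are formulas of a typed
  language, interpreted by Kripke--Joyal semantics in a topos with a line object.
\<close>

section \<open>Toposes\<close>

text \<open>
  All elements of the type \<open>'a\<close> are arrows; \<open>cmp g f\<close> is meaningful only if \<open>tgt f = src g\<close>.
  \<open>expo A B\<close> is the object of maps from \<open>A\<close> to \<open>B\<close>, and \<open>cur X A f\<close> is the transpose
  \<open>X \<rightarrow> expo A B\<close> of \<open>f : X \<times> A \<rightarrow> B\<close>.
\<close>

record ('o, 'a) topos_str =
  src :: "'a \<Rightarrow> 'o"
  tgt :: "'a \<Rightarrow> 'o"
  ide :: "'o \<Rightarrow> 'a"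
  cmp :: "'a \<Rightarrow> 'a \<Rightarrow> 'a"
  one :: 'o
  bang :: "'o \<Rightarrow> 'a"
  prd :: "'o \<Rightarrow> 'o \<Rightarrow> 'o"
  pr1 :: "'o \<Rightarrow> 'o \<Rightarrow> 'a"
  pr2 :: "'o \<Rightarrow> 'o \<Rightarrow> 'a"
  pair :: "'a \<Rightarrow> 'a \<Rightarrow> 'a"
  expo :: "'o \<Rightarrow> 'o \<Rightarrow> 'o"
  ev :: "'o \<Rightarrow> 'o \<Rightarrow> 'a"
  cur :: "'o \<Rightarrow> 'o \<Rightarrow> 'a \<Rightarrow> 'a"

definition hom :: "('o, 'a, 'x) topos_str_scheme \<Rightarrow> 'o \<Rightarrow> 'o \<Rightarrow> 'a set" where
  "hom M X Y = {f. src M f = X \<and> tgt M f = Y}"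

definition mono_arr :: "('o, 'a, 'x) topos_str_scheme \<Rightarrow> 'a \<Rightarrow> bool" where
  "mono_arr M m \<longleftrightarrow> (\<forall>X. inj_on (cmp M m) (hom M X (src M m)))"

definition is_equalizer :: "('o, 'a, 'x) topos_str_scheme \<Rightarrow> 'a \<Rightarrow> 'a \<Rightarrow> 'a \<Rightarrow> bool" where
  "is_equalizer M e f g \<longleftrightarrow> tgt M e = src M f \<and>
     (\<forall>X. bij_betw (cmp M e) (hom M X (src M e))
            {a \<in> hom M X (src M f). cmp M f a = cmp M g a})"

text \<open>\<open>classifies M tr m c\<close>: \<open>m\<close> is a pullback of \<open>tr : 1 \<rightarrow> \<Omega>\<close> along \<open>c\<close>.\<close>

definition classifies :: "('o, 'a, 'x) topos_str_scheme \<Rightarrow> 'a \<Rightarrow> 'a \<Rightarrow> 'a \<Rightarrow> bool" where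
  "classifies M tr m c \<longleftrightarrow> c \<in> hom M (tgt M m) (tgt M tr) \<and>
     (\<forall>X. bij_betw (cmp M m) (hom M X (src M m))
            {a \<in> hom M X (tgt M m). cmp M c a = cmp M tr (bang M X)})"

locale topos =
  fixes M :: "('o, 'a, 'x) topos_str_scheme"
  assumes ide_hom: "ide M X \<in> hom M X X"
    and cmp_hom: "f \<in> hom M X Y \<Longrightarrow> g \<in> hom M Y Z \<Longrightarrow> cmp M g f \<in> hom M X Z"
    and cmp_ide: "f \<in> hom M X Y \<Longrightarrow> cmp M f (ide M X) = f"
    and ide_cmp: "f \<in> hom M X Y \<Longrightarrow> cmp M (ide M Y) f = f"
    and cmp_assoc: "f \<in> hom M W X \<Longrightarrow> g \<in> hom M X Y \<Longrightarrow> h \<in> hom M Y Z \<Longrightarrow>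
          cmp M h (cmp M g f) = cmp M (cmp M h g) f"
    and terminal: "hom M X (one M) = {bang M X}"
    and pr1_hom: "pr1 M A B \<in> hom M (prd M A B) A"
    and pr2_hom: "pr2 M A B \<in> hom M (prd M A B) B"
    and pair_hom: "f \<in> hom M X A \<Longrightarrow> g \<in> hom M X B \<Longrightarrow> pair M f g \<in> hom M X (prd M A B)"
    and pr1_pair: "f \<in> hom M X A \<Longrightarrow> g \<in> hom M X B \<Longrightarrow> cmp M (pr1 M A B) (pair M f g) = f"
    and pr2_pair: "f \<in> hom M X A \<Longrightarrow> g \<in> hom M X B \<Longrightarrow> cmp M (pr2 M A B) (pair M f g) = g"
    and pair_unique: "h \<in> hom M X (prd M A B) \<Longrightarrow>
          pair M (cmp M (pr1 M A B) h) (cmp M (pr2 M A B) h) = h"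
    and ev_hom: "ev M A B \<in> hom M (prd M (expo M A B) A) B"
    and cur_hom: "f \<in> hom M (prd M X A) B \<Longrightarrow> cur M X A f \<in> hom M X (expo M A B)"
    and ev_cur: "f \<in> hom M (prd M X A) B \<Longrightarrow>
          cmp M (ev M A B) (pair M (cmp M (cur M X A f) (pr1 M X A)) (pr2 M X A)) = f"
    and cur_unique: "h \<in> hom M X (expo M A B) \<Longrightarrow>
          cur M X A (cmp M (ev M A B) (pair M (cmp M h (pr1 M X A)) (pr2 M X A))) = h"
    and equalizers: "f \<in> hom M X Y \<Longrightarrow> g \<in> hom M X Y \<Longrightarrow> \<exists>e. is_equalizer M e f g"
    and subobject_classifier:
          "\<exists>tr. src M tr = one M \<and> (\<forall>m. mono_arr M m \<longrightarrow> (\<exists>!c. classifies M tr m c))"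

section \<open>The internal language\<close>

datatype ty = Line | Infinitesimals | Unit | Prod ty ty | Fun ty ty

text \<open>
  Variables carry their type. \<open>Incl\<close> is the inclusion \<open>D \<rightarrow> R\<close>, \<open>Smooth n f\<close> is the map
  \<open>R\<^sup>n \<rightarrow> R\<close> that the model assigns to a smooth function \<open>f\<close> of \<open>n\<close> real variables,
  \<open>Descr v p\<close> is the unique \<open>v\<close> such that \<open>p\<close>.
\<close>

type_synonym var = "string \<times> ty"

datatype trm =
    Var var
  | Star
  | Tuple trm trm
  | Fst trm
  | Snd trm
  | Lam var trm
  | App trm trm  (infixl \<open>\<cdot>\<close> 90)
  | Incl trm
  | Smooth nat "(nat \<Rightarrow> real) \<Rightarrow> real" trm
  | Descr var fm
and fm =
    Equal trm trm  (infix \<open>\<approx>\<close> 50)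
  | And fm fm  (infixr \<open>\<sqinter>\<close> 35)
  | Forall var fm
  | ExistsOne var fm

primrec vec :: "nat \<Rightarrow> ty" where
  "vec 0 = Unit"
| "vec (Suc n) = Prod Line (vec n)"

primrec ty_of :: "trm \<Rightarrow> ty" where
  "ty_of (Var v) = snd v"
| "ty_of Star = Unit"
| "ty_of (Tuple s t) = Prod (ty_of s) (ty_of t)"
| "ty_of (Fst t) = (case ty_of t of Prod A B \<Rightarrow> A | _ \<Rightarrow> undefined)"
| "ty_of (Snd t) = (case ty_of t of Prod A B \<Rightarrow> B | _ \<Rightarrow> undefined)"
| "ty_of (Lam v t) = Fun (snd v) (ty_of t)"
| "ty_of (App s t) = (case ty_of s of Fun A B \<Rightarrow> B | _ \<Rightarrow> undefined)"
| "ty_of (Incl t) = Line"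
| "ty_of (Smooth n f t) = Line"
| "ty_of (Descr v p) = snd v"

text \<open>
  \<open>wt_trm G t\<close>, \<open>wt_fm G p\<close>: well-typed, with all free variables in \<open>G\<close>. The semantics below is
  meaningful only for well-typed expressions in which each \<open>Smooth n f\<close> has a smooth \<open>f\<close> and each
  description has a unique solution.
\<close>

primrec wt_trm :: "var set \<Rightarrow> trm \<Rightarrow> bool"
  and wt_fm :: "var set \<Rightarrow> fm \<Rightarrow> bool" where
  "wt_trm G (Var v) \<longleftrightarrow> v \<in> G"
| "wt_trm G Star \<longleftrightarrow> True"
| "wt_trm G (Tuple s t) \<longleftrightarrow> wt_trm G s \<and> wt_trm G t"
| "wt_trm G (Fst t) \<longleftrightarrow> wt_trm G t \<and> (\<exists>A B. ty_of t = Prod A B)"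
| "wt_trm G (Snd t) \<longleftrightarrow> wt_trm G t \<and> (\<exists>A B. ty_of t = Prod A B)"
| "wt_trm G (Lam v t) \<longleftrightarrow> wt_trm (insert v G) t"
| "wt_trm G (App s t) \<longleftrightarrow> wt_trm G s \<and> wt_trm G t \<and> (\<exists>B. ty_of s = Fun (ty_of t) B)"
| "wt_trm G (Incl t) \<longleftrightarrow> wt_trm G t \<and> ty_of t = Infinitesimals"
| "wt_trm G (Smooth n f t) \<longleftrightarrow> wt_trm G t \<and> ty_of t = vec n"
| "wt_trm G (Descr v p) \<longleftrightarrow> wt_fm (insert v G) p"
| "wt_fm G (Equal s t) \<longleftrightarrow> wt_trm G s \<and> wt_trm G t \<and> ty_of s = ty_of t"
| "wt_fm G (And p q) \<longleftrightarrow> wt_fm G p \<and> wt_fm G q"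
| "wt_fm G (Forall v p) \<longleftrightarrow> wt_fm (insert v G) p"
| "wt_fm G (ExistsOne v p) \<longleftrightarrow> wt_fm (insert v G) p"

section \<open>Models\<close>

text \<open>
  A function of \<open>n\<close> real variables is a function on \<open>nat \<Rightarrow> real\<close> (with the product topology)
  that depends only on the arguments \<open>0, \<dots>, n - 1\<close>. Smooth means that all iterated partial
  derivatives exist and are continuous.
\<close>

coinductive smooth :: "((nat \<Rightarrow> real) \<Rightarrow> real) \<Rightarrow> bool" where
  "continuous_on UNIV f \<Longrightarrow>
   (\<And>i x. (\<lambda>s. f (x(i := s))) differentiable at (x i)) \<Longrightarrow>
   (\<And>i. smooth (\<lambda>x. deriv (\<lambda>s. f (x(i := s))) (x i))) \<Longrightarrow> smooth f"

definition Cinf :: "nat \<Rightarrow> ((nat \<Rightarrow> real) \<Rightarrow> real) set" where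
  "Cinf n = {f. smooth f \<and> (\<forall>x y. (\<forall>i<n. x i = y i) \<longrightarrow> f x = f y)}"

record ('o, 'a) sdg_str = "('o, 'a) topos_str" +
  line :: 'o
  infs :: 'o
  incl :: 'a
  smap :: "nat \<Rightarrow> ((nat \<Rightarrow> real) \<Rightarrow> real) \<Rightarrow> 'a"

primrec obj :: "('o, 'a) sdg_str \<Rightarrow> ty \<Rightarrow> 'o" where
  "obj M Line = line M"
| "obj M Infinitesimals = infs M"
| "obj M Unit = one M"
| "obj M (Prod A B) = prd M (obj M A) (obj M B)"
| "obj M (Fun A B) = expo M (obj M A) (obj M B)"

text \<open>
  \<open>den M X r t\<close> is the generalized element of \<open>obj M (ty_of t)\<close> at stage \<open>X\<close> denoted by \<open>t\<close>, where
  \<open>r\<close> assigns to each variable a generalized element of its type at stage \<open>X\<close>;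
  \<open>forces M X r p\<close> is the Kripke--Joyal forcing relation. In the clause for \<open>ExistsOne\<close> no
  covering of the stage is needed: by uniqueness, locally existing witnesses glue.
\<close>

primrec den :: "('o, 'a) sdg_str \<Rightarrow> 'o \<Rightarrow> (var \<Rightarrow> 'a) \<Rightarrow> trm \<Rightarrow> 'a"
  and forces :: "('o, 'a) sdg_str \<Rightarrow> 'o \<Rightarrow> (var \<Rightarrow> 'a) \<Rightarrow> fm \<Rightarrow> bool" where
  "den M X r (Var v) = r v"
| "den M X r Star = bang M X"
| "den M X r (Tuple s t) = pair M (den M X r s) (den M X r t)"
| "den M X r (Fst t) = (case ty_of t of
     Prod A B \<Rightarrow> cmp M (pr1 M (obj M A) (obj M B)) (den M X r t) | _ \<Rightarrow> undefined)"
| "den M X r (Snd t) = (case ty_of t of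
     Prod A B \<Rightarrow> cmp M (pr2 M (obj M A) (obj M B)) (den M X r t) | _ \<Rightarrow> undefined)"
| "den M X r (Lam v t) = cur M X (obj M (snd v))
     (den M (prd M X (obj M (snd v)))
       ((\<lambda>w. cmp M (r w) (pr1 M X (obj M (snd v)))) (v := pr2 M X (obj M (snd v)))) t)"
| "den M X r (App s t) = (case ty_of s of
     Fun A B \<Rightarrow> cmp M (ev M (obj M A) (obj M B)) (pair M (den M X r s) (den M X r t))
   | _ \<Rightarrow> undefined)"
| "den M X r (Incl t) = cmp M (incl M) (den M X r t)"
| "den M X r (Smooth n f t) = cmp M (smap M n f) (den M X r t)"
| "den M X r (Descr v p) = (THE a. a \<in> hom M X (obj M (snd v)) \<and> forces M X (r(v := a)) p)"
| "forces M X r (Equal s t) \<longleftrightarrow> den M X r s = den M X r t"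
| "forces M X r (And p q) \<longleftrightarrow> forces M X r p \<and> forces M X r q"
| "forces M X r (Forall v p) \<longleftrightarrow>
     (\<forall>Y. \<forall>h \<in> hom M Y X. \<forall>a \<in> hom M Y (obj M (snd v)).
        forces M Y ((\<lambda>w. cmp M (r w) h) (v := a)) p)"
| "forces M X r (ExistsOne v p) \<longleftrightarrow>
     (\<forall>Y. \<forall>h \<in> hom M Y X. \<exists>!a. a \<in> hom M Y (obj M (snd v)) \<and>
        forces M Y ((\<lambda>w. cmp M (r w) h) (v := a)) p)"

text \<open>For a closed formula, validity at all stages is the same as validity at stage \<open>one\<close>.\<close>

definition valid :: "('o, 'a) sdg_str \<Rightarrow> fm \<Rightarrow> bool"  (infix \<open>\<Turnstile>\<close> 30) where
  "M \<Turnstile> p \<longleftrightarrow> (\<forall>X r. (\<forall>v. r v \<in> hom M X (obj M (snd v))) \<longrightarrow> forces M X r p)"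

section \<open>Calculus in the internal language\<close>

text \<open>
  Operators are closed terms, so that applying them to terms with free variables cannot lead to
  variable capture.
\<close>

definition tup :: "trm list \<Rightarrow> trm" where
  "tup ts = foldr Tuple ts Star"

definition coord :: "nat \<Rightarrow> trm \<Rightarrow> trm" where
  "coord i x = Fst ((Snd ^^ i) x)"

definition Const :: "real \<Rightarrow> trm" where
  "Const c = Smooth 0 (\<lambda>_. c) Star"

definition Plus :: "trm \<Rightarrow> trm \<Rightarrow> trm"  (infixl \<open>\<oplus>\<close> 65) where
  "s \<oplus> t = Smooth 2 (\<lambda>x. x 0 + x 1) (tup [s, t])"

definition Times :: "trm \<Rightarrow> trm \<Rightarrow> trm"  (infixl \<open>\<otimes>\<close> 70) where
  "s \<otimes> t = Smooth 2 (\<lambda>x. x 0 * x 1) (tup [s, t])"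

definition Sin :: "trm \<Rightarrow> trm" where
  "Sin t = Smooth 1 (\<lambda>x. sin (x 0)) (tup [t])"

definition Cos :: "trm \<Rightarrow> trm" where
  "Cos t = Smooth 1 (\<lambda>x. cos (x 0)) (tup [t])"

definition inf_zero :: trm where
  "inf_zero = (let z = (''z'', Infinitesimals) in Descr z (Incl (Var z) \<approx> Const 0))"

text \<open>The derivative of \<open>f : R \<rightarrow> R\<close>.\<close>

definition derivative :: trm where
  "derivative =
     (let f = (''f'', Fun Line Line); t = (''t'', Line); b = (''b'', Line);
          d = (''d'', Infinitesimals)
      in Lam f (Lam t (Descr b (Forall d
           (Var f \<cdot> (Var t \<oplus> Incl (Var d)) \<approx> Var f \<cdot> Var t \<oplus> Incl (Var d) \<otimes> Var b)))))"

text \<open>\<open>integral_op \<cdot> u \<cdot> v \<cdot> f\<close> is the integral of \<open>f\<close> from \<open>u\<close> to \<open>v\<close>.\<close>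

definition integral_op :: trm where
  "integral_op =
     (let u = (''u'', Line); v = (''v'', Line); f = (''f'', Fun Line Line);
          g = (''g'', Fun Line Line)
      in Lam u (Lam v (Lam f
           (Descr g (derivative \<cdot> Var g \<approx> Var f \<sqinter> Var g \<cdot> Var u \<approx> Const 0) \<cdot> Var v))))"

definition partial :: "nat \<Rightarrow> nat \<Rightarrow> trm" where
  "partial n i =
     (let f = (''f'', Fun (vec n) Line); x = (''x'', vec n); b = (''b'', Line);
          d = (''d'', Infinitesimals)
      in Lam f (Lam x (Descr b (Forall d
           (Var f \<cdot> tup (map (\<lambda>j. if j = i then coord j (Var x) \<oplus> Incl (Var d)
                                  else coord j (Var x)) [0..<n])
            \<approx> Var f \<cdot> Var x \<oplus> Incl (Var d) \<otimes> Var b)))))"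

definition laplace :: "nat \<Rightarrow> trm" where
  "laplace n =
     (let f = (''f'', Fun (vec n) Line); x = (''x'', vec n)
      in Lam f (Lam x (foldr Plus
           (map (\<lambda>i. partial n i \<cdot> (partial n i \<cdot> Var f) \<cdot> Var x) [0..<n]) (Const 0))))"

definition Kock_Lawvere :: fm where
  "Kock_Lawvere =
     (let g = (''g'', Fun Infinitesimals Line); b = (''b'', Line); d = (''d'', Infinitesimals)
      in Forall g (ExistsOne b (Forall d
           (Var g \<cdot> Var d \<approx> Var g \<cdot> inf_zero \<oplus> Incl (Var d) \<otimes> Var b))))"

definition Integration :: fm where
  "Integration =
     (let f = (''f'', Fun Line Line); g = (''g'', Fun Line Line); a = (''a'', Line);
          c = (''c'', Line)
      in Forall f (Forall a (Forall c (ExistsOne g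
           (derivative \<cdot> Var g \<approx> Var f \<sqinter> Var g \<cdot> Var a \<approx> Var c)))))"

section \<open>Well-adapted models\<close>

primrec tup_arr :: "('o, 'a) sdg_str \<Rightarrow> 'o \<Rightarrow> 'a list \<Rightarrow> 'a" where
  "tup_arr M X [] = bang M X"
| "tup_arr M X (a # as) = pair M a (tup_arr M X as)"

text \<open>
  The assumptions on \<open>smap\<close> say that it is a fully faithful functor from the category of the
  spaces \<open>\<real>\<^sup>n\<close> and smooth maps that preserves finite products and sends the real line to \<open>line\<close>.
  The ring operations of \<open>line\<close> are the images of those of the real numbers, and \<open>infs\<close> is the
  subobject \<open>{d. d * d = 0}\<close>.
\<close>

locale well_adapted_model = topos M for M :: "('o, 'a) sdg_str" +
  assumes smap_bij: "bij_betw (smap M n) (Cinf n) (hom M (obj M (vec n)) (line M))"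
    and smap_coord: "i < n \<Longrightarrow> smap M n (\<lambda>x. x i) =
          den M (obj M (vec n)) (\<lambda>_. ide M (obj M (vec n))) (coord i (Var (''x'', vec n)))"
    and smap_cmp: "f \<in> Cinf m \<Longrightarrow> (\<And>i. i < m \<Longrightarrow> g i \<in> Cinf n) \<Longrightarrow>
          smap M n (\<lambda>x. f (\<lambda>i. g i x)) =
          cmp M (smap M m f) (tup_arr M (obj M (vec n)) (map (\<lambda>i. smap M n (g i)) [0..<m]))"
    and infs_equalizer: "src M (incl M) = infs M"
          "is_equalizer M (incl M)
             (cmp M (smap M 1 (\<lambda>x. x 0 * x 0)) (tup_arr M (line M) [ide M (line M)]))
             (cmp M (smap M 1 (\<lambda>x. 0)) (tup_arr M (line M) [ide M (line M)]))"
    and Kock_Lawvere: "M \<Turnstile> Kock_Lawvere"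
    and Integration: "M \<Turnstile> Integration"

section \<open>Distributions of compact support\<close>

text \<open>
  \<open>Dist n\<close> is the type of all maps from \<open>R^(R^n)\<close> to \<open>R\<close>. Distributions of compact support are
  those that satisfy \<open>linear_dist\<close>; equality of distributions is equality in \<open>Dist n\<close>.
\<close>

definition Dist :: "nat \<Rightarrow> ty" where
  "Dist n = Fun (Fun (vec n) Line) Line"

text \<open>The free variables of \<open>m\<close> must differ from \<open>f\<close>, \<open>g\<close>, \<open>a\<close>.\<close>

definition linear_dist :: "nat \<Rightarrow> trm \<Rightarrow> fm" where
  "linear_dist n m =
     (let f = (''f'', Fun (vec n) Line); g = (''g'', Fun (vec n) Line); a = (''a'', Line);
          x = (''x'', vec n)
      in Forall f (Forall g (m \<cdot> Lam x (Var f \<cdot> Var x \<oplus> Var g \<cdot> Var x) \<approx> m \<cdot> Var f \<oplus> m \<cdot> Var g)) \<sqinter>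
         Forall a (Forall f (m \<cdot> Lam x (Var a \<otimes> (Var f \<cdot> Var x)) \<approx> Var a \<otimes> (m \<cdot> Var f))))"

definition dist_zero :: "nat \<Rightarrow> trm" where
  "dist_zero n = (let f = (''f'', Fun (vec n) Line) in Lam f (Const 0))"

definition dist_add :: "nat \<Rightarrow> trm" where
  "dist_add n =
     (let m = (''m'', Dist n); l = (''l'', Dist n); f = (''f'', Fun (vec n) Line)
      in Lam m (Lam l (Lam f (Var m \<cdot> Var f \<oplus> Var l \<cdot> Var f))))"

definition dist_scale :: "nat \<Rightarrow> trm" where
  "dist_scale n =
     (let a = (''a'', Line); m = (''m'', Dist n); f = (''f'', Fun (vec n) Line)
      in Lam a (Lam m (Lam f (Var a \<otimes> (Var m \<cdot> Var f)))))"

definition dirac :: "nat \<Rightarrow> trm" where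
  "dirac n =
     (let f = (''f'', Fun (vec n) Line) in Lam f (Var f \<cdot> tup (replicate n (Const 0))))"

definition dist_laplace :: "nat \<Rightarrow> trm" where
  "dist_laplace n =
     (let m = (''m'', Dist n); f = (''f'', Fun (vec n) Line)
      in Lam m (Lam f (Var m \<cdot> (laplace n \<cdot> Var f))))"

definition push :: "nat \<Rightarrow> nat \<Rightarrow> trm" where
  "push m n =
     (let h = (''h'', Fun (vec m) (vec n)); l = (''l'', Dist m); f = (''f'', Fun (vec n) Line);
          x = (''x'', vec m)
      in Lam h (Lam l (Lam f (Var l \<cdot> Lam x (Var f \<cdot> (Var h \<cdot> Var x))))))"

text \<open>
  The time derivative of \<open>q : R \<rightarrow> Dist n\<close>. It exists and is unique, by the Kock--Lawvere axiom,
  for all maps into \<open>Dist n\<close>, and it is linear if \<open>q\<close> has linear values. Requiring linearity inside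
  the description would be wrong: the description is evaluated at the generic \<open>q\<close>, which is not
  linear.
\<close>

definition dot :: "nat \<Rightarrow> trm" where
  "dot n =
     (let q = (''q'', Fun Line (Dist n)); t = (''t'', Line); m = (''m'', Dist n);
          d = (''d'', Infinitesimals)
      in Lam q (Lam t (Descr m (Forall d
           (Var q \<cdot> (Var t \<oplus> Incl (Var d))
            \<approx> dist_add n \<cdot> (Var q \<cdot> Var t) \<cdot> (dist_scale n \<cdot> Incl (Var d) \<cdot> Var m))))))"

text \<open>
  \<open>q\<close> takes values in the distributions of compact support and solves the wave equation in
  dimension \<open>n\<close> with initial value \<open>u\<close> and initial speed \<open>v\<close>; \<open>q\<close>, \<open>u\<close> and \<open>v\<close> must be closed.
\<close>

definition wave_solution :: "nat \<Rightarrow> trm \<Rightarrow> trm \<Rightarrow> trm \<Rightarrow> fm" where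
  "wave_solution n q u v =
     (let t = (''t'', Line)
      in Forall t (linear_dist n (q \<cdot> Var t)) \<sqinter>
         Forall t (dot n \<cdot> (dot n \<cdot> q) \<cdot> Var t \<approx> dist_laplace n \<cdot> (q \<cdot> Var t)) \<sqinter>
         q \<cdot> Const 0 \<approx> u \<sqinter>
         dot n \<cdot> q \<cdot> Const 0 \<approx> v)"

definition sphere :: trm where
  "sphere =
     (let t = (''t'', Line); f = (''f'', Fun (vec 3) Line); p = (''phi'', Line);
          q = (''theta'', Line)
      in Lam t (Lam f
           (integral_op \<cdot> Const 0 \<cdot> Const pi \<cdot> Lam p
             (integral_op \<cdot> Const 0 \<cdot> Const (2 * pi) \<cdot> Lam q
               (Var f \<cdot> tup [Var t \<otimes> Cos (Var q) \<otimes> Sin (Var p),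
                             Var t \<otimes> Sin (Var q) \<otimes> Sin (Var p),
                             Var t \<otimes> Cos (Var p)]
                \<otimes> Sin (Var p))))))"

definition ball :: trm where
  "ball =
     (let t = (''t'', Line); f = (''f'', Fun (vec 3) Line); s = (''s'', Line);
          p = (''phi'', Line); q = (''theta'', Line)
      in Lam t (Lam f
           (integral_op \<cdot> Const 0 \<cdot> Const 1 \<cdot> Lam s
             (integral_op \<cdot> Const 0 \<cdot> Const pi \<cdot> Lam p
               (integral_op \<cdot> Const 0 \<cdot> Const (2 * pi) \<cdot> Lam q
                 (Var f \<cdot> tup [Var t \<otimes> Var s \<otimes> Cos (Var q) \<otimes> Sin (Var p),
                               Var t \<otimes> Var s \<otimes> Sin (Var q) \<otimes> Sin (Var p),
                               Var t \<otimes> Var s \<otimes> Cos (Var p)]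
                  \<otimes> (Var s \<otimes> Var s) \<otimes> Sin (Var p)))))))"

definition proj_xy :: trm where
  "proj_xy = (let x = (''x'', vec 3) in Lam x (tup [coord 0 (Var x), coord 1 (Var x)]))"

section \<open>The two families of planar distributions\<close>

abbreviation time :: var where
  "time \<equiv> (''t'', Line)"

definition sphere_family :: trm where
  "sphere_family =
     Lam time (dist_scale 2 \<cdot> Const (1 / (4 * pi)) \<cdot>
       (push 3 2 \<cdot> proj_xy \<cdot> (dist_scale 3 \<cdot> Var time \<cdot> (sphere \<cdot> Var time))))"

definition sphere_ball_family :: trm where
  "sphere_ball_family =
     Lam time (dist_scale 2 \<cdot> Const (1 / (4 * pi)) \<cdot>
       (push 3 2 \<cdot> proj_xy \<cdot>
         (dist_add 3 \<cdot> (sphere \<cdot> Var time) \<cdot>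
           (dist_scale 3 \<cdot> (Var time \<otimes> Var time) \<cdot> (dist_laplace 3 \<cdot> (ball \<cdot> Var time))))))"

lemmas term_defs = tup_def coord_def Const_def Plus_def Times_def Sin_def Cos_def inf_zero_def
  derivative_def integral_op_def partial_def laplace_def Kock_Lawvere_def Integration_def Dist_def
  linear_dist_def dist_zero_def dist_add_def dist_scale_def dirac_def dist_laplace_def push_def
  dot_def wave_solution_def sphere_def ball_def proj_xy_def sphere_family_def
  sphere_ball_family_def

lemma wt_axioms: "wt_fm {} Kock_Lawvere" "wt_fm {} Integration"
  by (simp_all add: term_defs Let_def numeral_2_eq_2)

lemma wt_statement:
  "wt_fm {} (wave_solution 2 sphere_family (dist_zero 2) (dirac 2))"
  "wt_fm {} (wave_solution 2 sphere_ball_family (dirac 2) (dist_zero 2))"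
  by (simp_all add: term_defs Let_def eval_nat_numeral)

end

theory Submission
  imports Defs
begin

text \<open>
  A sentence of the internal language is evaluated at generalized elements: arrows from an
  arbitrary stage \<open>X\<close>. The arrows from \<open>X\<close> to the line form a commutative ring, a function of an
  internal variable is a family of operations on arrows that commutes with change of stage, and
  the elements of \<open>D\<close> are the arrows \<open>e\<close> with \<open>e\<^sup>2 = 0\<close>. By the Kock--Lawvere axiom each such family
  \<open>N\<close> has a unique slope \<open>b\<close> with \<open>N e = N 0 + e b\<close> for nilsquare \<open>e\<close> (\<open>slope_ex1\<close>). Ordinary and
  partial derivatives and time derivatives of maps into the distributions are slopes. So they are
  found by expanding up to \<open>e\<^sup>2 = 0\<close>, and two functions with the same derivative and the same value
  at a point agree by the integration axiom.

  Thereafter the theorem is a calculation with integrals. Composing a function \<open>f\<close> of two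
  variables with the projection \<open>p\<close> gives a function independent of the third coordinate, and
  \<open>\<Delta>(f \<circ> p) = \<Delta>f \<circ> p\<close> (\<open>lap_pull\<close>). Hence only the coordinates \<open>x\<close> and \<open>y\<close> of the points of the
  sphere matter. Let \<open>S(t)\<close> and \<open>T(t)\<close> be the values of the distribution \<open>S\<^sup>t\<close> at \<open>f \<circ> p\<close> and at
  \<open>\<Delta>f \<circ> p\<close>, and let \<open>B(t)\<close> be the value of \<open>B\<^sup>t\<close> at \<open>\<Delta>f \<circ> p\<close>. Then the two families send \<open>f\<close> to
  \<open>t S / (4\<pi>)\<close> and \<open>(S + t\<^sup>2 B) / (4\<pi>)\<close>. Two identities hold:

  \<^item> \<open>S' = t B\<close>, the divergence theorem (\<open>rad_eq_ball_mean\<close>);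
  \<^item> \<open>3 B + t B' = T\<close> (\<open>ball_mean_euler\<close>).

  By the first one \<open>(t S)' = S + t\<^sup>2 B\<close>, and with the second one \<open>(S + t\<^sup>2 B)' = t (3 B + t B') = t T\<close>.
  So the second family is the derivative of the first one, and the derivative of the second family
  at \<open>f\<close> is the first one at \<open>\<Delta>f\<close>; both therefore satisfy the wave equation. At \<open>t = 0\<close> they are
  \<open>0\<close> and \<open>f(0)\<close>, because \<open>S(0) = 4\<pi> f(0)\<close>.

  Both identities are obtained by integrating a derivative in \<open>s\<close> from \<open>0\<close> to \<open>1\<close>: the second one
  from \<open>s\<^sup>3 T(t s)\<close>, and the first one from \<open>s\<^sup>2 S'(t s)\<close>, whose derivative is known from
  \<open>t S'' + 2 S' = t T\<close> (\<open>sphere_divergence\<close>). That equation says that the divergence, on the sphere,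
  of the tangential part of the gradient of \<open>f \<circ> p\<close> has integral \<open>0\<close>. It comes from integrals of
  derivatives with respect to the two angles, without division by \<open>t\<close>, since \<open>t\<close> need not be
  invertible.
\<close>

section \<open>Elementary smooth functions\<close>

text \<open>
  The last rule covers sine and cosine and also the remainders of their Taylor expansions, which
  occur when an argument is moved by an infinitesimal. The functions need closure under partial
  derivatives, because smoothness is coinductive.
\<close>

inductive elementary :: "nat \<Rightarrow> ((nat \<Rightarrow> real) \<Rightarrow> real) \<Rightarrow> bool" for n where
  const: "elementary n (\<lambda>x. c)"
| coordinate: "i < n \<Longrightarrow> elementary n (\<lambda>x. x i)"
| add: "elementary n f \<Longrightarrow> elementary n g \<Longrightarrow> elementary n (\<lambda>x. f x + g x)"
| mult: "elementary n f \<Longrightarrow> elementary n g \<Longrightarrow> elementary n (\<lambda>x. f x * g x)"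
| series: "(\<And>z. summable (\<lambda>k. c k * z ^ k)) \<Longrightarrow> elementary n f \<Longrightarrow>
    elementary n (\<lambda>x. \<Sum>k. c k * f x ^ k)"

lemma elementary_continuous: "elementary n f \<Longrightarrow> continuous_on UNIV f"
proof (induction rule: elementary.induct)
  case (series c f)
  have "continuous_on UNIV (\<lambda>z. \<Sum>k. c k * z ^ k)"
    using DERIV_isCont[OF termdiffs_strong_converges_everywhere[OF series(1)]]
    by (simp add: continuous_at_imp_continuous_on)
  then show ?case
    by (rule continuous_on_compose2[OF _ series(3)]) simp
qed (auto intro!: continuous_intros continuous_on_product_coordinates)

lemma elementary_partial:
  "elementary n f \<Longrightarrow> \<exists>g. elementary n g \<and>
     (\<forall>x. ((\<lambda>s. f (x(i := s))) has_real_derivative g x) (at (x i)))"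
proof (induction rule: elementary.induct)
  case (const c)
  then show ?case
    by (intro exI[of _ "\<lambda>x. 0"]) (auto intro: elementary.const)
next
  case (coordinate j)
  then show ?case
    by (intro exI[of _ "\<lambda>x. if j = i then 1 else 0"])
      (auto intro: elementary.const)
next
  case (add f g)
  then obtain f' g' where
    "elementary n f'" "\<forall>x. ((\<lambda>s. f (x(i := s))) has_real_derivative f' x) (at (x i))"
    "elementary n g'" "\<forall>x. ((\<lambda>s. g (x(i := s))) has_real_derivative g' x) (at (x i))"
    by blast
  then show ?case
    by (intro exI[of _ "\<lambda>x. f' x + g' x"]) (simp add: elementary.add DERIV_add del: fun_upd_apply)
next
  case (mult f g)
  then obtain f' g' where
    f': "elementary n f'" "\<forall>x. ((\<lambda>s. f (x(i := s))) has_real_derivative f' x) (at (x i))" and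
    g': "elementary n g'" "\<forall>x. ((\<lambda>s. g (x(i := s))) has_real_derivative g' x) (at (x i))"
    by blast
  have "((\<lambda>s. f (x(i := s)) * g (x(i := s))) has_real_derivative f' x * g x + g' x * f x) (at (x i))" for x
    using DERIV_mult[OF f'(2)[rule_format, of x] g'(2)[rule_format, of x]] by simp
  then show ?case
    using mult.hyps f'(1) g'(1) by (intro exI[of _ "\<lambda>x. f' x * g x + g' x * f x"])
      (simp add: elementary.add elementary.mult del: fun_upd_apply)
next
  case (series c f)
  then obtain f' where
    f': "elementary n f'" "\<forall>x. ((\<lambda>s. f (x(i := s))) has_real_derivative f' x) (at (x i))"
    by blast
  have "((\<lambda>s. \<Sum>k. c k * f (x(i := s)) ^ k) has_real_derivative
      (\<Sum>k. diffs c k * f x ^ k) * f' x) (at (x i))" for x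
    using DERIV_chain2[OF _ f'(2)[rule_format, of x], of "\<lambda>z. \<Sum>k. c k * z ^ k"]
      termdiffs_strong_converges_everywhere[OF series(1)] by simp
  moreover have "summable (\<lambda>k. diffs c k * z ^ k)" for z
    using termdiff_converges_all[OF series(1)] .
  ultimately show ?case
    using series.hyps f'(1) by (intro exI[of _ "\<lambda>x. (\<Sum>k. diffs c k * f x ^ k) * f' x"])
      (simp add: elementary.mult elementary.series del: fun_upd_apply)
qed

text \<open>
  The class contains the partial derivatives of its members, so it is contained in the largest
  class with this property.
\<close>

lemma elementary_smooth: "elementary n f \<Longrightarrow> smooth f"
proof (coinduction arbitrary: f rule: smooth.coinduct)
  case (smooth f)
  then have "\<exists>g. elementary n g \<and>
     (\<forall>x. ((\<lambda>s. f (x(i := s))) has_real_derivative g x) (at (x i)))" for i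
    by (rule elementary_partial)
  then obtain g where g: "elementary n (g i)"
    "((\<lambda>s. f (x(i := s))) has_real_derivative g i x) (at (x i))" for i x
    by metis
  have "(\<lambda>x. deriv (\<lambda>s. f (x(i := s))) (x i)) = g i" for i
    using g(2) by (auto intro: DERIV_imp_deriv)
  then show ?case
    using g(1) real_differentiable_def g(2) elementary_continuous[OF smooth] by metis
qed

lemma elementary_Cinf: "elementary n f \<Longrightarrow> f \<in> Cinf n"
proof -
  assume f: "elementary n f"
  then have "f x = f y" if "\<forall>i<n. x i = y i" for x y
    using that by (induction rule: elementary.induct) auto
  with f show ?thesis
    by (auto simp: Cinf_def elementary_smooth)
qed

lemma elementary_sin: "elementary n f \<Longrightarrow> elementary n (\<lambda>x. sin (f x))"
proof -
  have "summable (\<lambda>k. sin_coeff k * z ^ k)" for z :: real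
    using summable_norm_cancel[OF summable_norm_sin[of z]] by simp
  then show "elementary n f \<Longrightarrow> ?thesis"
    using elementary.series[of sin_coeff n f] by (simp add: sin_def)
qed

lemma elementary_cos: "elementary n f \<Longrightarrow> elementary n (\<lambda>x. cos (f x))"
proof -
  have "summable (\<lambda>k. cos_coeff k * z ^ k)" for z :: real
    using summable_norm_cancel[OF summable_norm_cos[of z]] by simp
  then show "elementary n f \<Longrightarrow> ?thesis"
    using elementary.series[of cos_coeff n f] by (simp add: cos_def)
qed

text \<open>
  The second Hadamard quotient at \<open>0\<close> of an everywhere convergent power series is again such a
  series. If \<open>y\<^sup>2 = 0\<close>, the last summand vanishes and the function is affine.
\<close>

lemma elementary_series_remainder:
  assumes c: "\<And>z::real. summable (\<lambda>k. c k * z ^ k)"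
  obtains q where "\<And>n f. elementary n f \<Longrightarrow> elementary n (\<lambda>x. q (f x))"
    "\<And>y. (\<Sum>k. c k * y ^ k) = c 0 + c 1 * y + y * y * q y"
proof
  have s: "summable (\<lambda>k. c (k + 2) * z ^ k)" for z :: real
  proof (cases "z = 0")
    case False
    have "summable (\<lambda>k. c (k + 2) * z ^ (k + 2))"
      using c summable_iff_shift[of "\<lambda>k. c k * z ^ k" 2] by simp
    from summable_mult[OF this, of "1 / z^2"] False show ?thesis
      by (simp add: power_add field_simps)
  qed (auto simp: power_0_left intro!: summable_finite[of "{0}"] split: if_splits)
  then show "elementary n f \<Longrightarrow> elementary n (\<lambda>x. \<Sum>k. c (k + 2) * f x ^ k)" for n f
    by (rule elementary.series)
  show "(\<Sum>k. c k * y ^ k) = c 0 + c 1 * y + y * y * (\<Sum>k. c (k + 2) * y ^ k)" for y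
    using suminf_split_initial_segment[OF c[of y], of 2] suminf_mult[OF s[of y], of "y * y"]
    by (simp add: numeral_2_eq_2 algebra_simps)
qed

declare elementary.const [simp] elementary.coordinate [simp] elementary.add [simp] elementary.mult [simp]
  elementary_sin [simp] elementary_cos [simp]

lemma elementary_uminus [simp]: "elementary n f \<Longrightarrow> elementary n (\<lambda>x. - f x)"
  using elementary.mult[OF elementary.const[of n "- 1"]] by simp

lemma elementary_diff [simp]:
  "elementary n f \<Longrightarrow> elementary n g \<Longrightarrow> elementary n (\<lambda>x. f x - g x)"
  using elementary.add[of n f "\<lambda>x. - g x"] by simp

context well_adapted_model
begin

section \<open>Generalized elements\<close>

abbreviation comp (infixr \<open>\<odot>\<close> 75) where "g \<odot> f \<equiv> cmp M g f"
abbreviation L where "L \<equiv> line M"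
abbreviation power_of_line (\<open>Rn\<close>) where "Rn n \<equiv> obj M (vec n)"

text \<open>
  Typing is expressed by equations for source and target, since the simplifier can derive those
  of a composite arrow from those of its parts.
\<close>

lemma in_hom: "f \<in> hom M X Y \<longleftrightarrow> src M f = X \<and> tgt M f = Y"
  by (simp add: hom_def)

lemma ide_type [simp]: "src M (ide M X) = X" "tgt M (ide M X) = X"
  using ide_hom[of X] by (simp_all add: in_hom)

lemma comp_type [simp]:
  "tgt M f = src M g \<Longrightarrow> src M (g \<odot> f) = src M f"
  "tgt M f = src M g \<Longrightarrow> tgt M (g \<odot> f) = tgt M g"
  using cmp_hom[of f "src M f" "tgt M f" g "tgt M g"] by (simp_all add: in_hom)

lemma comp_assoc [simp]:
  "tgt M f = src M g \<Longrightarrow> tgt M g = src M h \<Longrightarrow> (h \<odot> g) \<odot> f = h \<odot> g \<odot> f"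
  using cmp_assoc[of f "src M f" "tgt M f" g "tgt M g" h "tgt M h"] by (simp add: in_hom)

lemma comp_ide [simp]:
  "src M f = X \<Longrightarrow> f \<odot> ide M X = f" "tgt M f = X \<Longrightarrow> ide M X \<odot> f = f"
  using cmp_ide[of f "src M f" "tgt M f"] ide_cmp[of f "src M f" "tgt M f"] by (auto simp: in_hom)

lemma bang_type [simp]: "src M (bang M X) = X" "tgt M (bang M X) = one M"
proof -
  have "bang M X \<in> hom M X (one M)"
    by (simp add: terminal)
  then show "src M (bang M X) = X" "tgt M (bang M X) = one M"
    by (simp_all add: in_hom)
qed

lemma bang_unique:
  assumes "tgt M f = one M" shows "f = bang M (src M f)"
proof -
  have "f \<in> hom M (src M f) (one M)"
    by (simp add: in_hom assms)
  then show ?thesis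
    by (simp only: terminal singleton_iff)
qed

lemma bang_comp [simp]: "tgt M h = X \<Longrightarrow> bang M X \<odot> h = bang M (src M h)"
  using bang_unique[of "bang M X \<odot> h"] by simp

lemma pr_type [simp]:
  "src M (pr1 M A B) = prd M A B" "tgt M (pr1 M A B) = A"
  "src M (pr2 M A B) = prd M A B" "tgt M (pr2 M A B) = B"
  using pr1_hom[of A B] pr2_hom[of A B] by (simp_all add: in_hom)

lemma pair_type [simp]:
  "src M f = src M g \<Longrightarrow> src M (pair M f g) = src M g"
  "src M f = src M g \<Longrightarrow> tgt M (pair M f g) = prd M (tgt M f) (tgt M g)"
  using pair_hom[of f "src M f" "tgt M f" g "tgt M g"] by (simp_all add: in_hom)

lemma pr_pair [simp]:
  assumes "src M f = src M g" "tgt M f = A" "tgt M g = B"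
  shows "pr1 M A B \<odot> pair M f g = f" "pr2 M A B \<odot> pair M f g = g"
  using assms pr1_pair[of f "src M f" "tgt M f" g "tgt M g"]
    pr2_pair[of f "src M f" "tgt M f" g "tgt M g"] by (simp_all add: in_hom)

lemma pair_eta: "tgt M f = prd M A B \<Longrightarrow> pair M (pr1 M A B \<odot> f) (pr2 M A B \<odot> f) = f"
  using pair_unique[of f "src M f" A B] by (simp add: in_hom)

lemma pair_eqI:
  assumes "tgt M f = prd M A B" "tgt M g = prd M A B" "src M f = src M g"
    "pr1 M A B \<odot> f = pr1 M A B \<odot> g" "pr2 M A B \<odot> f = pr2 M A B \<odot> g"
  shows "f = g"
proof -
  have "f = pair M (pr1 M A B \<odot> f) (pr2 M A B \<odot> f)"
    by (rule pair_eta[OF assms(1), symmetric])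
  also have "\<dots> = pair M (pr1 M A B \<odot> g) (pr2 M A B \<odot> g)"
    by (simp only: assms(4,5))
  also have "\<dots> = g"
    by (rule pair_eta[OF assms(2)])
  finally show ?thesis .
qed

lemma pair_comp [simp]:
  assumes "src M f = src M g" "tgt M h = src M g"
  shows "pair M f g \<odot> h = pair M (f \<odot> h) (g \<odot> h)"
proof (rule pair_eqI[of _ "tgt M f" "tgt M g"])
  show "pr1 M (tgt M f) (tgt M g) \<odot> pair M f g \<odot> h
    = pr1 M (tgt M f) (tgt M g) \<odot> pair M (f \<odot> h) (g \<odot> h)"
    using assms comp_assoc[of h "pair M f g" "pr1 M (tgt M f) (tgt M g)"] by simp
  show "pr2 M (tgt M f) (tgt M g) \<odot> pair M f g \<odot> h
    = pr2 M (tgt M f) (tgt M g) \<odot> pair M (f \<odot> h) (g \<odot> h)"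
    using assms comp_assoc[of h "pair M f g" "pr2 M (tgt M f) (tgt M g)"] by simp
qed (use assms in simp_all)

lemma pair_pr [simp]: "pair M (pr1 M A B) (pr2 M A B) = ide M (prd M A B)"
  by (rule pair_eqI[of _ A B]) simp_all

lemma ev_type [simp]: "src M (ev M A B) = prd M (expo M A B) A" "tgt M (ev M A B) = B"
  using ev_hom[of A B] by (simp_all add: in_hom)

lemma cur_type [simp]:
  "src M f = prd M X A \<Longrightarrow> src M (cur M X A f) = X"
  "src M f = prd M X A \<Longrightarrow> tgt M (cur M X A f) = expo M A (tgt M f)"
  using cur_hom[of f X A "tgt M f"] by (simp_all add: in_hom)

definition app where "app B F a = ev M (tgt M a) B \<odot> pair M F a"

lemma app_type [simp]:
  assumes "src M F = src M a" "tgt M F = expo M (tgt M a) B"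
  shows "src M (app B F a) = src M a" "tgt M (app B F a) = B"
  using assms by (simp_all add: app_def)

lemma app_comp [simp]:
  assumes "src M F = src M a" "tgt M F = expo M (tgt M a) B" "tgt M h = src M a"
  shows "app B F a \<odot> h = app B (F \<odot> h) (a \<odot> h)"
  using assms by (simp add: app_def)

lemma app_cur [simp]:
  assumes "src M f = prd M X A" "tgt M f = B" "tgt M h = X" "tgt M a = A" "src M h = src M a"
  shows "app B (cur M X A f \<odot> h) a = f \<odot> pair M h a"
proof -
  have "f \<odot> pair M h a
    = (ev M A B \<odot> pair M (cur M X A f \<odot> pr1 M X A) (pr2 M X A)) \<odot> pair M h a"
    using ev_cur[of f X A B] assms by (simp add: in_hom)
  also have "\<dots> = app B (cur M X A f \<odot> h) a"
    using assms by (simp add: app_def)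
  finally show ?thesis by simp
qed

lemma app_cur_ide [simp]:
  assumes "src M f = prd M X A" "tgt M f = B" "tgt M a = A" "src M a = X"
  shows "app B (cur M X A f) a = f \<odot> pair M (ide M X) a"
  using app_cur[of f X A B "ide M X" a] assms by simp

text \<open>
  Functions have to be compared at arguments at all later stages; the arguments at the stage of
  the functions may be too few. The generic argument, a projection, suffices.
\<close>

lemma expo_eqI:
  assumes "tgt M F = expo M A B" "tgt M G = expo M A B" "src M F = src M G"
    "\<And>h a. tgt M h = src M G \<Longrightarrow> tgt M a = A \<Longrightarrow> src M h = src M a \<Longrightarrow>
      app B (F \<odot> h) a = app B (G \<odot> h) a"
  shows "F = G"
proof -
  have "F = cur M (src M G) A (app B (F \<odot> pr1 M (src M G) A) (pr2 M (src M G) A))"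
    "G = cur M (src M G) A (app B (G \<odot> pr1 M (src M G) A) (pr2 M (src M G) A))"
    using cur_unique[of F "src M G" A B] cur_unique[of G "src M G" A B] assms(1-3)
    by (simp_all add: in_hom app_def)
  moreover note assms(4)[of "pr1 M (src M G) A" "pr2 M (src M G) A"]
  ultimately show ?thesis by simp
qed

text \<open>
  \<open>N h a\<close> is the value of a function with parameters at stage \<open>X\<close> at the argument \<open>a\<close>, after the
  change of stage \<open>h\<close>. By the Yoneda lemma such natural families are the same as arrows
  \<open>X \<rightarrow> expo A B\<close>. This replaces lambda terms: functions are given by their values, and \<open>lam\<close>
  internalizes them by the value at the generic argument.
\<close>

definition natural where
  "natural X A B N \<longleftrightarrow> (\<forall>h a. tgt M h = X \<longrightarrow> tgt M a = A \<longrightarrow> src M h = src M a \<longrightarrow>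
     src M (N h a) = src M a \<and> tgt M (N h a) = B \<and>
     (\<forall>k. tgt M k = src M a \<longrightarrow> N h a \<odot> k = N (h \<odot> k) (a \<odot> k)))"

definition lam where "lam X A N = cur M X A (N (pr1 M X A) (pr2 M X A))"

lemma naturalI:
  assumes "\<And>h a. tgt M h = X \<Longrightarrow> tgt M a = A \<Longrightarrow> src M h = src M a \<Longrightarrow>
      src M (N h a) = src M a \<and> tgt M (N h a) = B"
    "\<And>h a k. tgt M h = X \<Longrightarrow> tgt M a = A \<Longrightarrow> src M h = src M a \<Longrightarrow> tgt M k = src M a \<Longrightarrow>
      N h a \<odot> k = N (h \<odot> k) (a \<odot> k)"
  shows "natural X A B N"
  using assms by (simp add: natural_def)

lemma natural_type:
  assumes "natural X A B N" "tgt M h = X" "tgt M a = A" "src M h = src M a"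
  shows "src M (N h a) = src M a" "tgt M (N h a) = B"
  using assms by (simp_all add: natural_def)

lemma natural_comp:
  assumes "natural X A B N" "tgt M h = X" "tgt M a = A" "src M h = src M a" "tgt M k = src M a"
  shows "N h a \<odot> k = N (h \<odot> k) (a \<odot> k)"
  using assms by (simp add: natural_def)

lemma natural_base_change:
  assumes "natural X A B N" "tgt M k = X"
  shows "natural (src M k) A B (\<lambda>h. N (k \<odot> h))"
  by (rule naturalI) (use assms in \<open>simp_all add: natural_type natural_comp\<close>)

lemma lam_type [simp]:
  assumes "natural X A B N"
  shows "src M (lam X A N) = X" "tgt M (lam X A N) = expo M A B"
  using assms by (simp_all add: lam_def natural_type)

lemma app_lam [simp]:
  assumes "natural X A B N" "tgt M h = X" "tgt M a = A" "src M h = src M a"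
  shows "app B (lam X A N \<odot> h) a = N h a"
  using assms by (simp add: lam_def natural_type natural_comp)

lemma app_lam_ide [simp]:
  assumes "natural X A B N" "tgt M a = A" "src M a = X"
  shows "app B (lam X A N) a = N (ide M X) a"
  using app_lam[of X A B N "ide M X" a] assms by simp

lemma lam_comp:
  assumes "natural X A B N" "tgt M k = X"
  shows "lam X A N \<odot> k = lam (src M k) A (\<lambda>h. N (k \<odot> h))"
  by (rule expo_eqI[of _ A B]) (use assms natural_base_change[OF assms] in simp_all)

section \<open>The ring of generalized numbers\<close>

lemma Rn_simps [simp]:
  "Rn 0 = one M" "Rn 1 = prd M L (one M)" "Rn (Suc 0) = prd M L (one M)"
  "Rn 2 = prd M L (prd M L (one M))"
  "Rn 3 = prd M L (prd M L (prd M L (one M)))"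
  by (simp_all add: eval_nat_numeral)

lemma smap_type [simp]:
  assumes "f \<in> Cinf n" shows "src M (smap M n f) = Rn n" "tgt M (smap M n f) = L"
  using assms smap_bij[of n] by (auto simp: bij_betw_def in_hom)

lemma elementary_type [simp]:
  assumes "elementary n f" shows "src M (smap M n f) = Rn n" "tgt M (smap M n f) = L"
  using assms elementary_Cinf by simp_all

definition const where "const X c = smap M 0 (\<lambda>_. c) \<odot> bang M X"
definition plus (infixl \<open>\<boxplus>\<close> 65)
  where "a \<boxplus> b = smap M 2 (\<lambda>x. x 0 + x 1) \<odot> pair M a (pair M b (bang M (src M a)))"
definition times (infixl \<open>\<boxtimes>\<close> 70)
  where "a \<boxtimes> b = smap M 2 (\<lambda>x. x 0 * x 1) \<odot> pair M a (pair M b (bang M (src M a)))"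
definition sine where "sine a = smap M 1 (\<lambda>x. sin (x 0)) \<odot> pair M a (bang M (src M a))"
definition cosine where "cosine a = smap M 1 (\<lambda>x. cos (x 0)) \<odot> pair M a (bang M (src M a))"

lemma const_type [simp]: "src M (const X c) = X" "tgt M (const X c) = L"
  by (simp_all add: const_def)

lemma const_comp [simp]: "tgt M h = X \<Longrightarrow> const X c \<odot> h = const (src M h) c"
  by (simp add: const_def)

lemma plus_type [simp]:
  assumes "src M a = src M b" "tgt M a = L" "tgt M b = L"
  shows "src M (a \<boxplus> b) = src M b" "tgt M (a \<boxplus> b) = L"
  using assms by (simp_all add: plus_def)

lemma plus_comp [simp]:
  assumes "src M a = src M b" "tgt M a = L" "tgt M b = L" "tgt M h = src M b"
  shows "(a \<boxplus> b) \<odot> h = a \<odot> h \<boxplus> b \<odot> h"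
  using assms by (simp add: plus_def)

lemma times_type [simp]:
  assumes "src M a = src M b" "tgt M a = L" "tgt M b = L"
  shows "src M (a \<boxtimes> b) = src M b" "tgt M (a \<boxtimes> b) = L"
  using assms by (simp_all add: times_def)

lemma times_comp [simp]:
  assumes "src M a = src M b" "tgt M a = L" "tgt M b = L" "tgt M h = src M b"
  shows "(a \<boxtimes> b) \<odot> h = (a \<odot> h) \<boxtimes> (b \<odot> h)"
  using assms by (simp add: times_def)

lemma sine_type [simp]:
  assumes "tgt M a = L"
  shows "src M (sine a) = src M a" "tgt M (sine a) = L"
    "src M (cosine a) = src M a" "tgt M (cosine a) = L"
  using assms by (simp_all add: sine_def cosine_def)

lemma sine_comp [simp]:
  assumes "tgt M a = L" "tgt M h = src M a"
  shows "sine a \<odot> h = sine (a \<odot> h)" "cosine a \<odot> h = cosine (a \<odot> h)"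
  using assms by (simp_all add: sine_def cosine_def)

lemma tup_arr_type [simp]:
  assumes "set as \<subseteq> hom M X L"
  shows "src M (tup_arr M X as) = X" "tgt M (tup_arr M X as) = Rn (length as)"
  using assms by (induction as) (simp_all add: in_hom)

lemma tup_arr_comp:
  assumes "set as \<subseteq> hom M X L" "tgt M h = X"
  shows "tup_arr M X as \<odot> h = tup_arr M (src M h) (map (\<lambda>a. a \<odot> h) as)"
  using assms by (induction as) (simp_all add: in_hom)

definition val where "val X as f = smap M (length as) f \<odot> tup_arr M X as"

lemma val_type [simp]:
  assumes "set as \<subseteq> hom M X L" "elementary (length as) f"
  shows "src M (val X as f) = X" "tgt M (val X as f) = L"
  using assms by (simp_all add: val_def)

lemma vec_diff: "j < n \<Longrightarrow> vec (n - j) = Prod Line (vec (n - Suc j))"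
  by (metis Suc_diff_Suc vec.simps(2))

lemma ty_of_Snd: "j \<le> n \<Longrightarrow> ty_of ((Snd ^^ j) (Var (x, vec n))) = vec (n - j)"
proof (induction j)
  case (Suc j)
  then show ?case by (simp add: vec_diff)
qed simp

lemma den_Snd_type:
  assumes "j \<le> n" "tgt M (r (x, vec n)) = Rn n" "src M (r (x, vec n)) = X"
  shows "src M (den M X r ((Snd ^^ j) (Var (x, vec n)))) = X"
    "tgt M (den M X r ((Snd ^^ j) (Var (x, vec n)))) = Rn (n - j)"
  using assms
proof (induction j)
  case (Suc j)
  case 1
  have n: "vec (n - j) = Prod Line (vec (n - Suc j))"
    using 1 by (simp add: vec_diff)
  show ?case using Suc 1 n by (simp add: ty_of_Snd)
next
  case (Suc j)
  case 2
  have n: "vec (n - j) = Prod Line (vec (n - Suc j))"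
    using 2 by (simp add: vec_diff)
  show ?case using Suc 2 n by (simp add: ty_of_Snd)
qed simp_all

lemma den_Snd_tup:
  assumes "length as = n" "set as \<subseteq> hom M X L" "j \<le> n" "r (x, vec n) = tup_arr M X as"
  shows "den M X r ((Snd ^^ j) (Var (x, vec n))) = tup_arr M X (drop j as)"
  using assms(3)
proof (induction j)
  case (Suc j)
  have n: "vec (n - j) = Prod Line (vec (n - Suc j))"
    using Suc by (simp add: vec_diff)
  have "drop j as = as ! j # drop (Suc j) as"
    using Suc assms(1) by (simp add: Cons_nth_drop_Suc)
  moreover have "set (drop (Suc j) as) \<subseteq> hom M X L" "as ! j \<in> hom M X L"
    using assms set_drop_subset[of "Suc j" as] Suc nth_mem[of j as] by auto
  ultimately show ?case using Suc n assms(1) by (simp add: ty_of_Snd in_hom)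
qed (use assms in simp)

lemma den_Snd_comp:
  assumes "tgt M (r (x, vec n)) = Rn n" "src M (r (x, vec n)) = X" "j \<le> n"
    "r' (y, vec n) = r (x, vec n) \<odot> h" "src M h = Y" "tgt M h = X"
  shows "den M Y r' ((Snd ^^ j) (Var (y, vec n))) = den M X r ((Snd ^^ j) (Var (x, vec n))) \<odot> h"
  using assms(3)
proof (induction j)
  case (Suc j)
  have n: "vec (n - j) = Prod Line (vec (n - Suc j))"
    using Suc by (simp add: vec_diff)
  show ?case using Suc n assms by (simp add: ty_of_Snd den_Snd_type)
qed (use assms in simp)

text \<open>
  Coordinates are taken with the smooth coordinate functions instead of iterated projections, so
  that they compose with other smooth maps; \<open>den_coord\<close> says that the two coincide.
\<close>

definition crd where "crd n i x = smap M n (\<lambda>x. x i) \<odot> x"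

lemma crd_type [simp]:
  assumes "tgt M x = Rn n" "i < n" shows "src M (crd n i x) = src M x" "tgt M (crd n i x) = L"
  using assms by (simp_all add: crd_def)

lemma crd_comp [simp]:
  assumes "tgt M x = Rn n" "i < n" "tgt M h = src M x" shows "crd n i x \<odot> h = crd n i (x \<odot> h)"
  using assms by (simp add: crd_def)

lemma ty_of_coord: "i < n \<Longrightarrow> ty_of (coord i (Var (x, vec n))) = Line"
  by (simp add: coord_def ty_of_Snd vec_diff)

lemma den_coord:
  assumes "i < n" "tgt M (r (x, vec n)) = Rn n" "src M (r (x, vec n)) = X"
  shows "den M X r (coord i (Var (x, vec n))) = crd n i (r (x, vec n))"
proof -
  have n: "vec (n - i) = Prod Line (vec (n - Suc i))"
    using assms by (simp add: vec_diff)
  have "den M X r ((Snd ^^ i) (Var (x, vec n)))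
    = den M (Rn n) (\<lambda>_. ide M (Rn n)) ((Snd ^^ i) (Var (''x'', vec n))) \<odot> r (x, vec n)"
    by (rule den_Snd_comp) (use assms in simp_all)
  then show ?thesis
    using smap_coord[OF assms(1)] assms n
    by (simp add: crd_def coord_def ty_of_Snd den_Snd_type)
qed

lemma crd_tup_arr:
  assumes "set as \<subseteq> hom M X L" "length as = n" "i < n"
  shows "crd n i (tup_arr M X as) = as ! i"
proof -
  define r :: "var \<Rightarrow> 'a" where "r = (\<lambda>_. tup_arr M X as)"
  have n: "vec (n - i) = Prod Line (vec (n - Suc i))"
    using assms by (simp add: vec_diff)
  have d: "drop i as = as ! i # drop (Suc i) as"
    using assms by (simp add: Cons_nth_drop_Suc)
  have "set (drop (Suc i) as) \<subseteq> hom M X L" "as ! i \<in> hom M X L"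
    using assms set_drop_subset[of "Suc i" as] nth_mem[of i as] by auto
  then have "den M X r (coord i (Var (''x'', vec n))) = as ! i"
    using den_Snd_tup[of as n X i r "''x''"] assms d n
    by (simp add: coord_def r_def ty_of_Snd in_hom)
  moreover have "den M X r (coord i (Var (''x'', vec n))) = crd n i (tup_arr M X as)"
    using den_coord[of i n r "''x''" X] assms by (simp add: r_def)
  ultimately show ?thesis by simp
qed

lemma smap_comp_tup:
  assumes "f \<in> Cinf m" "\<And>i. i < m \<Longrightarrow> elementary (length as) (g i)" "set as \<subseteq> hom M X L"
  shows "smap M m f \<odot> tup_arr M X (map (\<lambda>i. val X as (g i)) [0..<m]) = val X as (\<lambda>x. f (\<lambda>i. g i x))"
proof -
  let ?n = "length as"
  have t: "set (map (\<lambda>i. smap M ?n (g i)) [0..<m]) \<subseteq> hom M (Rn ?n) L"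
    using assms by (auto simp: in_hom)
  have "val X as (\<lambda>x. f (\<lambda>i. g i x))
    = (smap M m f \<odot> tup_arr M (Rn ?n) (map (\<lambda>i. smap M ?n (g i)) [0..<m])) \<odot> tup_arr M X as"
    using smap_cmp[of f m g ?n] assms elementary_Cinf by (simp add: val_def)
  then show ?thesis
    using assms t by (simp add: tup_arr_comp val_def comp_def)
qed

text \<open>
  Functoriality of the assignment of arrows to smooth functions. From left to right, these
  equations collect an expression into the value of a single real function.
\<close>

lemma val_fold:
  assumes "set as \<subseteq> hom M X L"
  shows "const X c = val X as (\<lambda>x. c)"
    "elementary (length as) f \<Longrightarrow> elementary (length as) g \<Longrightarrow>
      val X as f \<boxplus> val X as g = val X as (\<lambda>x. f x + g x)"
    "elementary (length as) f \<Longrightarrow> elementary (length as) g \<Longrightarrow>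
      val X as f \<boxtimes> val X as g = val X as (\<lambda>x. f x * g x)"
    "elementary (length as) f \<Longrightarrow> sine (val X as f) = val X as (\<lambda>x. sin (f x))"
    "elementary (length as) f \<Longrightarrow> cosine (val X as f) = val X as (\<lambda>x. cos (f x))"
proof -
  have e: "elementary 2 (\<lambda>x. x 0 + x 1)" "elementary 2 (\<lambda>x. x 0 * x 1)"
    "elementary 1 (\<lambda>x. sin (x 0))" "elementary 1 (\<lambda>x. cos (x 0))" "elementary 0 (\<lambda>x. c)"
    by simp_all
  note C = e[THEN elementary_Cinf]
  show "const X c = val X as (\<lambda>x. c)"
    using smap_comp_tup[OF C(5) _ assms, of "\<lambda>i. undefined"] by (simp add: const_def)
  assume f: "elementary (length as) f"
  show "sine (val X as f) = val X as (\<lambda>x. sin (f x))"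
    using smap_comp_tup[OF C(3) _ assms, of "\<lambda>i. f"] assms f by (simp add: sine_def)
  show "cosine (val X as f) = val X as (\<lambda>x. cos (f x))"
    using smap_comp_tup[OF C(4) _ assms, of "\<lambda>i. f"] assms f by (simp add: cosine_def)
  assume g: "elementary (length as) g"
  show "val X as f \<boxplus> val X as g = val X as (\<lambda>x. f x + g x)"
    using smap_comp_tup[OF C(1) _ assms, of "\<lambda>i. if i = 0 then f else g"] assms f g
    by (simp add: plus_def numeral_2_eq_2)
  show "val X as f \<boxtimes> val X as g = val X as (\<lambda>x. f x * g x)"
    using smap_comp_tup[OF C(2) _ assms, of "\<lambda>i. if i = 0 then f else g"] assms f g
    by (simp add: times_def numeral_2_eq_2)
qed

text \<open>The premise of a ring identity in the variables \<open>as\<close>.\<close>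

abbreviation elements where
  "elements X \<equiv> list_all (\<lambda>a. src M a = X \<and> tgt M a = L)"

text \<open>
  The elements of a list are the values of the coordinate functions at the list. If they are
  written in this way, \<open>val_fold\<close> turns both sides of a ring identity into values of two real
  functions, which are equal by real algebra. All ring identities are proved like this.
\<close>

lemma line_atoms:
  assumes "elements X as"
  obtains bs where "set bs \<subseteq> hom M X L" "length bs = length as"
    "list_all2 (\<lambda>a i. a = val X bs (\<lambda>x. x i)) as [0..<length as]"
proof
  show *: "set as \<subseteq> hom M X L"
    using assms by (auto simp: list_all_iff in_hom)
  show "list_all2 (\<lambda>a i. a = val X as (\<lambda>x. x i)) as [0..<length as]"
    using crd_tup_arr[OF *] by (auto simp: list_all2_conv_all_nth val_def crd_def)
qed simp

lemma plus_commute: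
  assumes "src M a = X" "src M b = X" "tgt M a = L" "tgt M b = L"
  shows "a \<boxplus> b = b \<boxplus> a"
  by (rule line_atoms[of X "[a, b]"]) (use assms in \<open>simp_all add: val_fold algebra_simps\<close>)


section \<open>Interpretation of terms\<close>

definition env :: "'o \<Rightarrow> (var \<Rightarrow> 'a) \<Rightarrow> bool" where
  "env X r \<longleftrightarrow> (\<forall>v. src M (r v) = X \<and> tgt M (r v) = obj M (snd v))"

lemma env_type: "env X r \<Longrightarrow> src M (r v) = X" "env X r \<Longrightarrow> tgt M (r v) = obj M (snd v)"
  by (simp_all add: env_def del: split_paired_All)

lemma env_restrict [simp]: "env X r \<Longrightarrow> tgt M h = X \<Longrightarrow> env (src M h) (\<lambda>w. r w \<odot> h)"
  by (auto simp add: env_def simp del: split_paired_All)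

lemma env_update [simp]:
  "env X r \<Longrightarrow> src M a = X \<Longrightarrow> tgt M a = obj M (snd v) \<Longrightarrow> env X (r(v := a))"
  by (auto simp add: env_def simp del: split_paired_All)

lemma env_restrict_update [simp]:
  "env X r \<Longrightarrow> tgt M h = X \<Longrightarrow> src M h = Y \<Longrightarrow> src M a = Y \<Longrightarrow> tgt M a = obj M (snd v) \<Longrightarrow>
    env Y ((\<lambda>w. r w \<odot> h)(v := a))"
  by (rule env_update) auto

lemma env_restrict_update' [simp]:
  "env (tgt M h) r \<Longrightarrow> src M h = Y \<Longrightarrow> src M a = Y \<Longrightarrow> tgt M a = obj M (snd v) \<Longrightarrow>
    env Y ((\<lambda>w. r w \<odot> h)(v := a))"
  by (rule env_restrict_update) auto

lemma env_restrict_restrict: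
  "env X r \<Longrightarrow> tgt M h = X \<Longrightarrow> tgt M k = src M h \<Longrightarrow>
    (\<lambda>w. (r w \<odot> h) \<odot> k) = (\<lambda>w. r w \<odot> h \<odot> k)"
  by (auto simp add: env_def simp del: split_paired_All)

lemma env_restrict_ide: "env X r \<Longrightarrow> (\<lambda>w. r w \<odot> ide M X) = r"
  by (auto simp: env_def simp del: split_paired_All)

text \<open>
  The denotation of a term has to commute with change of stage. This is not automatic: the
  definite description in the semantics chooses separately at every stage.
\<close>

definition stable where
  "stable t A \<longleftrightarrow> ty_of t = A \<and> (\<forall>X r. env X r \<longrightarrow>
     src M (den M X r t) = X \<and> tgt M (den M X r t) = obj M A \<and>
     (\<forall>h. tgt M h = X \<longrightarrow> den M (src M h) (\<lambda>w. r w \<odot> h) t = den M X r t \<odot> h))"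

lemma stable_ty: "stable t A \<Longrightarrow> ty_of t = A"
  by (simp add: stable_def)

lemma stable_type:
  "stable t A \<Longrightarrow> env X r \<Longrightarrow> src M (den M X r t) = X"
  "stable t A \<Longrightarrow> env X r \<Longrightarrow> tgt M (den M X r t) = obj M A"
  by (simp_all add: stable_def)

lemma stable_comp:
  "stable t A \<Longrightarrow> env X r \<Longrightarrow> tgt M h = X \<Longrightarrow>
    den M X r t \<odot> h = den M (src M h) (\<lambda>w. r w \<odot> h) t"
  by (simp add: stable_def)

lemma stableI:
  assumes "ty_of t = A"
    "\<And>X r. env X r \<Longrightarrow> src M (den M X r t) = X \<and> tgt M (den M X r t) = obj M A"
    "\<And>X r h. env X r \<Longrightarrow> tgt M h = X \<Longrightarrow> den M (src M h) (\<lambda>w. r w \<odot> h) t = den M X r t \<odot> h"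
  shows "stable t A"
  using assms by (simp add: stable_def)

lemma incl_type [simp]: "src M (incl M) = infs M" "tgt M (incl M) = L"
  using infs_equalizer by (simp_all add: is_equalizer_def)

lemma stable_Var: "stable (Var (x, A)) A"
  by (rule stableI) (simp_all add: env_type)

lemma stable_Star: "stable Star Unit"
  by (rule stableI) simp_all

lemma stable_Tuple: "stable s A \<Longrightarrow> stable t B \<Longrightarrow> stable (Tuple s t) (Prod A B)"
  by (rule stableI) (simp_all add: stable_ty stable_type stable_comp)

lemma stable_Incl: "stable t Infinitesimals \<Longrightarrow> stable (Incl t) Line"
  by (rule stableI) (simp_all add: stable_ty stable_type stable_comp)

lemma stable_Smooth: "elementary n f \<Longrightarrow> stable t (vec n) \<Longrightarrow> stable (Smooth n f t) Line"
  by (rule stableI) (simp_all add: stable_ty stable_type stable_comp)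

lemma den_App [simp]:
  assumes "stable s (Fun A B)" "stable t A" "env X r"
  shows "den M X r (s \<cdot> t) = app (obj M B) (den M X r s) (den M X r t)"
  using assms by (simp add: app_def stable_ty stable_type)

lemma stable_App: "stable s (Fun A B) \<Longrightarrow> stable t A \<Longrightarrow> stable (s \<cdot> t) B"
  by (rule stableI) (simp_all add: den_App[of s A B] stable_ty stable_type stable_comp del: den.simps)

lemma cur_comp:
  assumes "src M f = prd M X A" "tgt M h = X"
  shows "cur M X A f \<odot> h = cur M (src M h) A (f \<odot> pair M (h \<odot> pr1 M (src M h) A) (pr2 M (src M h) A))"
  by (rule expo_eqI[of _ A "tgt M f"]) (use assms in simp_all)

lemma stable_Lam:
  assumes "stable t B" shows "stable (Lam (x, A) t) (Fun A B)"
proof (rule stableI)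
  fix X r h assume r: "env X r" and h: "tgt M h = X"
  let ?A = "obj M A"
  have "den M (prd M (src M h) ?A)
      ((\<lambda>w. (r w \<odot> h) \<odot> pr1 M (src M h) ?A)((x, A) := pr2 M (src M h) ?A)) t
    = den M (prd M X ?A) ((\<lambda>w. r w \<odot> pr1 M X ?A)((x, A) := pr2 M X ?A)) t
        \<odot> pair M (h \<odot> pr1 M (src M h) ?A) (pr2 M (src M h) ?A)"
    (is "den M ?Y ?r' t = den M ?Z ?r t \<odot> ?h")
  proof -
    have "?r' = (\<lambda>w. ?r w \<odot> ?h)"
      using r h by (auto simp: fun_eq_iff env_type)
    then show ?thesis
      using stable_comp[OF assms, of ?Z ?r ?h] r h by simp
  qed
  then show "den M (src M h) (\<lambda>w. r w \<odot> h) (Lam (x, A) t) = den M X r (Lam (x, A) t) \<odot> h"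
    using r h assms by (simp add: cur_comp stable_type)
qed (simp_all add: stable_ty[OF assms] stable_type[OF assms])

lemma app_Lam:
  assumes "stable t B" "env X r" "src M a = X" "tgt M a = obj M A"
  shows "app (obj M B) (den M X r (Lam (x, A) t)) a = den M X (r((x, A) := a)) t"
proof -
  let ?A = "obj M A"
  let ?r = "(\<lambda>w. r w \<odot> pr1 M X ?A)((x, A) := pr2 M X ?A)"
  have "app (obj M B) (den M X r (Lam (x, A) t)) a
    = den M (prd M X ?A) ?r t \<odot> pair M (ide M X) a"
    using assms by (simp add: stable_type)
  also have "\<dots> = den M X (\<lambda>w. ?r w \<odot> pair M (ide M X) a) t"
    using stable_comp[OF assms(1), of "prd M X ?A" ?r "pair M (ide M X) a"] assms by simp
  also have "(\<lambda>w. ?r w \<odot> pair M (ide M X) a) = r((x, A) := a)"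
    using assms by (auto simp: fun_eq_iff env_type)
  finally show ?thesis .
qed

lemma forces_Forall_restrict:
  assumes "forces M X r (Forall v p)" "env X r" "tgt M h = X"
  shows "forces M (src M h) (\<lambda>w. r w \<odot> h) (Forall v p)"
  unfolding forces.simps
proof (intro allI ballI)
  fix Y k a assume k: "k \<in> hom M Y (src M h)" and a: "a \<in> hom M Y (obj M (snd v))"
  then have "forces M Y ((\<lambda>w. r w \<odot> h \<odot> k)(v := a)) p"
    using assms by (simp add: in_hom)
  moreover have "(\<lambda>w. (r w \<odot> h) \<odot> k) = (\<lambda>w. r w \<odot> h \<odot> k)"
    using assms k by (intro env_restrict_restrict) (simp_all add: in_hom)
  ultimately show "forces M Y ((\<lambda>w. (r w \<odot> h) \<odot> k)(v := a)) p"
    by simp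
qed

lemma forces_Equal_restrict:
  assumes "forces M X r (s \<approx> t)" "env X r" "tgt M h = X" "stable s A" "stable t A"
  shows "forces M (src M h) (\<lambda>w. r w \<odot> h) (s \<approx> t)"
  using assms by (simp flip: stable_comp)

text \<open>
  The restriction of a solution to a later stage is a solution there, and by uniqueness it is
  the one that is described. Therefore unique existence is required at all stages, for all
  values of the free variables.
\<close>

lemma stable_Descr:
  assumes ex1: "\<And>X r. env X r \<Longrightarrow>
      \<exists>!a. a \<in> hom M X (obj M A) \<and> forces M X (r((x, A) := a)) p"
    and restrict: "\<And>X r h. forces M X r p \<Longrightarrow> env X r \<Longrightarrow> tgt M h = X \<Longrightarrow>
      forces M (src M h) (\<lambda>w. r w \<odot> h) p"
  shows "stable (Descr (x, A) p) A"
    and "env X r \<Longrightarrow> forces M X (r((x, A) := den M X r (Descr (x, A) p))) p"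
proof -
  have the: "den M X r (Descr (x, A) p) \<in> hom M X (obj M A)
    \<and> forces M X (r((x, A) := den M X r (Descr (x, A) p))) p" if "env X r" for X r
    using theI'[OF ex1[OF that]] by simp
  then show "env X r \<Longrightarrow> forces M X (r((x, A) := den M X r (Descr (x, A) p))) p"
    by blast
  show "stable (Descr (x, A) p) A"
  proof (rule stableI)
    fix X r h assume r: "env X r" and h: "tgt M h = X"
    let ?a = "den M X r (Descr (x, A) p)"
    have "forces M (src M h) (\<lambda>w. (r((x, A) := ?a)) w \<odot> h) p"
      by (rule restrict[OF conjunct2[OF the[OF r]]])
        (use the[OF r] r h in \<open>simp_all add: in_hom del: den.simps fun_upd_apply\<close>)
    moreover have "(\<lambda>w. (r((x, A) := ?a)) w \<odot> h) = (\<lambda>w. r w \<odot> h)((x, A) := ?a \<odot> h)"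
      by auto
    ultimately have "?a \<odot> h \<in> hom M (src M h) (obj M A) \<and>
      forces M (src M h) ((\<lambda>w. r w \<odot> h)((x, A) := ?a \<odot> h)) p"
      using the[OF r] h by (simp add: in_hom)
    then show "den M (src M h) (\<lambda>w. r w \<odot> h) (Descr (x, A) p) = ?a \<odot> h"
      using the[OF env_restrict[OF r h]] ex1[OF env_restrict[OF r h]] by blast
  next
    fix X r assume "env X r"
    then show "src M (den M X r (Descr (x, A) p)) = X \<and>
        tgt M (den M X r (Descr (x, A) p)) = obj M A"
      using the by (simp add: in_hom)
  qed simp
qed

lemma den_tup: "den M X r (tup ts) = tup_arr M X (map (den M X r) ts)"
  by (induction ts) (simp_all add: tup_def)

lemma stable_tup:
  assumes "list_all (\<lambda>t. stable t Line) ts" "length ts = n" shows "stable (tup ts) (vec n)"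
  using assms
proof (induction ts arbitrary: n)
  case (Cons t ts)
  then show ?case
    using stable_Tuple[of t Line "tup ts" "vec (length ts)"] by (auto simp: tup_def)
qed (auto simp: tup_def stable_Star)

lemma den_Const [simp]: "den M X r (Const c) = const X c"
  by (simp add: Const_def const_def)

lemma den_ops [simp]:
  assumes "src M (den M X r s) = X"
  shows "den M X r (s \<oplus> t) = den M X r s \<boxplus> den M X r t"
    "den M X r (s \<otimes> t) = den M X r s \<boxtimes> den M X r t"
    "den M X r (Sin s) = sine (den M X r s)"
    "den M X r (Cos s) = cosine (den M X r s)"
  using assms
  by (simp_all add: Plus_def Times_def Sin_def Cos_def plus_def times_def sine_def cosine_def den_tup)

lemma stable_ops:
  "stable (Const c) Line"
  "stable s Line \<Longrightarrow> stable t Line \<Longrightarrow> stable (s \<oplus> t) Line"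
  "stable s Line \<Longrightarrow> stable t Line \<Longrightarrow> stable (s \<otimes> t) Line"
  "stable s Line \<Longrightarrow> stable (Sin s) Line"
  "stable s Line \<Longrightarrow> stable (Cos s) Line"
  unfolding Const_def Plus_def Times_def Sin_def Cos_def
  by (auto intro!: stable_Smooth stable_tup stable_Star simp del: vec.simps simp: eval_nat_numeral(1))
    (auto simp: stable_Star)

lemma stable_coord: "i < n \<Longrightarrow> stable (coord i (Var (x, vec n))) Line"
  by (rule stableI) (simp_all add: den_coord env_type ty_of_coord)

lemma list_all_Cons: "P x \<Longrightarrow> list_all P xs \<Longrightarrow> list_all P (x # xs)"
  by simp

lemma list_all_Nil: "list_all P []"
  by simp

lemmas stable_intros = stable_Var stable_Star stable_Incl stable_Lam stable_App stable_ops
  stable_tup stable_coord list_all_Cons list_all_Nil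

section \<open>Operations on distributions\<close>

text \<open>
  The objects of maps from functions to numbers and of functions of \<open>n\<close> variables.
\<close>

abbreviation DD where "DD n \<equiv> obj M (Dist n)"
abbreviation EE where "EE n \<equiv> expo M (Rn n) L"

lemma obj_Dist: "obj M (Dist n) = expo M (EE n) L"
  by (simp add: Dist_def)

lemma stable_dist_add: "stable (dist_add n) (Fun (Dist n) (Fun (Dist n) (Dist n)))"
  unfolding dist_add_def Let_def Dist_def by (rule stable_intros)+

lemma stable_dist_scale: "stable (dist_scale n) (Fun Line (Fun (Dist n) (Dist n)))"
  unfolding dist_scale_def Let_def Dist_def by (rule stable_intros)+

lemma stable_dist_zero: "stable (dist_zero n) (Dist n)"
  unfolding dist_zero_def Let_def Dist_def by (rule stable_intros)+

lemma stable_dirac: "stable (dirac n) (Dist n)"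
  unfolding dirac_def Let_def Dist_def by (rule stable_intros | simp add: list_all_iff stable_ops)+

lemma stable_push:
  "stable (push m n) (Fun (Fun (vec m) (vec n)) (Fun (Dist m) (Dist n)))"
  unfolding push_def Let_def Dist_def by (rule stable_intros)+

lemma stable_proj_xy: "stable proj_xy (Fun (vec 3) (vec 2))"
  unfolding proj_xy_def Let_def by (rule stable_intros | simp)+

lemma app_Var_App:
  assumes "env X r" "stable s A"
  shows "den M X r (Var (x, Fun A B) \<cdot> s) = app (obj M B) (r (x, Fun A B)) (den M X r s)"
  using den_App[of "Var (x, Fun A B)" A B s X r] assms by (simp add: stable_Var)

lemma den_Lam_App:
  assumes "stable u B" "stable s A" "env X r"
  shows "den M X r (Lam (x, A) u \<cdot> s) = den M X (r((x, A) := den M X r s)) u"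
  using den_App[OF stable_Lam[OF assms(1)] assms(2,3)] app_Lam[OF assms(1,3)] assms
  by (simp add: stable_type del: den.simps)

lemma den_Lam_App2:
  assumes u: "stable u C" and s: "stable s A" and t: "stable t B" and r: "env X r"
  shows "den M X r (Lam (x, A) (Lam (y, B) u) \<cdot> s \<cdot> t)
    = den M X (r((x, A) := den M X r s, (y, B) := den M X r t)) u"
  using den_App[OF stable_App[OF stable_Lam[OF stable_Lam[OF u]] s] t r]
    den_Lam_App[OF stable_Lam[OF u] s r] app_Lam[OF u _ _ stable_type(2)[OF t r]] s t r
  by (simp add: stable_type del: den.simps)

lemma den_dist_add:
  assumes "stable m (Dist n)" "stable l (Dist n)" "env X r" "src M f = X" "tgt M f = EE n"
  shows "app L (den M X r (dist_add n \<cdot> m \<cdot> l)) f = app L (den M X r m) f \<boxplus> app L (den M X r l) f"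
proof -
  let ?m = "(''m'', Dist n)" and ?l = "(''l'', Dist n)" and ?f = "(''f'', Fun (vec n) Line)"
  have body: "stable (Var ?m \<cdot> Var ?f \<oplus> Var ?l \<cdot> Var ?f) Line"
    unfolding Dist_def by (rule stable_intros)+
  show ?thesis
    using assms den_Lam_App2[OF stable_Lam[OF body, of "''f''" "Fun (vec n) Line", folded Dist_def] assms(1,2,3), of "''m''" "''l''"]
      app_Lam[OF body, of X "r(?m := den M X r m, ?l := den M X r l)" f "Fun (vec n) Line" "''f''"]
    by (simp add: dist_add_def Let_def stable_type app_Var_App stable_Var Dist_def del: den.simps(6,7))
qed

lemma den_dist_scale:
  assumes "stable a Line" "stable m (Dist n)" "env X r" "src M f = X" "tgt M f = EE n"
  shows "app L (den M X r (dist_scale n \<cdot> a \<cdot> m)) f = den M X r a \<boxtimes> app L (den M X r m) f"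
proof -
  let ?a = "(''a'', Line)" and ?m = "(''m'', Dist n)" and ?f = "(''f'', Fun (vec n) Line)"
  have body: "stable (Var ?a \<otimes> (Var ?m \<cdot> Var ?f)) Line"
    unfolding Dist_def by (rule stable_intros)+
  show ?thesis
    using assms den_Lam_App2[OF stable_Lam[OF body, of "''f''" "Fun (vec n) Line", folded Dist_def] assms(1,2,3), of "''a''" "''m''"]
      app_Lam[OF body, of X "r(?a := den M X r a, ?m := den M X r m)" f "Fun (vec n) Line" "''f''"]
    by (simp add: dist_scale_def Let_def stable_type app_Var_App stable_Var Dist_def del: den.simps(6,7))
qed

lemma den_dist_zero:
  assumes "env X r" "src M f = X" "tgt M f = EE n"
  shows "app L (den M X r (dist_zero n)) f = const X 0"
  using assms app_Lam[OF stable_ops(1)[of 0], of X r f "Fun (vec n) Line" "''f''"]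
  by (simp add: dist_zero_def Let_def del: den.simps(6,7))

lemma den_dirac:
  assumes "env X r" "src M f = X" "tgt M f = EE n"
  shows "app L (den M X r (dirac n)) f = app L f (tup_arr M X (replicate n (const X 0)))"
proof -
  let ?f = "(''f'', Fun (vec n) Line)"
  have z: "stable (tup (replicate n (Const 0))) (vec n)"
    by (rule stable_tup) (simp_all add: list_all_iff stable_ops)
  then have body: "stable (Var ?f \<cdot> tup (replicate n (Const 0))) Line"
    by (rule stable_App[OF stable_Var])
  show ?thesis
    using assms z app_Lam[OF body, of X r f "Fun (vec n) Line" "''f''"]
    by (simp add: dirac_def Let_def app_Var_App den_tup del: den.simps(6,7))
qed

lemma den_push:
  assumes "stable h (Fun (vec m) (vec n))" "stable l (Dist m)" "env X r" "src M f = X" "tgt M f = EE n"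
  shows "app L (den M X r (push m n \<cdot> h \<cdot> l)) f
    = app L (den M X r l) (lam X (Rn m) (\<lambda>k x. app L (f \<odot> k) (app (Rn n) (den M X r h \<odot> k) x)))"
proof -
  let ?h = "(''h'', Fun (vec m) (vec n))" and ?l = "(''l'', Dist m)" and ?f = "(''f'', Fun (vec n) Line)"
    and ?x = "(''x'', vec m)"
  have c: "stable (Var ?h \<cdot> Var ?x) (vec n)" "stable (Var ?f \<cdot> (Var ?h \<cdot> Var ?x)) Line"
    by (rule stable_intros)+
  have g: "stable (Lam ?x (Var ?f \<cdot> (Var ?h \<cdot> Var ?x))) (Fun (vec m) Line)"
    by (rule stable_intros)+
  have body: "stable (Var ?l \<cdot> Lam ?x (Var ?f \<cdot> (Var ?h \<cdot> Var ?x))) Line"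
    unfolding Dist_def by (rule stable_intros)+
  let ?r = "r(?h := den M X r h, ?l := den M X r l, ?f := f)"
  have r: "env X ?r"
    using assms by (simp add: stable_type)
  have "den M X ?r (Lam ?x (Var ?f \<cdot> (Var ?h \<cdot> Var ?x)))
    = lam X (Rn m) (\<lambda>k x. app L (f \<odot> k) (app (Rn n) (den M X r h \<odot> k) x))"
    using assms c by (simp add: lam_def stable_type app_def)
  then have "den M X ?r (Var ?l \<cdot> Lam ?x (Var ?f \<cdot> (Var ?h \<cdot> Var ?x)))
    = app L (den M X r l) (lam X (Rn m) (\<lambda>k x. app L (f \<odot> k) (app (Rn n) (den M X r h \<odot> k) x)))"
    using app_Var_App[OF r g, of "''l''" Line] by (simp add: Dist_def del: den.simps(6,7))
  then show ?thesis
    using assms den_Lam_App2[OF stable_Lam[OF body, of "''f''" "Fun (vec n) Line", folded Dist_def] assms(1,2,3), of "''h''" "''l''"]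
      app_Lam[OF body, of X "r(?h := den M X r h, ?l := den M X r l)" f "Fun (vec n) Line" "''f''"]
    by (simp add: push_def Let_def stable_type Dist_def del: den.simps(6,7))
qed


lemma all_hom_iff:
  "(\<forall>Y. \<forall>h \<in> hom M Y X. \<forall>d \<in> hom M Y A. P Y h d) \<longleftrightarrow>
    (\<forall>h d. tgt M h = X \<longrightarrow> tgt M d = A \<longrightarrow> src M h = src M d \<longrightarrow> P (src M d) h d)"
  unfolding Ball_def in_hom by metis

lemma app_fold: "tgt M a = A \<Longrightarrow> ev M A B \<odot> pair M F a = app B F a"
  by (simp add: app_def)

section \<open>Infinitesimals and slopes\<close>

definition nilsquare where "nilsquare e \<longleftrightarrow> tgt M e = L \<and> e \<boxtimes> e = const (src M e) 0"

lemma nilsquare_type [simp]: "nilsquare e \<Longrightarrow> tgt M e = L"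
  by (simp add: nilsquare_def)

lemma nilsquare_comp [simp]: "nilsquare e \<Longrightarrow> tgt M h = src M e \<Longrightarrow> nilsquare (e \<odot> h)"
  using times_comp[of e e h] by (simp add: nilsquare_def)

text \<open>
  \<open>D\<close> is the equalizer of the square and zero, so its generalized elements may be replaced by
  numbers.
\<close>

lemma incl_bij:
  "bij_betw (\<lambda>d. incl M \<odot> d) (hom M X (infs M)) {e. src M e = X \<and> nilsquare e}"
proof -
  have sq: "smap M 1 (\<lambda>x. x 0 * x 0) \<odot> tup_arr M X [e] = e \<boxtimes> e"
      and z: "smap M 1 (\<lambda>x. 0) \<odot> tup_arr M X [e] = const X 0"
    if "src M e = X" "tgt M e = L" for e
  proof -
    have e: "set [e] \<subseteq> hom M X L" "e = val X [e] (\<lambda>x. x 0)"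
      using that crd_tup_arr[of "[e]" X 1 0] by (auto simp: in_hom val_def crd_def)
    show "smap M 1 (\<lambda>x. x 0 * x 0) \<odot> tup_arr M X [e] = e \<boxtimes> e"
      using val_fold(3)[OF e(1), of "\<lambda>x. x 0" "\<lambda>x. x 0", folded e(2)] by (simp add: val_def)
    show "smap M 1 (\<lambda>x. 0) \<odot> tup_arr M X [e] = const X 0"
      using val_fold(1)[OF e(1), of 0] by (simp add: val_def)
  qed
  have el: "elementary 1 (\<lambda>x. x 0 * x 0)" "elementary 1 (\<lambda>x. 0)"
    by simp_all
  have "{e \<in> hom M X L. (smap M 1 (\<lambda>x. x 0 * x 0) \<odot> tup_arr M L [ide M L]) \<odot> e
      = (smap M 1 (\<lambda>x. 0) \<odot> tup_arr M L [ide M L]) \<odot> e} = {e. src M e = X \<and> nilsquare e}"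
    using el sq z by (auto simp: in_hom nilsquare_def)
  moreover have "bij_betw (cmp M (incl M)) (hom M X (infs M))
    {e \<in> hom M X L. (smap M 1 (\<lambda>x. x 0 * x 0) \<odot> tup_arr M L [ide M L]) \<odot> e
      = (smap M 1 (\<lambda>x. 0) \<odot> tup_arr M L [ide M L]) \<odot> e}"
    using infs_equalizer el unfolding is_equalizer_def by simp
  ultimately show ?thesis by simp
qed

lemma nilsquare_incl [simp]: "tgt M d = infs M \<Longrightarrow> nilsquare (incl M \<odot> d)"
  using bij_betw_imp_surj_on[OF incl_bij[of "src M d"]] by (auto simp: in_hom)

lemma nilsquareE:
  assumes "nilsquare e"
  obtains d where "tgt M d = infs M" "src M d = src M e" "e = incl M \<odot> d"
proof -
  have "e \<in> (\<lambda>d. incl M \<odot> d) ` hom M (src M e) (infs M)"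
    using bij_betw_imp_surj_on[OF incl_bij[of "src M e"]] assms by simp
  then show thesis
    using that by (auto simp: in_hom)
qed

lemma incl_cancel:
  assumes "tgt M d = infs M" "tgt M d' = infs M" "src M d = src M d'" "incl M \<odot> d = incl M \<odot> d'"
  shows "d = d'"
  using bij_betw_imp_inj_on[OF incl_bij[of "src M d"]] assms by (auto simp: in_hom dest: inj_onD)

lemma nilsquare_zero [simp]: "nilsquare (const X 0)"
  using val_fold(1)[of "[]" X 0] val_fold(3)[of "[]" X "\<lambda>x. 0" "\<lambda>x. 0"] by (simp add: nilsquare_def)

lemma plus_zero [simp]:
  assumes "tgt M a = L" "src M a = X"
  shows "a \<boxplus> const X 0 = a" "const X 0 \<boxplus> a = a" "a \<boxtimes> const X 0 = const X 0"
    "const X 0 \<boxtimes> a = const X 0" "const X 1 \<boxtimes> a = a"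
  by (rule line_atoms[of X "[a]"]; use assms in \<open>simp add: val_fold algebra_simps\<close>)+

lemma plus_left_cancel:
  assumes "c \<boxplus> a = c \<boxplus> b" "tgt M a = L" "tgt M b = L" "tgt M c = L" "src M a = X" "src M b = X" "src M c = X"
  shows "a = b"
proof -
  have "const X (- 1) \<boxtimes> c \<boxplus> (c \<boxplus> a) = a" if "src M a = X" "tgt M a = L" for a
    by (rule line_atoms[of X "[a, c]"]) (use assms(4,7) that in \<open>simp_all add: val_fold algebra_simps\<close>)
  from this[of a] this[of b] show ?thesis
    using assms(1,2,3,5,6) by metis
qed

lemma nilsquare_times [simp]:
  assumes "nilsquare e" "tgt M c = L" "src M c = src M e"
  shows "nilsquare (e \<boxtimes> c)" "nilsquare (c \<boxtimes> e)"
proof -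
  have eq: "(a \<boxtimes> b) \<boxtimes> (a \<boxtimes> b) = (a \<boxtimes> a) \<boxtimes> (b \<boxtimes> b)"
    if "src M a = X" "src M b = X" "tgt M a = L" "tgt M b = L" for a b X
    by (rule line_atoms[of X "[a, b]"]) (use that in \<open>simp_all add: val_fold ac_simps\<close>)
  show "nilsquare (e \<boxtimes> c)" "nilsquare (c \<boxtimes> e)"
    using eq[of e "src M e" c] eq[of c "src M e" e] assms by (simp_all add: nilsquare_def)
qed

text \<open>
  An environment assigns a value to every variable of every type, so each type needs an element
  at each stage.
\<close>

lemma ex_arrow: "\<exists>a. src M a = X \<and> tgt M a = obj M A"
proof (induction A arbitrary: X)
  case Line
  then show ?case by (auto intro!: exI[of _ "const X 0"])
next
  case Infinitesimals
  obtain d where "tgt M d = infs M" "src M d = X"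
    using nilsquareE[OF nilsquare_zero[of X]] by (metis const_type(1))
  then show ?case by auto
next
  case Unit
  then show ?case by (auto intro!: exI[of _ "bang M X"])
next
  case (Prod A B)
  from Prod(1)[of X] Prod(2)[of X] obtain a b where
    "src M a = X" "tgt M a = obj M A" "src M b = X" "tgt M b = obj M B" by blast
  then show ?case by (auto intro!: exI[of _ "pair M a b"])
next
  case (Fun A B)
  from Fun(2)[of "prd M X (obj M A)"] obtain b where
    "src M b = prd M X (obj M A)" "tgt M b = obj M B" by blast
  then show ?case by (auto intro!: exI[of _ "cur M X (obj M A) b"])
qed

lemma ex_env: "\<exists>r. env X r"
  unfolding env_def by (rule choice) (simp add: ex_arrow)

lemma validI: "(\<And>X r. env X r \<Longrightarrow> forces M X r p) \<Longrightarrow> M \<Turnstile> p"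
  by (simp add: valid_def env_def in_hom)

lemma validD: "M \<Turnstile> p \<Longrightarrow> env X r \<Longrightarrow> forces M X r p"
  by (simp add: valid_def env_def in_hom)

lemma inf_zero:
  "stable inf_zero Infinitesimals" "env X r \<Longrightarrow> incl M \<odot> den M X r inf_zero = const X 0"
proof -
  let ?z = "(''z'', Infinitesimals)"
  have ex1: "\<exists>!a. a \<in> hom M X (obj M Infinitesimals) \<and> forces M X (r(?z := a)) (Incl (Var ?z) \<approx> Const 0)"
    if "env X r" for X r
  proof -
    obtain d where "tgt M d = infs M" "src M d = X" "const X 0 = incl M \<odot> d"
      using nilsquareE[OF nilsquare_zero[of X]] by (metis const_type(1))
    then show ?thesis
      using incl_cancel[of _ d] by (intro ex1I[of _ d]) (simp_all add: in_hom)
  qed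
  have re: "forces M (src M h) (\<lambda>w. r w \<odot> h) (Incl (Var ?z) \<approx> Const 0)"
    if "forces M X r (Incl (Var ?z) \<approx> Const 0)" "env X r" "tgt M h = X" for X r h
    using forces_Equal_restrict[OF that stable_Incl[OF stable_Var] stable_ops(1)] .
  show "stable inf_zero Infinitesimals"
    unfolding inf_zero_def Let_def by (rule stable_Descr(1)[OF ex1 re])
  assume r: "env X r"
  have "forces M X (r(?z := den M X r inf_zero)) (Incl (Var ?z) \<approx> Const 0)"
    unfolding inf_zero_def Let_def
    by (rule stable_Descr(2)) (rule r | rule ex1 re, assumption+)+
  then show "incl M \<odot> den M X r inf_zero = const X 0"
    by simp
qed

lemma forces_Forall_inst:
  assumes "forces M X r (Forall v p)" "env X r" "src M a = X" "tgt M a = obj M (snd v)"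
  shows "forces M X (r(v := a)) p"
  using assms(1)[unfolded forces.simps, rule_format, of "ide M X" X a] assms(2-4)
  by (simp add: in_hom env_restrict_ide)

lemma forces_ExistsOne_inst:
  assumes "forces M X r (ExistsOne v p)" "env X r"
  shows "\<exists>!a. a \<in> hom M X (obj M (snd v)) \<and> forces M X (r(v := a)) p"
proof -
  have "\<exists>!a. a \<in> hom M X (obj M (snd v)) \<and> forces M X ((\<lambda>w. r w \<odot> ide M X)(v := a)) p"
    using assms(1)[unfolded forces.simps, rule_format, of "ide M X" X] by (simp add: in_hom)
  then show ?thesis using assms(2) by (simp add: env_restrict_ide)
qed

lemma forces_Forall_infs:
  assumes "\<And>h d. tgt M h = X \<Longrightarrow> tgt M d = infs M \<Longrightarrow> src M h = src M d \<Longrightarrow>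
      forces M (src M d) ((\<lambda>w. r w \<odot> h)((x, Infinitesimals) := d)) p \<longleftrightarrow> P h (incl M \<odot> d)"
  shows "forces M X r (Forall (x, Infinitesimals) p) \<longleftrightarrow>
    (\<forall>h e. tgt M h = X \<longrightarrow> src M h = src M e \<longrightarrow> nilsquare e \<longrightarrow> P h e)"
proof -
  have "forces M X r (Forall (x, Infinitesimals) p) \<longleftrightarrow>
      (\<forall>h d. tgt M h = X \<longrightarrow> tgt M d = infs M \<longrightarrow> src M h = src M d \<longrightarrow>
        forces M (src M d) ((\<lambda>w. r w \<odot> h)((x, Infinitesimals) := d)) p)"
    unfolding forces.simps by (simp only: snd_conv obj.simps all_hom_iff)
  also have "\<dots> \<longleftrightarrow>
      (\<forall>h d. tgt M h = X \<longrightarrow> tgt M d = infs M \<longrightarrow> src M h = src M d \<longrightarrow> P h (incl M \<odot> d))"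
    using assms by blast
  also have "\<dots> \<longleftrightarrow> (\<forall>h e. tgt M h = X \<longrightarrow> src M h = src M e \<longrightarrow> nilsquare e \<longrightarrow> P h e)"
  proof (intro iffI allI impI)
    fix h e assume *: "\<forall>h d. tgt M h = X \<longrightarrow> tgt M d = infs M \<longrightarrow> src M h = src M d \<longrightarrow> P h (incl M \<odot> d)"
      "tgt M h = X" "src M h = src M e" "nilsquare e"
    obtain d where d: "tgt M d = infs M" "src M d = src M e" "e = incl M \<odot> d"
      using nilsquareE[OF *(4)] .
    show "P h e"
      unfolding d(3) using *(1-3) d(1,2) by metis
  qed simp
  finally show ?thesis .
qed

text \<open>
  \<open>b\<close> is the coefficient of the affine map to which \<open>N\<close> restricts on \<open>D\<close>, that is, its
  derivative at \<open>0\<close>.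
\<close>

definition slope where
  "slope X N b \<longleftrightarrow> src M b = X \<and> tgt M b = L \<and> (\<forall>h e. tgt M h = X \<longrightarrow> src M h = src M e \<longrightarrow> nilsquare e \<longrightarrow>
     N h e = N h (const (src M e) 0) \<boxplus> e \<boxtimes> (b \<odot> h))"

text \<open>The Kock--Lawvere axiom for the internal map \<open>d \<mapsto> N d\<close> on \<open>D\<close>.\<close>

lemma slope_ex1:
  assumes N: "natural X L L N" shows "\<exists>!b. slope X N b"
proof -
  obtain r where r: "env X r" using ex_env by blast
  define g where "g = lam X (infs M) (\<lambda>h d. N h (incl M \<odot> d))"
  have nat: "natural X (infs M) L (\<lambda>h d. N h (incl M \<odot> d))"
    by (rule naturalI) (use N in \<open>simp_all add: natural_type natural_comp\<close>)
  have g: "src M g = X" "tgt M g = expo M (infs M) L"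
    using nat by (simp_all add: g_def)
  have app_g: "app L (g \<odot> h) d = N h (incl M \<odot> d)"
    if "tgt M h = X" "tgt M d = infs M" "src M h = src M d" for h d
    using nat that by (simp add: g_def)
  let ?g = "(''g'', Fun Infinitesimals Line)" and ?b = "(''b'', Line)" and ?d = "(''d'', Infinitesimals)"
  let ?p = "Var ?g \<cdot> Var ?d \<approx> Var ?g \<cdot> inf_zero \<oplus> Incl (Var ?d) \<otimes> Var ?b"
  have s: "stable (Var ?g \<cdot> Var ?d) Line" "stable (Var ?g \<cdot> inf_zero) Line"
    by (rule stable_intros inf_zero)+
  have "forces M X r (Forall ?g (ExistsOne ?b (Forall ?d ?p)))"
    using validD[OF Kock_Lawvere r] by (simp add: Kock_Lawvere_def Let_def)
  then have "forces M X (r(?g := g)) (ExistsOne ?b (Forall ?d ?p))"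
    using r g by (intro forces_Forall_inst) simp_all
  then have "\<exists>!b. b \<in> hom M X L \<and> forces M X (r(?g := g, ?b := b)) (Forall ?d ?p)"
    using forces_ExistsOne_inst[of X "r(?g := g)" ?b "Forall ?d ?p"] r g
    by (simp del: forces.simps)
  moreover have "b \<in> hom M X L \<and> forces M X (r(?g := g, ?b := b)) (Forall ?d ?p) \<longleftrightarrow> slope X N b" for b
  proof (cases "b \<in> hom M X L")
    case True
    then have b: "src M b = X" "tgt M b = L" by (simp_all add: in_hom)
    have *: "forces M (src M d) ((\<lambda>w. (r(?g := g, ?b := b)) w \<odot> h)(?d := d)) ?p \<longleftrightarrow>
        N h (incl M \<odot> d) = N h (const (src M (incl M \<odot> d)) 0) \<boxplus> (incl M \<odot> d) \<boxtimes> (b \<odot> h)"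
      if h: "tgt M h = X" "tgt M d = infs M" "src M h = src M d" for h d
    proof -
      let ?r = "(\<lambda>w. (r(?g := g, ?b := b)) w \<odot> h)(?d := d)"
      have r': "env (src M d) ?r" using r g b h by (simp del: fun_upd_apply)
      have "den M (src M d) ?r (Var ?g \<cdot> Var ?d) = N h (incl M \<odot> d)"
        using h app_g[of h d] by (simp add: app_fold)
      moreover have "den M (src M d) ?r (Var ?g \<cdot> inf_zero) = N h (const (src M d) 0)"
        using h app_g[of h "den M (src M d) ?r inf_zero"]
          stable_type[OF inf_zero(1) r'] inf_zero(2)[OF r'] stable_ty[OF inf_zero(1)] by (simp add: app_fold)
      ultimately show ?thesis
        using h b N by (simp add: natural_type del: den.simps(7))
    qed
    have "forces M X (r(?g := g, ?b := b)) (Forall ?d ?p) \<longleftrightarrow>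
      (\<forall>h e. tgt M h = X \<longrightarrow> src M h = src M e \<longrightarrow> nilsquare e \<longrightarrow>
        N h e = N h (const (src M e) 0) \<boxplus> e \<boxtimes> (b \<odot> h))"
      by (rule forces_Forall_infs) (rule *)
    then show ?thesis
      using b by (simp add: in_hom slope_def del: forces.simps)
  qed (auto simp: slope_def in_hom)
  ultimately show ?thesis by simp
qed

text \<open>
  Cancellation of a universally quantified nilsquare factor. A derivative is computed by
  expanding at a nilsquare \<open>e\<close> and reading off the coefficient.
\<close>

lemma slope_unique: "natural X L L N \<Longrightarrow> slope X N b \<Longrightarrow> slope X N b' \<Longrightarrow> b = b'"
  using slope_ex1 by blast

lemma slope_Descr:
  assumes N: "\<And>X r. env X r \<Longrightarrow> natural X L L (N r)"
    and p: "\<And>X r b. env X r \<Longrightarrow> src M b = X \<Longrightarrow> tgt M b = L \<Longrightarrow>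
      forces M X (r((x, Line) := b)) (Forall w q) \<longleftrightarrow> slope X (N r) b"
  shows "stable (Descr (x, Line) (Forall w q)) Line"
    "env X r \<Longrightarrow> slope X (N r) (den M X r (Descr (x, Line) (Forall w q)))"
proof -
  have eq: "(a \<in> hom M X (obj M Line) \<and> forces M X (r((x, Line) := a)) (Forall w q)) = slope X (N r) a"
    if "env X r" for X r a
    using p[OF that, of a] by (auto simp: slope_def in_hom simp del: forces.simps)
  have ex1: "\<exists>!a. a \<in> hom M X (obj M Line) \<and> forces M X (r((x, Line) := a)) (Forall w q)"
    if "env X r" for X r
    unfolding eq[OF that] by (rule slope_ex1[OF N[OF that]])
  show st: "stable (Descr (x, Line) (Forall w q)) Line"
    by (rule stable_Descr(1)) (rule ex1 forces_Forall_restrict, assumption+)+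
  assume r: "env X r"
  show "slope X (N r) (den M X r (Descr (x, Line) (Forall w q)))"
  proof -
    have "forces M X (r((x, Line) := den M X r (Descr (x, Line) (Forall w q)))) (Forall w q)"
      by (rule stable_Descr(2)[OF _ _ r]) (rule ex1 forces_Forall_restrict, assumption+)+
    then show ?thesis
      using p[OF r] stable_type[OF st r] by (simp del: den.simps forces.simps)
  qed
qed


section \<open>Derivatives\<close>

lemma slopeD:
  assumes "slope X N b" "tgt M h = X" "src M h = src M e" "nilsquare e"
  shows "N h e = N h (const (src M e) 0) \<boxplus> e \<boxtimes> (b \<odot> h)"
  using assms(1)[unfolded slope_def] assms(2-) by blast

lemma slope_cong:
  assumes "\<And>h e. tgt M h = X \<Longrightarrow> src M h = src M e \<Longrightarrow> nilsquare e \<Longrightarrow> N h e = N' h e"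
  shows "slope X N b \<longleftrightarrow> slope X N' b"
  unfolding slope_def using assms by (auto simp: assms)

text \<open>
  Moving a point of \<open>A\<close> by a number: addition on the line, or addition to one of the coordinates
  of a vector. The ordinary and the partial derivatives are derivatives along such shifts.
\<close>

definition is_shift where
  "is_shift A sh \<longleftrightarrow> (\<forall>x e. tgt M x = A \<longrightarrow> src M e = src M x \<longrightarrow> tgt M e = L \<longrightarrow>
     src M (sh x e) = src M x \<and> tgt M (sh x e) = A \<and> sh x (const (src M x) 0) = x \<and>
     (\<forall>k. tgt M k = src M x \<longrightarrow> sh x e \<odot> k = sh (x \<odot> k) (e \<odot> k)))"

lemma is_shiftD:
  assumes "is_shift A sh" "tgt M x = A"
  shows "src M e = src M x \<Longrightarrow> tgt M e = L \<Longrightarrow> src M (sh x e) = src M x"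
    "src M e = src M x \<Longrightarrow> tgt M e = L \<Longrightarrow> tgt M (sh x e) = A"
    "src M x = X \<Longrightarrow> sh x (const X 0) = x"
    "src M e = src M x \<Longrightarrow> tgt M e = L \<Longrightarrow> tgt M k = src M x \<Longrightarrow> sh x e \<odot> k = sh (x \<odot> k) (e \<odot> k)"
  using assms unfolding is_shift_def by (blast intro: const_type)+

definition derivative_along where
  "derivative_along A sh F G \<longleftrightarrow> src M F = src M G \<and> tgt M F = expo M A L \<and> tgt M G = expo M A L \<and>
    (\<forall>h x e. tgt M h = src M G \<longrightarrow> tgt M x = A \<longrightarrow> src M h = src M x \<longrightarrow> src M e = src M x \<longrightarrow> nilsquare e \<longrightarrow>
      app L (F \<odot> h) (sh x e) = app L (F \<odot> h) x \<boxplus> e \<boxtimes> app L (G \<odot> h) x)"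

lemma derivative_along_type:
  assumes "derivative_along A sh F G"
  shows "src M F = src M G" "tgt M F = expo M A L" "tgt M G = expo M A L"
  using assms by (simp_all add: derivative_along_def)

lemma derivative_alongD:
  assumes "derivative_along A sh F G"
    "tgt M h = src M G" "tgt M x = A" "src M h = src M x" "src M e = src M x" "nilsquare e"
  shows "app L (F \<odot> h) (sh x e) = app L (F \<odot> h) x \<boxplus> e \<boxtimes> app L (G \<odot> h) x"
  using assms(1)[unfolded derivative_along_def] assms(2-) by blast

lemma derivative_along_comp:
  assumes F: "derivative_along A sh F G" and k: "tgt M k = src M G"
  shows "derivative_along A sh (F \<odot> k) (G \<odot> k)"
proof -
  have "app L ((F \<odot> k) \<odot> h) (sh a e) = app L ((F \<odot> k) \<odot> h) a \<boxplus> e \<boxtimes> app L ((G \<odot> k) \<odot> h) a"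
    if h: "tgt M h = src M k" "tgt M a = A" "src M h = src M a" "src M e = src M a" "nilsquare e" for h a e
    using h k derivative_along_type[OF F] by (simp add: derivative_alongD[OF F])
  then show ?thesis
    using k derivative_along_type[OF F] unfolding derivative_along_def by simp
qed

lemma derivative_along_slope:
  assumes sh: "is_shift A sh" and F: "derivative_along A sh F G"
    and h: "tgt M h = src M G" "tgt M a = A" "src M h = src M a"
  shows "slope (src M a) (\<lambda>k e. app L (F \<odot> h \<odot> k) (sh (a \<odot> k) e)) (app L (G \<odot> h) a)"
  unfolding slope_def
proof (intro conjI allI impI)
  fix k e assume k: "tgt M k = src M a" "src M k = src M e" "nilsquare e"
  then show "app L (F \<odot> h \<odot> k) (sh (a \<odot> k) e)
    = app L (F \<odot> h \<odot> k) (sh (a \<odot> k) (const (src M e) 0)) \<boxplus> e \<boxtimes> (app L (G \<odot> h) a \<odot> k)"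
    using h derivative_along_type[OF F] by (simp add: derivative_alongD[OF F] is_shiftD(3)[OF sh])
qed (use h derivative_along_type[OF F] in simp_all)

lemma natural_shift:
  assumes "is_shift A sh" "src M F = X" "tgt M F = expo M A L" "src M a = X" "tgt M a = A"
  shows "natural X L L (\<lambda>k e. app L (F \<odot> k) (sh (a \<odot> k) e))"
  by (rule naturalI) (use assms(2-) in \<open>simp_all add: is_shiftD[OF assms(1)]\<close>)

text \<open>
  The terms for the derivative and the partial derivatives are of this form; \<open>S\<close> is the term for
  the shifted argument.
\<close>

definition slope_operator where
  "slope_operator A x S =
     (let f = (''f'', Fun A Line); b = (''b'', Line); d = (''d'', Infinitesimals)
      in Lam f (Lam (x, A) (Descr b (Forall d
           (Var f \<cdot> S \<approx> Var f \<cdot> Var (x, A) \<oplus> Incl (Var d) \<otimes> Var b)))))"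

text \<open>
  At each argument \<open>x\<close> the description asks for the slope of \<open>e \<mapsto> f (sh x e)\<close>, which exists
  uniquely. So the operator is total, and the expansion along the shift characterizes its value.
\<close>

lemma slope_operator:
  assumes sh: "is_shift (obj M A) sh" and S: "stable S A" and x: "x \<notin> {''f'', ''b'', ''d''}"
    and den_S: "\<And>Y r. env Y r \<Longrightarrow> den M Y r S = sh (r (x, A)) (incl M \<odot> r (''d'', Infinitesimals))"
  shows stable_slope_operator: "stable (slope_operator A x S) (Fun (Fun A Line) (Fun A Line))"
    and slope_operator_iff: "env X r \<Longrightarrow> src M F = X \<Longrightarrow> tgt M F = expo M (obj M A) L \<Longrightarrow>
      src M G = X \<Longrightarrow> tgt M G = expo M (obj M A) L \<Longrightarrow>
      app (expo M (obj M A) L) (den M X r (slope_operator A x S)) F = G \<longleftrightarrow> derivative_along (obj M A) sh F G"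
proof -
  let ?f = "(''f'', Fun A Line)" and ?x = "(x, A)" and ?b = "(''b'', Line)" and ?d = "(''d'', Infinitesimals)"
  let ?q = "Var ?f \<cdot> S \<approx> Var ?f \<cdot> Var ?x \<oplus> Incl (Var ?d) \<otimes> Var ?b"
  let ?E = "expo M (obj M A) L" and ?Op = "slope_operator A x S"
  define N where "N r = (\<lambda>h e. app L (r ?f \<odot> h) (sh (r ?x \<odot> h) e))" for r :: "var \<Rightarrow> 'a"
  have N: "natural X L L (N r)" if "env X r" for X r
    unfolding N_def by (rule natural_shift[OF sh]) (use that in \<open>simp_all add: env_type\<close>)
  have p: "forces M X (r(?b := b)) (Forall ?d ?q) \<longleftrightarrow> slope X (N r) b"
    if r: "env X r" and b: "src M b = X" "tgt M b = L" for X r b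
  proof -
    have *: "forces M (src M d) ((\<lambda>w. (r(?b := b)) w \<odot> h)(?d := d)) ?q \<longleftrightarrow>
        N r h (incl M \<odot> d) = N r h (const (src M (incl M \<odot> d)) 0) \<boxplus> (incl M \<odot> d) \<boxtimes> (b \<odot> h)"
      if h: "tgt M h = X" "tgt M d = infs M" "src M h = src M d" for h d
    proof -
      let ?r = "(\<lambda>w. (r(?b := b)) w \<odot> h)(?d := d)"
      have r': "env (src M d) ?r" using r b h by (simp del: fun_upd_apply)
      have "den M (src M d) ?r (Var ?f \<cdot> S) = N r h (incl M \<odot> d)"
        using app_Var_App[OF r' S, of "''f''" Line] den_S[OF r'] h r x by (simp add: N_def env_type del: den.simps(7))
      moreover have "den M (src M d) ?r (Var ?f \<cdot> Var ?x) = N r h (const (src M d) 0)"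
        using app_Var_App[OF r' stable_Var, of "''f''" A Line x] h r x
        by (simp add: N_def env_type is_shiftD(3)[OF sh] del: den.simps(7))
      ultimately show ?thesis
        using h b r N[OF r] by (simp add: natural_type env_type del: den.simps(7))
    qed
    have "forces M X (r(?b := b)) (Forall ?d ?q) \<longleftrightarrow>
      (\<forall>h e. tgt M h = X \<longrightarrow> src M h = src M e \<longrightarrow> nilsquare e \<longrightarrow>
        N r h e = N r h (const (src M e) 0) \<boxplus> e \<boxtimes> (b \<odot> h))"
      by (rule forces_Forall_infs) (rule *)
    then show ?thesis
      using b by (simp add: slope_def del: forces.simps)
  qed
  have D1: "stable (Descr ?b (Forall ?d ?q)) Line"
    by (rule slope_Descr(1)[where N = N]) (rule N p, assumption+)+
  have D2: "slope X (N r) (den M X r (Descr ?b (Forall ?d ?q)))" if "env X r" for X r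
    by (rule slope_Descr(2)[where N = N, OF _ _ that]) (rule N p, assumption+)+
  show st: "stable ?Op (Fun (Fun A Line) (Fun A Line))"
    unfolding slope_operator_def Let_def by (rule stable_Lam D1)+
  have den_Op: "slope X (\<lambda>h e. app L (F \<odot> h) (sh (a \<odot> h) e)) (app L (app ?E (den M X r ?Op) F) a)"
    if *: "env X r" "src M F = X" "tgt M F = ?E" "src M a = X" "tgt M a = obj M A" for X r F a
  proof -
    have "app L (app ?E (den M X r ?Op) F) a = den M X (r(?f := F, ?x := a)) (Descr ?b (Forall ?d ?q))"
      using app_Lam[OF stable_Lam[OF D1, of x A], of X r F "Fun A Line" "''f''"]
        app_Lam[OF D1, of X "r(?f := F)" a A x] *
      by (simp add: slope_operator_def Let_def del: den.simps)
    then show ?thesis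
      using D2[of X "r(?f := F, ?x := a)"] * x by (simp add: N_def del: den.simps)
  qed
  assume r: "env X r" and F: "src M F = X" "tgt M F = ?E" and G: "src M G = X" "tgt M G = ?E"
  let ?D = "\<lambda>X r. den M X r ?Op"
  have D: "src M (?D X r) = X" "tgt M (?D X r) = expo M ?E ?E"
    using stable_type[OF st r] by simp_all
  have sl: "slope (src M a) (\<lambda>k e. app L (F \<odot> h \<odot> k) (sh (a \<odot> k) e)) (app L (app ?E (?D X r) F \<odot> h) a)"
    if h: "tgt M h = X" "tgt M a = obj M A" "src M h = src M a" for h a
  proof -
    have "slope (src M a) (\<lambda>k e. app L ((F \<odot> h) \<odot> k) (sh (a \<odot> k) e)) (app L (app ?E (?D X r) F \<odot> h) a)"
      using den_Op[of "src M a" "\<lambda>w. r w \<odot> h" "F \<odot> h" a] stable_comp[OF st r h(1)] D F h r env_restrict[OF r h(1)]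
      by simp
    then show ?thesis
      by (rule slope_cong[THEN iffD1, rotated]) (use F h in simp)
  qed
  show "app ?E (?D X r) F = G \<longleftrightarrow> derivative_along (obj M A) sh F G"
  proof
    show "derivative_along (obj M A) sh F G" if eq: "app ?E (?D X r) F = G"
    proof -
      have "app L (F \<odot> h) (sh a e) = app L (F \<odot> h) a \<boxplus> e \<boxtimes> app L (G \<odot> h) a"
        if h: "tgt M h = X" "tgt M a = obj M A" "src M h = src M a" "src M e = src M a" "nilsquare e" for h a e
        using slopeD[OF sl[OF h(1-3)], of "ide M (src M a)" e] h F G by (simp add: eq is_shiftD(3)[OF sh])
      then show ?thesis using F G by (simp add: derivative_along_def)
    qed
  next
    assume der: "derivative_along (obj M A) sh F G"
    show "app ?E (?D X r) F = G"
    proof (rule expo_eqI[of _ "obj M A" L])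
      fix h a assume h: "tgt M h = src M G" "tgt M a = obj M A" "src M h = src M a"
      have "natural (src M a) L L (\<lambda>k e. app L ((F \<odot> h) \<odot> k) (sh (a \<odot> k) e))"
        by (rule natural_shift[OF sh]) (use F G h in simp_all)
      moreover have "slope (src M a) (\<lambda>k e. app L ((F \<odot> h) \<odot> k) (sh (a \<odot> k) e)) (app L (app ?E (?D X r) F \<odot> h) a)"
        by (rule slope_cong[THEN iffD1, OF _ sl]) (use F G h in simp_all)
      moreover have "slope (src M a) (\<lambda>k e. app L ((F \<odot> h) \<odot> k) (sh (a \<odot> k) e)) (app L (G \<odot> h) a)"
        by (rule slope_cong[THEN iffD1, OF _ derivative_along_slope[OF sh der]]) (use F G h in simp_all)
      ultimately show "app L (app ?E (?D X r) F \<odot> h) a = app L (G \<odot> h) a"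
        by (rule slope_unique)
    qed (use D F G in simp_all)
  qed
qed

abbreviation hasder where "hasder \<equiv> derivative_along L (\<boxplus>)"

lemma is_shift_plus: "is_shift L (\<boxplus>)"
  by (simp add: is_shift_def)

lemma derivative:
  shows stable_derivative: "stable derivative (Fun (Fun Line Line) (Fun Line Line))"
    and derivative_iff: "env X r \<Longrightarrow> src M F = X \<Longrightarrow> tgt M F = expo M L L \<Longrightarrow> src M G = X \<Longrightarrow> tgt M G = expo M L L \<Longrightarrow>
      app (expo M L L) (den M X r derivative) F = G \<longleftrightarrow> hasder F G"
proof -
  let ?S = "Var (''t'', Line) \<oplus> Incl (Var (''d'', Infinitesimals))"
  have D: "derivative = slope_operator Line ''t'' ?S"
    by (simp add: derivative_def slope_operator_def Let_def)
  have sh: "is_shift (obj M Line) (\<boxplus>)" by (simp add: is_shift_plus)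
  have S: "stable ?S Line" by (rule stable_intros)+
  have den_S: "den M Y r ?S = r (''t'', Line) \<boxplus> (incl M \<odot> r (''d'', Infinitesimals))" if "env Y r" for Y r
    using that by (simp add: env_type)
  show "stable derivative (Fun (Fun Line Line) (Fun Line Line))"
    unfolding D by (rule stable_slope_operator[OF sh S _ den_S]) simp_all
  show "env X r \<Longrightarrow> src M F = X \<Longrightarrow> tgt M F = expo M L L \<Longrightarrow> src M G = X \<Longrightarrow> tgt M G = expo M L L \<Longrightarrow>
      app (expo M L L) (den M X r derivative) F = G \<longleftrightarrow> hasder F G"
    unfolding D by (rule slope_operator_iff[OF sh S _ den_S, unfolded obj.simps]) simp_all
qed

section \<open>Integrals\<close>

text \<open>The integration axiom at a stage.\<close>

lemma antiderivative_ex1: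
  assumes F: "src M F = X" "tgt M F = expo M L L" and a: "src M a = X" "tgt M a = L"
    and c: "src M c = X" "tgt M c = L"
  shows "\<exists>!G. hasder G F \<and> app L G a = c"
proof -
  obtain r where r: "env X r" using ex_env by blast
  let ?f = "(''f'', Fun Line Line)" and ?g = "(''g'', Fun Line Line)" and ?a = "(''a'', Line)" and ?c = "(''c'', Line)"
  let ?p = "derivative \<cdot> Var ?g \<approx> Var ?f \<sqinter> Var ?g \<cdot> Var ?a \<approx> Var ?c"
  have "forces M X r (Forall ?f (Forall ?a (Forall ?c (ExistsOne ?g ?p))))"
    using validD[OF Integration r] by (simp add: Integration_def Let_def)
  then have "forces M X (r(?f := F)) (Forall ?a (Forall ?c (ExistsOne ?g ?p)))"
    by (rule forces_Forall_inst) (use r assms in simp_all)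
  then have "forces M X (r(?f := F, ?a := a)) (Forall ?c (ExistsOne ?g ?p))"
    by (rule forces_Forall_inst) (use r assms in simp_all)
  then have "forces M X (r(?f := F, ?a := a, ?c := c)) (ExistsOne ?g ?p)"
    by (rule forces_Forall_inst) (use r assms in simp_all)
  then have "\<exists>!G. G \<in> hom M X (expo M L L) \<and> forces M X (r(?f := F, ?a := a, ?c := c, ?g := G)) ?p"
    using forces_ExistsOne_inst[of X "r(?f := F, ?a := a, ?c := c)" ?g ?p] r assms
    by (simp del: forces.simps)
  moreover have "G \<in> hom M X (expo M L L) \<and> forces M X (r(?f := F, ?a := a, ?c := c, ?g := G)) ?p
      \<longleftrightarrow> hasder G F \<and> app L G a = c" for G
  proof (cases "G \<in> hom M X (expo M L L)")
    case True
    then have G: "src M G = X" "tgt M G = expo M L L" by (simp_all add: in_hom)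
    let ?r = "r(?f := F, ?a := a, ?c := c, ?g := G)"
    have r': "env X ?r" using r assms G by simp
    have "den M X ?r (derivative \<cdot> Var ?g) = F \<longleftrightarrow> hasder G F"
      using derivative_iff[OF r' G F] den_App[OF stable_derivative stable_Var r', of "''g''"] by simp
    then show ?thesis
      using G a by (simp add: in_hom app_fold del: den.simps(7)) (simp add: app_fold)
  qed (use F in \<open>auto simp: derivative_along_def in_hom\<close>)
  ultimately show ?thesis by simp
qed

definition integ where
  "integ u v F = app L (THE G. hasder G F \<and> app L G u = const (src M u) 0) v"

lemma integ_eq:
  assumes "hasder G F" "src M u = src M F" "tgt M u = L" "src M v = src M F" "tgt M v = L" "app L G u = const (src M u) 0"
  shows "integ u v F = app L G v"
proof -
  have "(THE G. hasder G F \<and> app L G u = const (src M u) 0) = G"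
    using antiderivative_ex1[of F "src M F" u "const (src M u) 0"] assms derivative_along_type[OF assms(1)]
    by (intro the1_equality) simp_all
  then show ?thesis by (simp add: integ_def)
qed

lemma antiderivativeE:
  assumes "tgt M F = expo M L L" "src M u = src M F" "tgt M u = L"
  obtains G where "hasder G F" "app L G u = const (src M u) 0" "src M G = src M F" "tgt M G = expo M L L"
    "\<And>v. src M v = src M F \<Longrightarrow> tgt M v = L \<Longrightarrow> integ u v F = app L G v"
proof -
  obtain G where G: "hasder G F" "app L G u = const (src M u) 0"
    using antiderivative_ex1[of F "src M F" u "const (src M u) 0"] assms by auto
  have "integ u v F = app L G v" if "src M v = src M F" "tgt M v = L" for v
    by (rule integ_eq[OF G(1) assms(2,3) that G(2)])
  then show thesis
    by (rule that[OF G derivative_along_type(1,2)[OF G(1)]])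
qed

lemma integ_type [simp]:
  assumes "tgt M F = expo M L L" "src M u = src M F" "tgt M u = L" "src M v = src M F" "tgt M v = L"
  shows "src M (integ u v F) = src M F" "tgt M (integ u v F) = L"
proof -
  obtain G where "src M G = src M F" "tgt M G = expo M L L" "integ u v F = app L G v"
    using antiderivativeE[OF assms(1-3)] assms(4,5) by metis
  then show "src M (integ u v F) = src M F" "tgt M (integ u v F) = L"
    using assms by simp_all
qed

lemma integ_comp [simp]:
  assumes "tgt M F = expo M L L" "src M u = src M F" "tgt M u = L" "src M v = src M F" "tgt M v = L"
    and k: "tgt M k = src M F"
  shows "integ u v F \<odot> k = integ (u \<odot> k) (v \<odot> k) (F \<odot> k)"
proof -
  obtain G where G: "hasder G F" "app L G u = const (src M u) 0" "src M G = src M F" "tgt M G = expo M L L"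
    "integ u v F = app L G v"
    using antiderivativeE[OF assms(1-3)] assms(4,5) by metis
  have "app L (G \<odot> k) (u \<odot> k) = const (src M k) 0"
    using app_comp[of G u L k] G assms by simp
  then have "integ (u \<odot> k) (v \<odot> k) (F \<odot> k) = app L (G \<odot> k) (v \<odot> k)"
    using derivative_along_comp[OF G(1) k] assms by (intro integ_eq) simp_all
  then show ?thesis
    using G assms by simp
qed

lemma den_integral_op:
  shows stable_integral_op: "stable integral_op (Fun Line (Fun Line (Fun (Fun Line Line) Line)))"
    and "env X r \<Longrightarrow> src M F = X \<Longrightarrow> tgt M F = expo M L L \<Longrightarrow> src M u = X \<Longrightarrow> tgt M u = L \<Longrightarrow>
      src M v = X \<Longrightarrow> tgt M v = L \<Longrightarrow>
      app L (app (expo M (expo M L L) L) (app (expo M L (expo M (expo M L L) L)) (den M X r integral_op) u) v) F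
        = integ u v F"
proof -
  let ?f = "(''f'', Fun Line Line)" and ?g = "(''g'', Fun Line Line)" and ?u = "(''u'', Line)" and ?v = "(''v'', Line)"
  let ?p = "derivative \<cdot> Var ?g \<approx> Var ?f \<sqinter> Var ?g \<cdot> Var ?u \<approx> Const 0"
  have s: "stable (derivative \<cdot> Var ?g) (Fun Line Line)" "stable (Var ?g \<cdot> Var ?u) Line"
    by (rule stable_derivative stable_intros)+
  have p: "G \<in> hom M X (expo M L L) \<and> forces M X (r(?g := G)) ?p \<longleftrightarrow>
      hasder G (r ?f) \<and> app L G (r ?u) = const X 0" if r: "env X r" for X r G
  proof (cases "G \<in> hom M X (expo M L L)")
    case True
    then have G: "src M G = X" "tgt M G = expo M L L" by (simp_all add: in_hom)
    have r': "env X (r(?g := G))" using r G by simp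
    have "den M X (r(?g := G)) (derivative \<cdot> Var ?g) = r ?f \<longleftrightarrow> hasder G (r ?f)"
      using derivative_iff[OF r' G, of "r ?f"] den_App[OF stable_derivative stable_Var r', of "''g''"] r
      by (simp add: env_type)
    then show ?thesis
      using G r by (simp add: in_hom del: den.simps(7)) (simp add: app_fold env_type)
  qed (use r in \<open>auto simp: derivative_along_def in_hom env_type\<close>)
  have ex1: "\<exists>!G. G \<in> hom M X (obj M (Fun Line Line)) \<and> forces M X (r(?g := G)) ?p" if r: "env X r" for X r
    using antiderivative_ex1[of "r ?f" X "r ?u" "const X 0"] r p[OF r]
    by (simp add: env_type del: forces.simps)
  have re: "forces M (src M h) (\<lambda>w. r w \<odot> h) ?p" if f: "forces M X r ?p" and r: "env X r" and h: "tgt M h = X" for X r h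
    using f forces_Equal_restrict[OF _ r h s(1) stable_Var[of "''f''"]] forces_Equal_restrict[OF _ r h s(2) stable_ops(1)]
    unfolding forces.simps(2) by blast
  have D: "stable (Descr ?g ?p) (Fun Line Line)"
    by (rule stable_Descr(1)) (rule ex1 re, assumption+)+
  have den_D: "den M X r (Descr ?g ?p) = (THE G. hasder G (r ?f) \<and> app L G (r ?u) = const X 0)" if "env X r" for X r
    using p[OF that] by (simp del: forces.simps)
  have D': "stable (Descr ?g ?p \<cdot> Var ?v) Line"
    by (rule stable_intros D)+
  note L1 = stable_Lam[OF D', of "''f''" "Fun Line Line"]
  note L2 = stable_Lam[OF L1, of "''v''" Line]
  show "stable integral_op (Fun Line (Fun Line (Fun (Fun Line Line) Line)))"
    unfolding integral_op_def Let_def by (rule stable_Lam L2)+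
  assume *: "env X r" "src M F = X" "tgt M F = expo M L L" "src M u = X" "tgt M u = L" "src M v = X" "tgt M v = L"
  let ?r = "r(?u := u, ?v := v, ?f := F)"
  have r': "env X ?r" using * by simp
  have "app L (app (expo M (expo M L L) L) (app (expo M L (expo M (expo M L L) L)) (den M X r integral_op) u) v) F
    = den M X ?r (Descr ?g ?p \<cdot> Var ?v)"
    using app_Lam[OF L2, of X r u Line "''u''"] app_Lam[OF L1, of X "r(?u := u)" v Line "''v''"]
      app_Lam[OF D', of X "r(?u := u, ?v := v)" F "Fun Line Line" "''f''"] *
    by (simp add: integral_op_def Let_def del: den.simps)
  also have "\<dots> = app L (den M X ?r (Descr ?g ?p)) v"
    using den_App[OF D stable_Var r', of "''v''"] by (simp del: den.simps(7,10))
  also have "\<dots> = integ u v F"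
    using den_D[OF r'] * by (simp add: integ_def del: den.simps(10))
  finally show "app L (app (expo M (expo M L L) L) (app (expo M L (expo M (expo M L L) L)) (den M X r integral_op) u) v) F
        = integ u v F" .
qed


section \<open>Partial derivatives\<close>

lemma ex_tup_arr:
  assumes "tgt M x = Rn n"
  shows "\<exists>as. length as = n \<and> set as \<subseteq> hom M (src M x) L \<and> x = tup_arr M (src M x) as"
  using assms
proof (induction n arbitrary: x)
  case 0
  then show ?case using bang_unique[of x] by auto
next
  case (Suc n)
  then have x: "tgt M x = prd M L (Rn n)" by simp
  then obtain as where as: "length as = n" "set as \<subseteq> hom M (src M x) L"
    "pr2 M L (Rn n) \<odot> x = tup_arr M (src M x) as"
    using Suc.IH[of "pr2 M L (Rn n) \<odot> x"] by auto
  have "x = tup_arr M (src M x) (pr1 M L (Rn n) \<odot> x # as)"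
    using pair_eta[OF x] as by simp
  moreover have "pr1 M L (Rn n) \<odot> x \<in> hom M (src M x) L"
    using x by (simp add: in_hom)
  ultimately show ?case
    using as by (intro exI[of _ "pr1 M L (Rn n) \<odot> x # as"]) simp
qed

lemma tup_arr_crd:
  assumes "tgt M x = Rn n"
  shows "tup_arr M (src M x) (map (\<lambda>j. crd n j x) [0..<n]) = x"
proof -
  obtain as where as: "length as = n" "set as \<subseteq> hom M (src M x) L" "x = tup_arr M (src M x) as"
    using ex_tup_arr[OF assms] by blast
  then have "crd n j x = as ! j" if "j < n" for j
    using crd_tup_arr[OF as(2,1) that] by metis
  then have "map (\<lambda>j. crd n j x) [0..<n] = as"
    by (intro nth_equalityI) (simp_all add: as(1))
  then show ?thesis
    using as(3) by simp
qed

definition shift where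
  "shift n i x e = tup_arr M (src M x)
     (map (\<lambda>j. if j = i then crd n j x \<boxplus> e else crd n j x) [0..<n])"

lemma shift_hom:
  assumes "tgt M x = Rn n" "src M e = src M x" "tgt M e = L"
  shows "set (map (\<lambda>j. if j = i then crd n j x \<boxplus> e else crd n j x) [0..<n]) \<subseteq> hom M (src M x) L"
  using assms by (auto simp: in_hom)

lemma shift_type [simp]:
  assumes "tgt M x = Rn n" "src M e = src M x" "tgt M e = L"
  shows "src M (shift n i x e) = src M x" "tgt M (shift n i x e) = Rn n"
  unfolding shift_def using tup_arr_type[OF shift_hom[OF assms, of i]] by simp_all

lemma shift_comp [simp]:
  assumes "tgt M x = Rn n" "src M e = src M x" "tgt M e = L" "tgt M k = src M x"
  shows "shift n i x e \<odot> k = shift n i (x \<odot> k) (e \<odot> k)"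
  unfolding shift_def
  using assms tup_arr_comp[OF shift_hom[OF assms(1-3), of i] assms(4)]
  by (auto intro!: arg_cong[where f = "tup_arr M _"])

lemma shift_zero [simp]:
  assumes "tgt M x = Rn n" "src M x = X" shows "shift n i x (const X 0) = x"
proof -
  have "map (\<lambda>j. if j = i then crd n j x \<boxplus> const X 0 else crd n j x) [0..<n]
    = map (\<lambda>j. crd n j x) [0..<n]"
    using assms by simp
  then show ?thesis
    using tup_arr_crd[OF assms(1)] assms(2) unfolding shift_def by (simp only:)
qed

lemma is_shift_shift: "is_shift (Rn n) (shift n i)"
  by (simp add: is_shift_def)

abbreviation haspd where "haspd n i \<equiv> derivative_along (Rn n) (shift n i)"

lemma partial:
  shows stable_partial: "stable (partial n i) (Fun (Fun (vec n) Line) (Fun (vec n) Line))"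
    and partial_iff: "env X r \<Longrightarrow> src M f = X \<Longrightarrow> tgt M f = EE n \<Longrightarrow> src M g = X \<Longrightarrow> tgt M g = EE n \<Longrightarrow>
      app (EE n) (den M X r (partial n i)) f = g \<longleftrightarrow> haspd n i f g"
proof -
  let ?x = "(''x'', vec n)" and ?d = "(''d'', Infinitesimals)"
  let ?S = "tup (map (\<lambda>j. if j = i then coord j (Var ?x) \<oplus> Incl (Var ?d) else coord j (Var ?x)) [0..<n])"
  have D: "partial n i = slope_operator (vec n) ''x'' ?S"
    by (simp add: partial_def slope_operator_def Let_def)
  have S: "stable ?S (vec n)"
    by (rule stable_tup) (auto simp: list_all_iff intro!: stable_intros)
  have den_S: "den M Y r ?S = shift n i (r ?x) (incl M \<odot> r ?d)" if "env Y r" for Y r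
    using that unfolding den_tup shift_def
    by (auto simp: den_coord env_type intro!: arg_cong[where f = "tup_arr M _"])
  show "stable (partial n i) (Fun (Fun (vec n) Line) (Fun (vec n) Line))"
    unfolding D by (rule stable_slope_operator[OF is_shift_shift S _ den_S]) simp_all
  show "env X r \<Longrightarrow> src M f = X \<Longrightarrow> tgt M f = EE n \<Longrightarrow> src M g = X \<Longrightarrow> tgt M g = EE n \<Longrightarrow>
      app (EE n) (den M X r (partial n i)) f = g \<longleftrightarrow> haspd n i f g"
    unfolding D by (rule slope_operator_iff[OF is_shift_shift S _ den_S, unfolded obj.simps]) simp_all
qed

text \<open>
  Characterized by the expansion instead of being defined as a denotation, so that it does not
  depend on an environment.
\<close>

definition pd where "pd n i f = (THE g. haspd n i f g)"

lemma ex_haspd: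
  assumes r: "env X r" and f: "src M f = X" "tgt M f = EE n"
  shows "haspd n i f (app (EE n) (den M X r (partial n i)) f)"
proof -
  have "src M (app (EE n) (den M X r (partial n i)) f) = X"
    "tgt M (app (EE n) (den M X r (partial n i)) f) = EE n"
    using stable_type[OF stable_partial[of n i] r] f by simp_all
  from partial_iff[OF r f this, of i] show ?thesis by (rule iffD1) (rule refl)
qed

lemma pd_eqI: "haspd n i f g \<Longrightarrow> pd n i f = g"
proof -
  assume g: "haspd n i f g"
  obtain r where r: "env (src M g) r" using ex_env by blast
  have "h = app (EE n) (den M (src M g) r (partial n i)) f" if h: "haspd n i f h" for h
    using partial_iff[OF r derivative_along_type(1,2)[OF g], of h i] derivative_along_type[OF h] derivative_along_type[OF g] h by metis
  then show ?thesis
    unfolding pd_def using g by (intro the_equality) metis+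
qed

lemma den_partial_pd:
  assumes r: "env X r" and f: "src M f = X" "tgt M f = EE n"
  shows "app (EE n) (den M X r (partial n i)) f = pd n i f"
  by (rule pd_eqI[symmetric]) (rule ex_haspd[OF assms])

lemma haspd_pd:
  assumes f: "tgt M f = EE n" shows "haspd n i f (pd n i f)"
proof -
  obtain r where r: "env (src M f) r" using ex_env by blast
  show ?thesis
    using ex_haspd[OF r refl f, of i] den_partial_pd[OF r refl f, of i] by metis
qed

lemma pd_type [simp]:
  assumes "tgt M f = EE n" shows "src M (pd n i f) = src M f" "tgt M (pd n i f) = EE n"
  using derivative_along_type[OF haspd_pd[OF assms, of i]] by simp_all

lemma pd_comp [simp]:
  assumes "tgt M f = EE n" "tgt M k = src M f" shows "pd n i f \<odot> k = pd n i (f \<odot> k)"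
  using derivative_along_comp[OF haspd_pd[OF assms(1), of i], of k] assms by (intro pd_eqI[symmetric]) simp

section \<open>The Laplace operator\<close>

text \<open>
  The sum is folded as in the term for the Laplace operator, so that the two agree by induction
  on the list of indices.
\<close>

definition lap_sum where
  "lap_sum n is f x = foldr (\<lambda>i s. app L (pd n i (pd n i f)) x \<boxplus> s) is (const (src M x) 0)"

lemma lap_sum_type [simp]:
  assumes "tgt M f = EE n" "tgt M x = Rn n" "src M f = src M x"
  shows "src M (lap_sum n is f x) = src M x" "tgt M (lap_sum n is f x) = L"
  using assms by (induction "is") (simp_all add: lap_sum_def)

lemma lap_sum_comp [simp]:
  assumes "tgt M f = EE n" "tgt M x = Rn n" "src M f = src M x" "tgt M k = src M x"
  shows "lap_sum n is f x \<odot> k = lap_sum n is (f \<odot> k) (x \<odot> k)"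
proof (induction "is")
  case (Cons i "is")
  then show ?case
    using assms lap_sum_type[OF assms(1-3), of "is"] by (simp add: lap_sum_def)
qed (use assms in \<open>simp add: lap_sum_def\<close>)

definition lap where
  "lap n f = lam (src M f) (Rn n) (\<lambda>h. lap_sum n [0..<n] (f \<odot> h))"

lemma natural_lap:
  assumes "tgt M f = EE n"
  shows "natural (src M f) (Rn n) L (\<lambda>h. lap_sum n is (f \<odot> h))"
  by (rule naturalI) (use assms in simp_all)

lemma lap_type [simp]:
  assumes "tgt M f = EE n" shows "src M (lap n f) = src M f" "tgt M (lap n f) = EE n"
  by (simp_all add: lap_def lam_type[OF natural_lap[OF assms]])

lemma app_lap:
  assumes "tgt M f = EE n" "tgt M x = Rn n" "src M h = src M x" "tgt M h = src M f"
  shows "app L (lap n f \<odot> h) x = lap_sum n [0..<n] (f \<odot> h) x"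
  unfolding lap_def by (subst app_lam[OF natural_lap]) (use assms in simp_all)

lemma app_lap_ide:
  assumes "tgt M f = EE n" "tgt M x = Rn n" "src M f = src M x"
  shows "app L (lap n f) x = lap_sum n [0..<n] f x"
  using app_lap[of f n x "ide M (src M x)"] assms by simp

lemma lap_comp [simp]:
  assumes "tgt M f = EE n" "tgt M k = src M f" shows "lap n f \<odot> k = lap n (f \<odot> k)"
  by (rule expo_eqI[of _ "Rn n" L]) (use assms in \<open>simp_all add: app_lap\<close>)

lemma den_laplace:
  shows stable_laplace: "stable (laplace n) (Fun (Fun (vec n) Line) (Fun (vec n) Line))"
    and "env X r \<Longrightarrow> src M f = X \<Longrightarrow> tgt M f = EE n \<Longrightarrow>
      app (EE n) (den M X r (laplace n)) f = lap n f"
proof -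
  let ?f = "(''f'', Fun (vec n) Line)" and ?x = "(''x'', vec n)"
  let ?t = "\<lambda>i. partial n i \<cdot> (partial n i \<cdot> Var ?f) \<cdot> Var ?x"
  have s: "stable (partial n i \<cdot> Var ?f) (Fun (vec n) Line)" "stable (?t i) Line" for i
    by (rule stable_partial stable_intros)+
  have s': "stable (foldr Plus (map ?t is) (Const 0)) Line" for "is"
    by (induction "is") (simp_all add: stable_ops s)
  show st: "stable (laplace n) (Fun (Fun (vec n) Line) (Fun (vec n) Line))"
    unfolding laplace_def Let_def by (rule stable_Lam s')+
  have den_t: "den M X r (?t i) = app L (pd n i (pd n i (r ?f))) (r ?x)" if r: "env X r" for X r i
  proof -
    have "den M X r (partial n i \<cdot> Var ?f) = pd n i (r ?f)"
      using den_App[OF stable_partial stable_Var r, of n i "''f''"] den_partial_pd[OF r, of "r ?f" n i] r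
      by (simp add: env_type)
    then have "den M X r (partial n i \<cdot> (partial n i \<cdot> Var ?f)) = pd n i (pd n i (r ?f))"
      using den_App[OF stable_partial s(1) r, of i i] den_partial_pd[OF r, of "pd n i (r ?f)" n i] r
      by (simp add: env_type)
    then show ?thesis
      using den_App[OF stable_App[OF stable_partial s(1)] stable_Var r, of i i "''x''"] by simp
  qed
  have den_s: "den M X r (foldr Plus (map ?t is) (Const 0))
    = lap_sum n is (r ?f) (r ?x)"
    if r: "env X r" for X r "is"
  proof (induction "is")
    case (Cons i "is")
    then show ?case using den_t[OF r] r by (simp add: lap_sum_def env_type del: den.simps(7))
  qed (use r in \<open>simp add: lap_sum_def env_type\<close>)
  assume *: "env X r" "src M f = X" "tgt M f = EE n"
  let ?D = "den M X r (laplace n)"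
  have D: "src M ?D = X" "tgt M ?D = expo M (EE n) (EE n)"
    using stable_type[OF st *(1)] by simp_all
  show "app (EE n) ?D f = lap n f"
  proof (rule expo_eqI[of _ "Rn n" L])
    fix h x assume h: "tgt M h = src M (lap n f)" "tgt M x = Rn n" "src M h = src M x"
    let ?r = "\<lambda>w. r w \<odot> h"
    have r': "env (src M x) ?r" using * h by (simp flip: h(3))
    have D': "?D \<odot> h = den M (src M x) ?r (laplace n)"
      using stable_comp[OF st *(1), of h] h * by simp
    have "app L (app (EE n) ?D f \<odot> h) x = app L (app (EE n) (den M (src M x) ?r (laplace n)) (f \<odot> h)) x"
      using D h * D' by simp
    also have "app (EE n) (den M (src M x) ?r (laplace n)) (f \<odot> h)
      = den M (src M x) (?r(?f := f \<odot> h)) (Lam ?x (foldr Plus (map ?t [0..<n]) (Const 0)))"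
      using app_Lam[OF stable_Lam[OF s'[of "[0..<n]"], of "''x''" "vec n"] r', of "f \<odot> h" "Fun (vec n) Line" "''f''"] h *
      by (simp add: laplace_def Let_def del: den.simps)
    also have "app L \<dots> x = den M (src M x) (?r(?f := f \<odot> h, ?x := x)) (foldr Plus (map ?t [0..<n]) (Const 0))"
      by (subst app_Lam[OF s', simplified obj.simps]) (use r' h * in simp_all)
    also have "\<dots> = lap_sum n [0..<n] (f \<odot> h) x"
      by (subst den_s) (use r' h * in simp_all)
    also have "\<dots> = app L (lap n f \<odot> h) x"
      using h * by (subst app_lap) simp_all
    finally show "app L (app (EE n) ?D f \<odot> h) x = app L (lap n f \<odot> h) x" .
  qed (use D * in simp_all)
qed

lemma stable_dist_laplace: "stable (dist_laplace n) (Fun (Dist n) (Dist n))"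
  unfolding dist_laplace_def Let_def Dist_def by (rule stable_laplace stable_intros)+

lemma den_dist_laplace:
  assumes "stable m (Dist n)" "env X r" "src M f = X" "tgt M f = EE n"
  shows "app L (den M X r (dist_laplace n \<cdot> m)) f = app L (den M X r m) (lap n f)"
proof -
  let ?m = "(''m'', Dist n)" and ?f = "(''f'', Fun (vec n) Line)"
  have s: "stable (laplace n \<cdot> Var ?f) (Fun (vec n) Line)"
    by (rule stable_laplace stable_intros)+
  have body: "stable (Var ?m \<cdot> (laplace n \<cdot> Var ?f)) Line"
    unfolding Dist_def by (rule stable_laplace stable_intros)+
  let ?r = "r(?m := den M X r m, ?f := f)"
  have r': "env X ?r"
    using assms by (simp add: stable_type)
  have "den M X ?r (laplace n \<cdot> Var ?f) = lap n f"
    using den_App[OF stable_laplace stable_Var r', of n "''f''"] den_laplace(2)[OF r' assms(3,4)] by simp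
  then have "den M X ?r (Var ?m \<cdot> (laplace n \<cdot> Var ?f)) = app L (den M X r m) (lap n f)"
    using app_Var_App[OF r' s, of "''m''" Line] by (simp add: Dist_def del: den.simps(6,7))
  then show ?thesis
    using assms den_Lam_App[OF stable_Lam[OF body, of "''f''" "Fun (vec n) Line", folded Dist_def] assms(1,2), of "''m''"]
      app_Lam[OF body, of X "r(?m := den M X r m)" f "Fun (vec n) Line" "''f''"]
    by (simp add: dist_laplace_def Let_def stable_type Dist_def del: den.simps(6,7))
qed


section \<open>Velocities of maps into the distributions\<close>

lemma slope_comp:
  assumes N: "natural X L L N" and b: "slope X N b" and g: "tgt M g = X"
  shows "slope (src M g) (\<lambda>k. N (g \<odot> k)) (b \<odot> g)"
proof -
  have t: "src M b = X" "tgt M b = L" using b by (simp_all add: slope_def)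
  show ?thesis
    unfolding slope_def
  proof (intro conjI allI impI)
    fix k e assume k: "tgt M k = src M g" "src M k = src M e" "nilsquare e"
    have "tgt M (g \<odot> k) = X" "src M (g \<odot> k) = src M e"
      using k g by simp_all
    from slopeD[OF b this k(3)]
    show "N (g \<odot> k) e = N (g \<odot> k) (const (src M e) 0) \<boxplus> e \<boxtimes> ((b \<odot> g) \<odot> k)"
      using k g t by simp
  qed (use t g in simp_all)
qed

definition speed where
  "speed n X Q t f = (\<lambda>k e. app L (app (DD n) (Q \<odot> k) (t \<odot> k \<boxplus> e)) (f \<odot> k))"

text \<open>
  A map \<open>Q\<close> has the velocity \<open>m\<close> at \<open>t\<close> if \<open>m f\<close> is the slope of \<open>e \<mapsto> Q (t + e) f\<close> for all test
  functions \<open>f\<close> at later stages. This reduces time derivatives with values in an exponential to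
  numbers.
\<close>

definition velocity where
  "velocity n X Q t m \<longleftrightarrow> src M m = X \<and> tgt M m = DD n \<and>
     (\<forall>h f. tgt M h = X \<longrightarrow> tgt M f = EE n \<longrightarrow> src M h = src M f \<longrightarrow>
        slope (src M f) (speed n (src M f) (Q \<odot> h) (t \<odot> h) f) (app L (m \<odot> h) f))"

lemma natural_speed:
  assumes "src M Q = X" "tgt M Q = expo M L (DD n)" "src M t = X" "tgt M t = L" "src M f = X" "tgt M f = EE n"
  shows "natural X L L (speed n X Q t f)"
  unfolding speed_def by (rule naturalI) (use assms in \<open>simp_all add: obj_Dist\<close>)

lemma velocity_unique:
  assumes Q: "src M Q = X" "tgt M Q = expo M L (DD n)" and t: "src M t = X" "tgt M t = L"
    and m: "velocity n X Q t m" "velocity n X Q t m'"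
  shows "m = m'"
proof (rule expo_eqI[of _ "EE n" L])
  show ty: "tgt M m = expo M (EE n) L" "tgt M m' = expo M (EE n) L" "src M m = src M m'"
    using m by (simp_all add: velocity_def obj_Dist)
  fix h f assume h: "tgt M h = src M m'" "tgt M f = EE n" "src M h = src M f"
  have X: "src M m' = X" using m by (simp add: velocity_def)
  have "natural (src M f) L L (speed n (src M f) (Q \<odot> h) (t \<odot> h) f)"
    by (rule natural_speed) (use h X Q t in simp_all)
  moreover have "slope (src M f) (speed n (src M f) (Q \<odot> h) (t \<odot> h) f) (app L (m \<odot> h) f)"
    "slope (src M f) (speed n (src M f) (Q \<odot> h) (t \<odot> h) f) (app L (m' \<odot> h) f)"
    using m h unfolding X velocity_def by blast+
  ultimately show "app L (m \<odot> h) f = app L (m' \<odot> h) f"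
    by (rule slope_unique)
qed

text \<open>
  The slope for the generic test function, a projection, gives the velocity by transposition:
  each test function arises from the generic one by a change of stage, and slopes commute with
  it.
\<close>

lemma velocity_ex:
  assumes Q: "src M Q = X" "tgt M Q = expo M L (DD n)" and t: "src M t = X" "tgt M t = L"
  shows "\<exists>m. velocity n X Q t m"
proof -
  let ?E = "EE n"
  let ?p1 = "pr1 M X ?E" and ?p2 = "pr2 M X ?E"
  let ?N = "speed n (prd M X ?E) (Q \<odot> ?p1) (t \<odot> ?p1) ?p2"
  have N: "natural (prd M X ?E) L L ?N"
    by (rule natural_speed) (use Q t in simp_all)
  then obtain b where b: "slope (prd M X ?E) ?N b"
    using slope_ex1 by blast
  then have bt: "src M b = prd M X ?E" "tgt M b = L"
    by (simp_all add: slope_def)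
  let ?m = "cur M X ?E b"
  have "slope (src M f) (speed n (src M f) (Q \<odot> h) (t \<odot> h) f) (app L (?m \<odot> h) f)"
    if h: "tgt M h = X" "tgt M f = ?E" "src M h = src M f" for h f
  proof -
    have eq: "speed n (prd M X ?E) (Q \<odot> ?p1) (t \<odot> ?p1) ?p2 (pair M h f \<odot> k) e
      = speed n (src M f) (Q \<odot> h) (t \<odot> h) f k e"
      if "tgt M k = src M f" "src M k = src M e" "nilsquare e" for k e
      using that h Q t by (simp add: speed_def)
    have "tgt M (pair M h f) = prd M X ?E" using h by simp
    from slope_comp[OF N b this]
    have "slope (src M f) (\<lambda>k. ?N (pair M h f \<odot> k)) (b \<odot> pair M h f)"
      using h by simp
    then have "slope (src M f) (speed n (src M f) (Q \<odot> h) (t \<odot> h) f) (b \<odot> pair M h f)"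
      by (rule slope_cong[THEN iffD1, rotated]) (rule eq)
    then show ?thesis
      using bt h by simp
  qed
  then have "\<forall>h f. tgt M h = X \<longrightarrow> tgt M f = ?E \<longrightarrow> src M h = src M f \<longrightarrow>
      slope (src M f) (speed n (src M f) (Q \<odot> h) (t \<odot> h) f) (app L (?m \<odot> h) f)"
    by blast
  then show ?thesis
    using bt unfolding velocity_def by (intro exI[of _ ?m]) (simp add: obj_Dist)
qed

text \<open>
  The equation between distributions in the description is tested at all test functions; then it
  is the expansion that defines a velocity.
\<close>

lemma den_dot:
  shows stable_dot: "stable (dot n) (Fun (Fun Line (Dist n)) (Fun Line (Dist n)))"
    and "env X r \<Longrightarrow> src M Q = X \<Longrightarrow> tgt M Q = expo M L (DD n) \<Longrightarrow> src M t = X \<Longrightarrow> tgt M t = L \<Longrightarrow>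
      velocity n X Q t (app (DD n) (app (expo M L (DD n)) (den M X r (dot n)) Q) t)"
proof -
  let ?q = "(''q'', Fun Line (Dist n))" and ?t = "(''t'', Line)" and ?m = "(''m'', Dist n)" and ?d = "(''d'', Infinitesimals)"
  let ?l = "Var ?q \<cdot> (Var ?t \<oplus> Incl (Var ?d))"
  let ?rh = "dist_add n \<cdot> (Var ?q \<cdot> Var ?t) \<cdot> (dist_scale n \<cdot> Incl (Var ?d) \<cdot> Var ?m)"
  let ?p = "?l \<approx> ?rh"
  have s: "stable (Var ?t \<oplus> Incl (Var ?d)) Line" "stable ?l (Dist n)" "stable (Var ?q \<cdot> Var ?t) (Dist n)"
    "stable (dist_scale n \<cdot> Incl (Var ?d) \<cdot> Var ?m) (Dist n)" "stable ?rh (Dist n)" "stable (Incl (Var ?d)) Line"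
    by (rule stable_dist_add stable_dist_scale stable_intros)+
  have p: "m \<in> hom M X (obj M (Dist n)) \<and> forces M X (r(?m := m)) (Forall ?d ?p) \<longleftrightarrow> velocity n X (r ?q) (r ?t) m"
    if r: "env X r" for X r m
  proof (cases "m \<in> hom M X (obj M (Dist n))")
    case True
    then have m: "src M m = X" "tgt M m = DD n" by (simp_all add: in_hom)
    let ?Q = "r ?q" and ?T = "r ?t"
    have QT: "src M ?Q = X" "tgt M ?Q = expo M L (DD n)" "src M ?T = X" "tgt M ?T = L"
      using r by (simp_all add: env_type)
    let ?P = "\<lambda>h e. \<forall>k f. tgt M k = src M e \<longrightarrow> tgt M f = EE n \<longrightarrow> src M k = src M f \<longrightarrow>
        app L (app (DD n) (?Q \<odot> h \<odot> k) (?T \<odot> h \<odot> k \<boxplus> (e \<odot> k))) f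
        = app L (app (DD n) (?Q \<odot> h \<odot> k) (?T \<odot> h \<odot> k)) f \<boxplus> (e \<odot> k) \<boxtimes> app L (m \<odot> h \<odot> k) f"
    have *: "forces M (src M d) ((\<lambda>w. (r(?m := m)) w \<odot> h)(?d := d)) ?p \<longleftrightarrow> ?P h (incl M \<odot> d)"
      if h: "tgt M h = X" "tgt M d = infs M" "src M h = src M d" for h d
    proof -
      let ?r = "(\<lambda>w. (r(?m := m)) w \<odot> h)(?d := d)"
      have r': "env (src M d) ?r" using r m h by (simp del: fun_upd_apply)
      have l: "app L (den M (src M d) ?r ?l \<odot> k) f
          = app L (app (DD n) (?Q \<odot> h \<odot> k) (?T \<odot> h \<odot> k \<boxplus> ((incl M \<odot> d) \<odot> k))) f"
        and rh: "app L (den M (src M d) ?r ?rh \<odot> k) f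
          = app L (app (DD n) (?Q \<odot> h \<odot> k) (?T \<odot> h \<odot> k)) f \<boxplus> ((incl M \<odot> d) \<odot> k) \<boxtimes> app L (m \<odot> h \<odot> k) f"
        if k: "tgt M k = src M d" "tgt M f = EE n" "src M k = src M f" for k f
      proof -
        show "app L (den M (src M d) ?r ?l \<odot> k) f
          = app L (app (DD n) (?Q \<odot> h \<odot> k) (?T \<odot> h \<odot> k \<boxplus> ((incl M \<odot> d) \<odot> k))) f"
          using app_Var_App[OF r' s(1), of "''q''" "Dist n"] h k QT by (simp del: den.simps(7))
        let ?r' = "\<lambda>w. ?r w \<odot> k"
        have r'': "env (src M f) ?r'"
          using env_restrict[OF r' k(1)] k(3) by simp
        have "den M (src M d) ?r ?rh \<odot> k = den M (src M f) ?r' ?rh"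
          using stable_comp[OF s(5) r' k(1)] k(3) by simp
        then have "app L (den M (src M d) ?r ?rh \<odot> k) f = app L (den M (src M f) ?r' (Var ?q \<cdot> Var ?t)) f
          \<boxplus> den M (src M f) ?r' (Incl (Var ?d)) \<boxtimes> app L (den M (src M f) ?r' (Var ?m)) f"
          using den_dist_add[OF s(3,4) r'' refl k(2)] den_dist_scale[OF s(6) stable_Var r'' refl k(2), of "''m''"] by simp
        then show "app L (den M (src M d) ?r ?rh \<odot> k) f
          = app L (app (DD n) (?Q \<odot> h \<odot> k) (?T \<odot> h \<odot> k)) f \<boxplus> ((incl M \<odot> d) \<odot> k) \<boxtimes> app L (m \<odot> h \<odot> k) f"
          using app_Var_App[OF r'' stable_Var, of "''q''" Line "Dist n" "''t''"] h k QT m by (simp del: den.simps(7))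
      qed
      have ty: "src M (den M (src M d) ?r ?l) = src M d" "tgt M (den M (src M d) ?r ?l) = expo M (EE n) L"
        "src M (den M (src M d) ?r ?rh) = src M d" "tgt M (den M (src M d) ?r ?rh) = expo M (EE n) L"
        using stable_type[OF s(2) r'] stable_type[OF s(5) r'] by (simp_all only: obj_Dist)
      show ?thesis
      proof
        assume "forces M (src M d) ?r ?p"
        then have eq: "den M (src M d) ?r ?l = den M (src M d) ?r ?rh" by simp
        show "?P h (incl M \<odot> d)"
        proof (intro allI impI)
          fix k f assume "tgt M k = src M (incl M \<odot> d)" and k: "tgt M f = EE n" "src M k = src M f"
          then have k': "tgt M k = src M d" using h by simp
          show "app L (app (DD n) (?Q \<odot> h \<odot> k) (?T \<odot> h \<odot> k \<boxplus> ((incl M \<odot> d) \<odot> k))) f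
            = app L (app (DD n) (?Q \<odot> h \<odot> k) (?T \<odot> h \<odot> k)) f \<boxplus> ((incl M \<odot> d) \<odot> k) \<boxtimes> app L (m \<odot> h \<odot> k) f"
            using l[OF k' k] rh[OF k' k] eq by metis
        qed
      next
        assume P: "?P h (incl M \<odot> d)"
        have "den M (src M d) ?r ?l = den M (src M d) ?r ?rh"
        proof (rule expo_eqI[OF ty(2,4)])
          fix k f assume "tgt M k = src M (den M (src M d) ?r ?rh)" and k: "tgt M f = EE n" "src M k = src M f"
          then have k': "tgt M k = src M d" "tgt M k = src M (incl M \<odot> d)" using ty h by simp_all
          show "app L (den M (src M d) ?r ?l \<odot> k) f = app L (den M (src M d) ?r ?rh \<odot> k) f"
            using l[OF k'(1) k] rh[OF k'(1) k] P k k' by metis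
        qed (simp only: ty)
        then show "forces M (src M d) ?r ?p" by simp
      qed
    qed
    have "forces M X (r(?m := m)) (Forall ?d ?p) \<longleftrightarrow>
      (\<forall>h e. tgt M h = X \<longrightarrow> src M h = src M e \<longrightarrow> nilsquare e \<longrightarrow> ?P h e)"
      by (rule forces_Forall_infs) (rule *)
    also have "\<dots> \<longleftrightarrow> velocity n X ?Q ?T m"
    proof
      assume P: "\<forall>h e. tgt M h = X \<longrightarrow> src M h = src M e \<longrightarrow> nilsquare e \<longrightarrow> ?P h e"
      show "velocity n X ?Q ?T m"
        unfolding velocity_def slope_def
      proof (intro conjI allI impI)
        fix h f k e assume h: "tgt M h = X" "tgt M f = EE n" "src M h = src M f"
          and k: "tgt M k = src M f" "src M k = src M e" "nilsquare e"
        have "tgt M (h \<odot> k) = X" "src M (h \<odot> k) = src M e"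
          using h k by simp_all
        then have "?P (h \<odot> k) e"
          using P k(3) by blast
        moreover have "tgt M (f \<odot> k) = EE n" "src M (ide M (src M e)) = src M (f \<odot> k)"
          using h k by simp_all
        ultimately have "app L (app (DD n) (?Q \<odot> (h \<odot> k) \<odot> ide M (src M e)) (?T \<odot> (h \<odot> k) \<odot> ide M (src M e) \<boxplus> (e \<odot> ide M (src M e)))) (f \<odot> k)
          = app L (app (DD n) (?Q \<odot> (h \<odot> k) \<odot> ide M (src M e)) (?T \<odot> (h \<odot> k) \<odot> ide M (src M e))) (f \<odot> k)
            \<boxplus> (e \<odot> ide M (src M e)) \<boxtimes> app L (m \<odot> (h \<odot> k) \<odot> ide M (src M e)) (f \<odot> k)"
          using ide_type(2)[of "src M e"] by blast
        then show "speed n (src M f) (?Q \<odot> h) (?T \<odot> h) f k e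
          = speed n (src M f) (?Q \<odot> h) (?T \<odot> h) f k (const (src M e) 0) \<boxplus> e \<boxtimes> (app L (m \<odot> h) f \<odot> k)"
          using h k QT m by (simp add: speed_def obj_Dist)
      qed (use m in \<open>simp_all add: obj_Dist\<close>)
    next
      assume v: "velocity n X ?Q ?T m"
      show "\<forall>h e. tgt M h = X \<longrightarrow> src M h = src M e \<longrightarrow> nilsquare e \<longrightarrow> ?P h e"
      proof (intro allI impI)
        fix h e k f assume h: "tgt M h = X" "src M h = src M e" "nilsquare e"
          and k: "tgt M k = src M e" "tgt M f = EE n" "src M k = src M f"
        have "slope (src M f) (speed n (src M f) (?Q \<odot> h \<odot> k) (?T \<odot> h \<odot> k) f) (app L (m \<odot> h \<odot> k) f)"
          using v[unfolded velocity_def] h k by simp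
        moreover have "tgt M (ide M (src M f)) = src M f" "src M (ide M (src M f)) = src M (e \<odot> k)" "nilsquare (e \<odot> k)"
          using h k by simp_all
        ultimately have "speed n (src M f) (?Q \<odot> h \<odot> k) (?T \<odot> h \<odot> k) f (ide M (src M f)) (e \<odot> k)
          = speed n (src M f) (?Q \<odot> h \<odot> k) (?T \<odot> h \<odot> k) f (ide M (src M f)) (const (src M (e \<odot> k)) 0)
            \<boxplus> (e \<odot> k) \<boxtimes> (app L (m \<odot> h \<odot> k) f \<odot> ide M (src M f))"
          by (rule slopeD)
        then show "app L (app (DD n) (?Q \<odot> h \<odot> k) (?T \<odot> h \<odot> k \<boxplus> (e \<odot> k))) f
          = app L (app (DD n) (?Q \<odot> h \<odot> k) (?T \<odot> h \<odot> k)) f \<boxplus> (e \<odot> k) \<boxtimes> app L (m \<odot> h \<odot> k) f"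
          using h k QT m by (simp add: speed_def obj_Dist)
      qed
    qed
    finally show ?thesis using True by blast
  qed (auto simp: velocity_def in_hom)
  have ex1: "\<exists>!m. m \<in> hom M X (obj M (Dist n)) \<and> forces M X (r(?m := m)) (Forall ?d ?p)" if r: "env X r" for X r
    unfolding p[OF r] using velocity_ex[of "r ?q" X n "r ?t"] velocity_unique[of "r ?q" X n "r ?t"] r
    by (auto simp: env_type)
  have D1: "stable (Descr ?m (Forall ?d ?p)) (Dist n)"
    by (rule stable_Descr(1)) (rule ex1 forces_Forall_restrict, assumption+)+
  have D2: "velocity n X (r ?q) (r ?t) (den M X r (Descr ?m (Forall ?d ?p)))" if r: "env X r" for X r
  proof -
    have "forces M X (r(?m := den M X r (Descr ?m (Forall ?d ?p)))) (Forall ?d ?p)"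
      by (rule stable_Descr(2)[OF _ _ r]) (rule ex1 forces_Forall_restrict, assumption+)+
    moreover have "den M X r (Descr ?m (Forall ?d ?p)) \<in> hom M X (obj M (Dist n))"
      unfolding in_hom using stable_type[OF D1 r] by blast
    ultimately show ?thesis
      using p[OF r] by blast
  qed
  show "stable (dot n) (Fun (Fun Line (Dist n)) (Fun Line (Dist n)))"
    unfolding dot_def Let_def by (rule stable_Lam D1)+
  assume *: "env X r" "src M Q = X" "tgt M Q = expo M L (DD n)" "src M t = X" "tgt M t = L"
  have "app (DD n) (app (expo M L (DD n)) (den M X r (dot n)) Q) t
    = den M X (r(?q := Q, ?t := t)) (Descr ?m (Forall ?d ?p))"
    using app_Lam[OF stable_Lam[OF D1, of "''t''" Line], of X r Q "Fun Line (Dist n)" "''q''"]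
      app_Lam[OF D1, of X "r(?q := Q)" t Line "''t''"] *
    by (simp add: dot_def Let_def del: den.simps)
  then show "velocity n X Q t (app (DD n) (app (expo M L (DD n)) (den M X r (dot n)) Q) t)"
    using D2[of X "r(?q := Q, ?t := t)"] * by (simp del: den.simps)
qed


section \<open>Integrals of families\<close>

lemma lam_cong:
  assumes "\<And>h a. tgt M h = X \<Longrightarrow> tgt M a = A \<Longrightarrow> src M h = src M a \<Longrightarrow> N h a = N' h a"
  shows "lam X A N = lam X A N'"
  by (simp add: lam_def assms)

text \<open>Integrals with constant bounds of functions that are given by their values.\<close>

definition itg where "itg X u v N = integ (const X u) (const X v) (lam X L N)"

lemma itg_cong:
  assumes "\<And>h a. tgt M h = X \<Longrightarrow> tgt M a = L \<Longrightarrow> src M h = src M a \<Longrightarrow> N h a = N' h a"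
  shows "itg X u v N = itg X u v N'"
  unfolding itg_def using lam_cong[OF assms] by simp

lemma itg_type [simp]:
  assumes "natural X L L N" shows "src M (itg X u v N) = X" "tgt M (itg X u v N) = L"
  using assms by (simp_all add: itg_def)

lemma itg_comp:
  assumes "natural X L L N" "tgt M k = X"
  shows "itg X u v N \<odot> k = itg (src M k) u v (\<lambda>h. N (k \<odot> h))"
  using assms by (simp add: itg_def lam_comp)

definition fder where
  "fder X G N \<longleftrightarrow> natural X L L G \<and> natural X L L N \<and>
    (\<forall>h a e. tgt M h = X \<longrightarrow> tgt M a = L \<longrightarrow> src M h = src M a \<longrightarrow> src M e = src M a \<longrightarrow> nilsquare e \<longrightarrow>
      G h (a \<boxplus> e) = G h a \<boxplus> e \<boxtimes> N h a)"

lemma fderI: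
  assumes "natural X L L G" "natural X L L N"
    "\<And>h a e. tgt M h = X \<Longrightarrow> tgt M a = L \<Longrightarrow> src M h = src M a \<Longrightarrow> src M e = src M a \<Longrightarrow> nilsquare e \<Longrightarrow>
      G h (a \<boxplus> e) = G h a \<boxplus> e \<boxtimes> N h a"
  shows "fder X G N"
  using assms unfolding fder_def by blast

lemma fderD:
  assumes "fder X G N" "tgt M h = X" "tgt M a = L" "src M h = src M a" "src M e = src M a" "nilsquare e"
  shows "G h (a \<boxplus> e) = G h a \<boxplus> e \<boxtimes> N h a"
  using assms(1)[unfolded fder_def] assms(2-) by blast

lemma fder_natural: "fder X G N \<Longrightarrow> natural X L L G" "fder X G N \<Longrightarrow> natural X L L N"
  by (simp_all add: fder_def)

lemma hasder_lam:
  assumes "fder X G N" shows "hasder (lam X L G) (lam X L N)"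
  unfolding derivative_along_def
proof (intro conjI allI impI)
  fix h a e assume "tgt M h = src M (lam X L N)" "tgt M a = L" "src M h = src M a" "src M e = src M a" "nilsquare e"
  then show "app L (lam X L G \<odot> h) (a \<boxplus> e) = app L (lam X L G \<odot> h) a \<boxplus> e \<boxtimes> app L (lam X L N \<odot> h) a"
    using fder_natural[OF assms] by (simp add: fderD[OF assms])
qed (use fder_natural[OF assms] in simp_all)

lemma antiderivative_family:
  assumes N: "natural X L L N"
  obtains G where "fder X G N" "G (ide M X) (const X u) = const X 0"
    "\<forall>v. itg X u v N = G (ide M X) (const X v)"
proof -
  have F: "src M (lam X L N) = X" "tgt M (lam X L N) = expo M L L"
    using N by simp_all
  obtain G where G: "hasder G (lam X L N)" "app L G (const X u) = const X 0" "src M G = X" "tgt M G = expo M L L"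
    "\<And>v. src M v = X \<Longrightarrow> tgt M v = L \<Longrightarrow> integ (const X u) v (lam X L N) = app L G v"
    using antiderivativeE[OF F(2), of "const X u"] F(1) by auto
  have "fder X (\<lambda>h a. app L (G \<odot> h) a) N"
  proof (rule fderI)
    show "natural X L L (\<lambda>h a. app L (G \<odot> h) a)"
      by (rule naturalI) (use G in simp_all)
    fix h a e assume h: "tgt M h = X" "tgt M a = L" "src M h = src M a" "src M e = src M a" "nilsquare e"
    then have "app L (G \<odot> h) (a \<boxplus> e) = app L (G \<odot> h) a \<boxplus> e \<boxtimes> app L (lam X L N \<odot> h) a"
      using F by (intro derivative_alongD[OF G(1)]) simp_all
    then show "app L (G \<odot> h) (a \<boxplus> e) = app L (G \<odot> h) a \<boxplus> e \<boxtimes> N h a"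
      using N h by simp
  qed (rule N)
  then show thesis
    by (rule that) (use G in \<open>simp_all add: itg_def\<close>)
qed

text \<open>
  The fundamental theorem of calculus. The antiderivative that vanishes at the lower bound is
  \<open>G\<close> minus its value there.
\<close>

lemma itg_fder:
  assumes G: "fder X G N"
  shows "itg X u v N \<boxplus> G (ide M X) (const X u) = G (ide M X) (const X v)"
proof -
  note nat = fder_natural[OF G]
  let ?u = "G (ide M X) (const X u)"
  have u: "src M ?u = X" "tgt M ?u = L"
    using nat by (simp_all add: natural_type)
  let ?c = "\<lambda>h. const (src M h) (- 1) \<boxtimes> (?u \<odot> h)"
  have "fder X (\<lambda>h a. G h a \<boxplus> ?c h) N"
  proof (rule fderI)
    show "natural X L L (\<lambda>h a. G h a \<boxplus> ?c h)"
      by (rule naturalI) (use u nat in \<open>simp_all add: natural_type natural_comp[OF nat(1)]\<close>)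
    fix h a e assume h: "tgt M h = X" "tgt M a = L" "src M h = src M a" "src M e = src M a" "nilsquare e"
    have eq: "(x \<boxplus> e \<boxtimes> n) \<boxplus> y = (x \<boxplus> y) \<boxplus> e \<boxtimes> n" if "elements Y [x, y, e, n]" for x y n e Y
      by (rule line_atoms[OF that]) (simp_all add: val_fold algebra_simps)
    show "G h (a \<boxplus> e) \<boxplus> ?c h = (G h a \<boxplus> ?c h) \<boxplus> e \<boxtimes> N h a"
      unfolding fderD[OF G h] by (rule eq[of "src M a"]) (use h u nat in \<open>simp_all add: natural_type\<close>)
  qed (rule nat)
  note der = hasder_lam[OF this] and nat' = fder_natural(1)[OF this]
  have cancel: "x \<boxplus> const Y (- 1) \<boxtimes> x = const Y 0" "(y \<boxplus> const Y (- 1) \<boxtimes> x) \<boxplus> x = y"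
    if "src M x = Y" "tgt M x = L" "src M y = Y" "tgt M y = L" for x y Y
    by (rule line_atoms[of Y "[x, y]"]; use that in \<open>simp add: val_fold algebra_simps\<close>)+
  have "itg X u v N = app L (lam X L (\<lambda>h a. G h a \<boxplus> ?c h)) (const X v)"
    unfolding itg_def by (rule integ_eq[OF der]) (use nat nat' u in \<open>simp_all add: cancel(1)[OF u u]\<close>)
  then show ?thesis
    using nat' u nat by (simp add: natural_type cancel(2)[of _ X])
qed

lemma itg_zero: "itg X u v (\<lambda>h a. const (src M a) 0) = const X 0"
proof -
  have nat: "natural X L L (\<lambda>h a. const (src M a) 0)"
    by (rule naturalI) simp_all
  have "fder X (\<lambda>h a. const (src M a) 0) (\<lambda>h a. const (src M a) 0)"
    by (rule fderI[OF nat nat]) simp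
  from itg_fder[OF this, of u v] show ?thesis
    using nat by simp
qed

text \<open>
  A sum of antiderivatives is an antiderivative of the sum; \<open>itg_scale\<close> is similar.
\<close>

lemma itg_add:
  assumes N: "natural X L L N" and N': "natural X L L N'"
  shows "itg X u v (\<lambda>h a. N h a \<boxplus> N' h a) = itg X u v N \<boxplus> itg X u v N'"
proof -
  obtain G where G: "fder X G N" "G (ide M X) (const X u) = const X 0"
    "\<forall>v. itg X u v N = G (ide M X) (const X v)"
    using antiderivative_family[OF N, of u] by blast
  obtain G' where G': "fder X G' N'" "G' (ide M X) (const X u) = const X 0"
    "\<forall>v. itg X u v N' = G' (ide M X) (const X v)"
    using antiderivative_family[OF N', of u] by blast
  note nat = N N' fder_natural(1)[OF G(1)] fder_natural(1)[OF G'(1)]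
  have natN: "natural X L L (\<lambda>h a. N h a \<boxplus> N' h a)"
    by (rule naturalI) (simp_all add: nat[THEN natural_type(1)] nat[THEN natural_type(2)]
      natural_comp[OF N] natural_comp[OF N'])
  have "fder X (\<lambda>h a. G h a \<boxplus> G' h a) (\<lambda>h a. N h a \<boxplus> N' h a)"
  proof (rule fderI[OF _ natN])
    show "natural X L L (\<lambda>h a. G h a \<boxplus> G' h a)"
      by (rule naturalI) (simp_all add: nat[THEN natural_type(1)] nat[THEN natural_type(2)]
        natural_comp[OF nat(3)] natural_comp[OF nat(4)])
    fix h a e assume h: "tgt M h = X" "tgt M a = L" "src M h = src M a" "src M e = src M a" "nilsquare e"
    have eq: "(x \<boxplus> e \<boxtimes> n) \<boxplus> (y \<boxplus> e \<boxtimes> m) = (x \<boxplus> y) \<boxplus> e \<boxtimes> (n \<boxplus> m)"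
      if "elements Y [x, y, e, n, m]" for x y n m e Y
      by (rule line_atoms[OF that]) (simp_all add: val_fold algebra_simps)
    show "G h (a \<boxplus> e) \<boxplus> G' h (a \<boxplus> e) = (G h a \<boxplus> G' h a) \<boxplus> e \<boxtimes> (N h a \<boxplus> N' h a)"
      using h by (simp add: fderD[OF G(1)] fderD[OF G'(1)] nat[THEN natural_type(1)] nat[THEN natural_type(2)] eq[of "src M a"])
  qed
  from itg_fder[OF this, of u v] show ?thesis
    using natN by (simp add: G(2,3) G'(2,3))
qed

lemma itg_scale:
  assumes N: "natural X L L N" and c: "src M c = X" "tgt M c = L"
  shows "itg X u v (\<lambda>h a. (c \<odot> h) \<boxtimes> N h a) = c \<boxtimes> itg X u v N"
proof -
  obtain G where G: "fder X G N" "G (ide M X) (const X u) = const X 0"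
    "\<forall>v. itg X u v N = G (ide M X) (const X v)"
    using antiderivative_family[OF N, of u] by blast
  note nat = N fder_natural(1)[OF G(1)]
  have natN: "natural X L L (\<lambda>h a. (c \<odot> h) \<boxtimes> N h a)"
    by (rule naturalI) (simp_all add: c nat[THEN natural_type(1)] nat[THEN natural_type(2)] natural_comp[OF N])
  have "fder X (\<lambda>h a. (c \<odot> h) \<boxtimes> G h a) (\<lambda>h a. (c \<odot> h) \<boxtimes> N h a)"
  proof (rule fderI[OF _ natN])
    show "natural X L L (\<lambda>h a. (c \<odot> h) \<boxtimes> G h a)"
      by (rule naturalI) (simp_all add: c nat[THEN natural_type(1)] nat[THEN natural_type(2)] natural_comp[OF nat(2)])
    fix h a e assume h: "tgt M h = X" "tgt M a = L" "src M h = src M a" "src M e = src M a" "nilsquare e"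
    have eq: "c \<boxtimes> (x \<boxplus> e \<boxtimes> n) = c \<boxtimes> x \<boxplus> e \<boxtimes> (c \<boxtimes> n)"
      if "elements Y [x, e, n, c]" for x n c e Y
      by (rule line_atoms[OF that]) (simp_all add: val_fold algebra_simps)
    show "(c \<odot> h) \<boxtimes> G h (a \<boxplus> e) = (c \<odot> h) \<boxtimes> G h a \<boxplus> e \<boxtimes> ((c \<odot> h) \<boxtimes> N h a)"
      using h c by (simp add: fderD[OF G(1)] nat[THEN natural_type(1)] nat[THEN natural_type(2)] eq[of "src M a"])
  qed
  from itg_fder[OF this, of u v] show ?thesis
    using natN c by (simp add: G(2,3))
qed

section \<open>Integrals over the sphere in polar coordinates\<close>

definition natural2 where
  "natural2 X G \<longleftrightarrow> (\<forall>h p q. tgt M h = X \<longrightarrow> tgt M p = L \<longrightarrow> tgt M q = L \<longrightarrow> src M h = src M q \<longrightarrow> src M p = src M q \<longrightarrow>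
     src M (G h p q) = src M q \<and> tgt M (G h p q) = L \<and>
     (\<forall>k. tgt M k = src M q \<longrightarrow> G h p q \<odot> k = G (h \<odot> k) (p \<odot> k) (q \<odot> k)))"

lemma natural2I:
  assumes "\<And>h p q. tgt M h = X \<Longrightarrow> tgt M p = L \<Longrightarrow> tgt M q = L \<Longrightarrow> src M h = src M q \<Longrightarrow> src M p = src M q \<Longrightarrow>
      src M (G h p q) = src M q \<and> tgt M (G h p q) = L"
    "\<And>h p q k. tgt M h = X \<Longrightarrow> tgt M p = L \<Longrightarrow> tgt M q = L \<Longrightarrow> src M h = src M q \<Longrightarrow> src M p = src M q \<Longrightarrow>
      tgt M k = src M q \<Longrightarrow> G h p q \<odot> k = G (h \<odot> k) (p \<odot> k) (q \<odot> k)"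
  shows "natural2 X G"
  using assms unfolding natural2_def by blast

lemma natural2_type:
  assumes "natural2 X G" "tgt M h = X" "tgt M p = L" "tgt M q = L" "src M h = src M q" "src M p = src M q"
  shows "src M (G h p q) = src M q" "tgt M (G h p q) = L"
  using assms unfolding natural2_def by blast+

lemma natural2_comp:
  assumes "natural2 X G" "tgt M h = X" "tgt M p = L" "tgt M q = L" "src M h = src M q" "src M p = src M q" "tgt M k = src M q"
  shows "G h p q \<odot> k = G (h \<odot> k) (p \<odot> k) (q \<odot> k)"
  using assms unfolding natural2_def by blast

text \<open>
  In \<open>G h p q\<close>, the polar angle \<open>p\<close> ranges from \<open>0\<close> to \<open>\<pi>\<close> and the azimuth \<open>q\<close> from \<open>0\<close> to \<open>2\<pi>\<close>.
\<close>

definition inner where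
  "inner G u v h p = itg (src M p) u v (\<lambda>k q. G (h \<odot> k) (p \<odot> k) q)"

definition dbl where
  "dbl X G = itg X 0 pi (inner G 0 (2 * pi))"

lemma natural_slice:
  assumes G: "natural2 X G" and h: "tgt M h = X" "tgt M p = L" "src M h = src M p"
  shows "natural (src M p) L L (\<lambda>k q. G (h \<odot> k) (p \<odot> k) q)"
  by (rule naturalI) (use h in \<open>simp_all add: natural2_type[OF G] natural2_comp[OF G]\<close>)

lemma natural_inner:
  assumes G: "natural2 X G" shows "natural X L L (inner G u v)"
proof (rule naturalI)
  fix h p k assume h: "tgt M h = X" "tgt M p = L" "src M h = src M p" and k: "tgt M k = src M p"
  have "inner G u v h p \<odot> k = itg (src M k) u v (\<lambda>k' q. G (h \<odot> k \<odot> k') (p \<odot> k \<odot> k') q)"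
    unfolding inner_def using itg_comp[OF natural_slice[OF G h] k] .
  also have "\<dots> = inner G u v (h \<odot> k) (p \<odot> k)"
  proof -
    have "src M (p \<odot> k) = src M k" using h k by simp
    then show ?thesis
      unfolding inner_def by (simp only:) (rule itg_cong, use h k in simp)
  qed
  finally show "inner G u v h p \<odot> k = inner G u v (h \<odot> k) (p \<odot> k)" .
qed (simp add: inner_def natural_slice[OF G])

lemma dbl_type [simp]:
  assumes "natural2 X G" shows "src M (dbl X G) = X" "tgt M (dbl X G) = L"
  using natural_inner[OF assms] by (simp_all add: dbl_def)

lemma inner_cong:
  assumes "tgt M h = X" "tgt M p = L" "src M h = src M p"
    "\<And>h p q. tgt M h = X \<Longrightarrow> tgt M p = L \<Longrightarrow> tgt M q = L \<Longrightarrow> src M h = src M q \<Longrightarrow> src M p = src M q \<Longrightarrow>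
      G h p q = G' h p q"
  shows "inner G u v h p = inner G' u v h p"
  unfolding inner_def by (rule itg_cong, rule assms(4)) (use assms(1-3) in simp_all)

lemma dbl_cong:
  assumes "\<And>h p q. tgt M h = X \<Longrightarrow> tgt M p = L \<Longrightarrow> tgt M q = L \<Longrightarrow> src M h = src M q \<Longrightarrow> src M p = src M q \<Longrightarrow>
      G h p q = G' h p q"
  shows "dbl X G = dbl X G'"
  unfolding dbl_def by (rule itg_cong, rule inner_cong[of _ X]) (assumption | rule assms)+

lemma dbl_comp:
  assumes G: "natural2 X G" and k: "tgt M k = X"
  shows "dbl X G \<odot> k = dbl (src M k) (\<lambda>h. G (k \<odot> h))"
proof -
  have "dbl X G \<odot> k = itg (src M k) 0 pi (\<lambda>h. inner G 0 (2 * pi) (k \<odot> h))"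
    unfolding dbl_def using itg_comp[OF natural_inner[OF G] k] .
  also have "\<dots> = dbl (src M k) (\<lambda>h. G (k \<odot> h))"
    unfolding dbl_def inner_def by (rule itg_cong, rule itg_cong) (use k in simp)
  finally show ?thesis .
qed

lemma dbl_add:
  assumes G: "natural2 X G" and G': "natural2 X G'"
  shows "dbl X (\<lambda>h p q. G h p q \<boxplus> G' h p q) = dbl X G \<boxplus> dbl X G'"
proof -
  have "dbl X (\<lambda>h p q. G h p q \<boxplus> G' h p q) = itg X 0 pi (\<lambda>h p. inner G 0 (2 * pi) h p \<boxplus> inner G' 0 (2 * pi) h p)"
    unfolding dbl_def inner_def
    by (rule itg_cong) (rule itg_add[OF natural_slice[OF G] natural_slice[OF G']])
  then show ?thesis
    using itg_add[OF natural_inner[OF G] natural_inner[OF G']] by (simp add: dbl_def)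
qed

lemma dbl_scale:
  assumes G: "natural2 X G" and c: "src M c = X" "tgt M c = L"
  shows "dbl X (\<lambda>h p q. (c \<odot> h) \<boxtimes> G h p q) = c \<boxtimes> dbl X G"
proof -
  have "dbl X (\<lambda>h p q. (c \<odot> h) \<boxtimes> G h p q) = itg X 0 pi (\<lambda>h p. (c \<odot> h) \<boxtimes> inner G 0 (2 * pi) h p)"
    unfolding dbl_def
  proof (rule itg_cong)
    fix h p assume h: "tgt M h = X" "tgt M p = L" "src M h = src M p"
    have "inner (\<lambda>h p q. (c \<odot> h) \<boxtimes> G h p q) 0 (2 * pi) h p
      = itg (src M p) 0 (2 * pi) (\<lambda>k q. ((c \<odot> h) \<odot> k) \<boxtimes> G (h \<odot> k) (p \<odot> k) q)"
      unfolding inner_def by (rule itg_cong) (use h c in simp)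
    also have "\<dots> = (c \<odot> h) \<boxtimes> inner G 0 (2 * pi) h p"
      unfolding inner_def by (rule itg_scale[OF natural_slice[OF G h]]) (use h c in simp_all)
    finally show "inner (\<lambda>h p q. (c \<odot> h) \<boxtimes> G h p q) 0 (2 * pi) h p = (c \<odot> h) \<boxtimes> inner G 0 (2 * pi) h p" .
  qed
  then show ?thesis
    using itg_scale[OF natural_inner[OF G] c] by (simp add: dbl_def)
qed

text \<open>
  The inner integral of a derivative in the azimuth is a difference of boundary values, which
  vanishes by periodicity.
\<close>

lemma dbl_theta_derivative:
  assumes U: "natural2 X U" and U': "natural2 X U'"
    and der: "\<And>h p q e. tgt M h = X \<Longrightarrow> tgt M p = L \<Longrightarrow> tgt M q = L \<Longrightarrow> src M h = src M q \<Longrightarrow> src M p = src M q \<Longrightarrow>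
      src M e = src M q \<Longrightarrow> nilsquare e \<Longrightarrow> U h p (q \<boxplus> e) = U h p q \<boxplus> e \<boxtimes> U' h p q"
    and periodic: "\<And>h p. tgt M h = X \<Longrightarrow> tgt M p = L \<Longrightarrow> src M h = src M p \<Longrightarrow>
      U h p (const (src M p) (2 * pi)) = U h p (const (src M p) 0)"
  shows "dbl X U' = const X 0"
proof -
  have "inner U' 0 (2 * pi) h p = const (src M p) 0" if h: "tgt M h = X" "tgt M p = L" "src M h = src M p" for h p
  proof -
    let ?Y = "src M p"
    have "fder ?Y (\<lambda>k q. U (h \<odot> k) (p \<odot> k) q) (\<lambda>k q. U' (h \<odot> k) (p \<odot> k) q)"
      by (rule fderI[OF natural_slice[OF U h] natural_slice[OF U' h]], rule der) (use h in simp_all)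
    from itg_fder[OF this, of 0 "2 * pi"]
    have "U h p (const ?Y 0) \<boxplus> inner U' 0 (2 * pi) h p = U h p (const ?Y 0) \<boxplus> const ?Y 0"
      using h plus_commute[of "inner U' 0 (2 * pi) h p" ?Y "U h p (const ?Y 0)"] natural_slice[OF U' h]
      by (simp add: periodic natural2_type[OF U] inner_def)
    then show ?thesis
      by (rule plus_left_cancel) (use h natural_slice[OF U' h] in \<open>simp_all add: natural2_type[OF U] inner_def\<close>)
  qed
  then have "dbl X U' = itg X 0 pi (\<lambda>h p. const (src M p) 0)"
    unfolding dbl_def by (intro itg_cong) simp
  then show ?thesis by (simp add: itg_zero)
qed

text \<open>
  Differentiation under the integral sign is additivity of the integral, applied to the
  expansion of the integrand at \<open>p + e\<close>. So the inner integral of \<open>V\<close> is an antiderivative of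
  that of \<open>V'\<close>, and it vanishes at both poles.
\<close>

lemma dbl_phi_derivative:
  assumes V: "natural2 X V" and V': "natural2 X V'"
    and der: "\<And>h p q e. tgt M h = X \<Longrightarrow> tgt M p = L \<Longrightarrow> tgt M q = L \<Longrightarrow> src M h = src M q \<Longrightarrow> src M p = src M q \<Longrightarrow>
      src M e = src M q \<Longrightarrow> nilsquare e \<Longrightarrow> V h (p \<boxplus> e) q = V h p q \<boxplus> e \<boxtimes> V' h p q"
    and boundary: "\<And>h q. tgt M h = X \<Longrightarrow> tgt M q = L \<Longrightarrow> src M h = src M q \<Longrightarrow> V h (const (src M q) 0) q = const (src M q) 0"
      "\<And>h q. tgt M h = X \<Longrightarrow> tgt M q = L \<Longrightarrow> src M h = src M q \<Longrightarrow> V h (const (src M q) pi) q = const (src M q) 0"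
  shows "dbl X V' = const X 0"
proof -
  have "fder X (inner V 0 (2 * pi)) (inner V' 0 (2 * pi))"
  proof (rule fderI[OF natural_inner[OF V] natural_inner[OF V']])
    fix h p e assume h: "tgt M h = X" "tgt M p = L" "src M h = src M p" "src M e = src M p" "nilsquare e"
    note sl = natural_slice[OF V h(1-3)] natural_slice[OF V' h(1-3)]
    have e: "src M e = src M p" "tgt M e = L" using h by simp_all
    have pe: "src M (p \<boxplus> e) = src M p" using h by simp
    have nat: "natural (src M p) L L (\<lambda>k q. (e \<odot> k) \<boxtimes> V' (h \<odot> k) (p \<odot> k) q)"
      by (rule naturalI) (use h in \<open>simp_all add: natural2_type[OF V'] natural2_comp[OF V']\<close>)
    have "inner V 0 (2 * pi) h (p \<boxplus> e)
      = itg (src M p) 0 (2 * pi) (\<lambda>k q. V (h \<odot> k) (p \<odot> k) q \<boxplus> (e \<odot> k) \<boxtimes> V' (h \<odot> k) (p \<odot> k) q)"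
      unfolding inner_def pe by (rule itg_cong) (use h in \<open>simp add: der\<close>)
    also have "\<dots> = inner V 0 (2 * pi) h p \<boxplus> e \<boxtimes> inner V' 0 (2 * pi) h p"
      unfolding inner_def itg_add[OF sl(1) nat] itg_scale[OF sl(2) e] ..
    finally show "inner V 0 (2 * pi) h (p \<boxplus> e) = inner V 0 (2 * pi) h p \<boxplus> e \<boxtimes> inner V' 0 (2 * pi) h p" .
  qed
  note F = itg_fder[OF this, of 0 pi]
  have z: "inner V 0 (2 * pi) (ide M X) (const X a) = const X 0" if "a = 0 \<or> a = pi" for a
  proof -
    have "inner V 0 (2 * pi) (ide M X) (const X a) = itg X 0 (2 * pi) (\<lambda>k q. const (src M q) 0)"
      unfolding inner_def const_type by (rule itg_cong) (use that boundary in auto)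
    then show ?thesis by (simp add: itg_zero)
  qed
  show ?thesis
    using F z[of 0] z[of pi] V' by (simp add: dbl_def natural_inner)
qed


section \<open>Expansion of sine, cosine and functions of two variables\<close>

lemma nil_drop:
  assumes "a = b \<boxplus> (e \<boxtimes> e) \<boxtimes> c" "nilsquare e" "src M b = X" "src M c = X" "src M e = X"
    "tgt M b = L" "tgt M c = L"
  shows "a = b"
  using assms(2-) unfolding assms(1) by (simp add: nilsquare_def)

text \<open>
  By the addition theorems it suffices that \<open>sin e = e\<close> and \<open>cos e = 1\<close>, which are the
  expansions of the two series with remainders \<open>e\<^sup>2 qs e\<close> and \<open>e\<^sup>2 qc e\<close>.
\<close>

lemma sine_plus:
  assumes "tgt M a = L" "src M a = X" "nilsquare e" "src M e = X"
  shows "sine (a \<boxplus> e) = sine a \<boxplus> e \<boxtimes> cosine a"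
    "cosine (a \<boxplus> e) = cosine a \<boxplus> e \<boxtimes> (const X (- 1) \<boxtimes> sine a)"
proof -
  have sm: "summable (\<lambda>k. sin_coeff k * z ^ k)" "summable (\<lambda>k. cos_coeff k * z ^ k)" for z :: real
    using summable_norm_cancel[OF summable_norm_sin[of z]] summable_norm_cancel[OF summable_norm_cos[of z]]
    by simp_all
  have "\<exists>q. (\<forall>n f. elementary n f \<longrightarrow> elementary n (\<lambda>x. q (f x))) \<and>
      (\<forall>y. (\<Sum>k. sin_coeff k * y ^ k) = sin_coeff 0 + sin_coeff 1 * y + y * y * q y)"
    apply (rule elementary_series_remainder[OF sm(1)])
    subgoal for q by (rule exI[of _ q]) blast
    done
  then obtain qs where qs: "\<forall>n f. elementary n f \<longrightarrow> elementary n (\<lambda>x. qs (f x))"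
      "\<forall>y. (\<Sum>k. sin_coeff k * y ^ k) = sin_coeff 0 + sin_coeff 1 * y + y * y * qs y"
    by blast
  have "\<exists>q. (\<forall>n f. elementary n f \<longrightarrow> elementary n (\<lambda>x. q (f x))) \<and>
      (\<forall>y. (\<Sum>k. cos_coeff k * y ^ k) = cos_coeff 0 + cos_coeff 1 * y + y * y * q y)"
    apply (rule elementary_series_remainder[OF sm(2)])
    subgoal for q by (rule exI[of _ q]) blast
    done
  then obtain qc where qc: "\<forall>n f. elementary n f \<longrightarrow> elementary n (\<lambda>x. qc (f x))"
      "\<forall>y. (\<Sum>k. cos_coeff k * y ^ k) = cos_coeff 0 + cos_coeff 1 * y + y * y * qc y"
    by blast
  have s: "sin y = y + y * y * qs y" and c: "cos y = 1 + y * y * qc y" for y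
    using spec[OF qs(2), of y] spec[OF qc(2), of y] by (simp_all add: sin_def cos_def sin_coeff_def cos_coeff_def)
  define Rs :: "(nat \<Rightarrow> real) \<Rightarrow> real" where "Rs = (\<lambda>x. sin (x 0) * qc (x 1) + cos (x 0) * qs (x 1) :: real)"
  define Rc :: "(nat \<Rightarrow> real) \<Rightarrow> real" where "Rc = (\<lambda>x. cos (x 0) * qc (x 1) - sin (x 0) * qs (x 1) :: real)"
  have R: "elementary 2 Rs" "elementary 2 Rc"
    by (simp_all add: Rs_def Rc_def qs qc)
  have eqs: "(\<lambda>x. sin (x 0 + x 1)) = (\<lambda>x. (sin (x 0) + x 1 * cos (x 0)) + (x 1 * x 1) * Rs x)"
    "(\<lambda>x. cos (x 0 + x 1)) = (\<lambda>x. (cos (x 0) + x 1 * (- 1 * sin (x 0))) + (x 1 * x 1) * Rc x)"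
  proof -
    have "sin (u + v) = (sin u + v * cos u) + (v * v) * (sin u * qc v + cos u * qs v)"
      "cos (u + v) = (cos u + v * (- 1 * sin u)) + (v * v) * (cos u * qc v - sin u * qs v)" for u v :: real
      unfolding sin_add cos_add s[of v] c[of v] by (simp_all add: algebra_simps)
    then show "(\<lambda>x. sin (x 0 + x 1)) = (\<lambda>x. (sin (x 0) + x 1 * cos (x 0)) + (x 1 * x 1) * Rs x)"
      "(\<lambda>x. cos (x 0 + x 1)) = (\<lambda>x. (cos (x 0) + x 1 * (- 1 * sin (x 0))) + (x 1 * x 1) * Rc x)"
      by (simp_all add: Rs_def Rc_def fun_eq_iff)
  qed
  have e: "tgt M e = L" using assms by simp
  obtain bs where bs: "set bs \<subseteq> hom M X L" "length bs = 2"
    and a: "a = val X bs (\<lambda>x. x 0)" and ev: "e = val X bs (\<lambda>x. x 1)"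
    by (rule line_atoms[of X "[a, e]"]) (use assms e in \<open>simp_all add: numeral_2_eq_2\<close>)
  note fold = val_fold[OF bs(1), unfolded bs(2)]
  have "sine (a \<boxplus> e) = (sine a \<boxplus> e \<boxtimes> cosine a) \<boxplus> (e \<boxtimes> e) \<boxtimes> val X bs Rs"
  proof -
    have "sine (a \<boxplus> e) = val X bs (\<lambda>x. sin (x 0 + x 1))"
      unfolding a ev by (simp add: fold)
    then show ?thesis
      unfolding eqs a ev by (simp add: fold R)
  qed
  then show "sine (a \<boxplus> e) = sine a \<boxplus> e \<boxtimes> cosine a"
    by (rule nil_drop[where X = X]) (use assms e bs R in simp_all)
  have "cosine (a \<boxplus> e) = (cosine a \<boxplus> e \<boxtimes> (const X (- 1) \<boxtimes> sine a)) \<boxplus> (e \<boxtimes> e) \<boxtimes> val X bs Rc"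
  proof -
    have "cosine (a \<boxplus> e) = val X bs (\<lambda>x. cos (x 0 + x 1))"
      unfolding a ev by (simp add: fold)
    then show ?thesis
      unfolding eqs a ev fold(1)[of "- 1"] by (simp add: fold R)
  qed
  then show "cosine (a \<boxplus> e) = cosine a \<boxplus> e \<boxtimes> (const X (- 1) \<boxtimes> sine a)"
    by (rule nil_drop[where X = X]) (use assms e bs R in simp_all)
qed

lemma const_fold:
  "sine (const X c) = const X (sin c)" "cosine (const X c) = const X (cos c)"
  "const X a \<boxplus> const X b = const X (a + b)" "const X a \<boxtimes> const X b = const X (a * b)"
  using val_fold[of "[]" X] by simp_all

text \<open>
  The projection to the plane of the point with the polar angle \<open>p\<close> and the azimuth \<open>q\<close> on the
  sphere with radius \<open>t\<close>.
\<close>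

definition pt where
  "pt t p q = tup_arr M (src M q) [t \<boxtimes> (cosine q \<boxtimes> sine p), t \<boxtimes> (sine q \<boxtimes> sine p)]"

lemma pt_type [simp]:
  assumes "tgt M t = L" "tgt M p = L" "tgt M q = L" "src M t = src M q" "src M p = src M q"
  shows "src M (pt t p q) = src M q" "tgt M (pt t p q) = prd M L (prd M L (one M))"
  using assms by (simp_all add: pt_def)

lemma pt_comp [simp]:
  assumes "tgt M t = L" "tgt M p = L" "tgt M q = L" "src M t = src M q" "src M p = src M q" "tgt M k = src M q"
  shows "pt t p q \<odot> k = pt (t \<odot> k) (p \<odot> k) (q \<odot> k)"
  using assms by (simp add: pt_def)

lemma shift_pair:
  assumes "tgt M a = L" "tgt M b = L" "tgt M e = L" "src M a = X" "src M b = X" "src M e = X"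
  shows "shift 2 0 (tup_arr M X [a, b]) e = tup_arr M X [a \<boxplus> e, b]"
    "shift 2 1 (tup_arr M X [a, b]) e = tup_arr M X [a, b \<boxplus> e]"
proof -
  have "set [a, b] \<subseteq> hom M X L" using assms by (simp add: in_hom)
  note crd = crd_tup_arr[OF this, of 2 0] crd_tup_arr[OF this, of 2 1]
  have u: "[0..<2] = [0, 1::nat]" by (simp add: upt_rec)
  have "src M (tup_arr M X [a, b]) = X" using assms by simp
  then show "shift 2 0 (tup_arr M X [a, b]) e = tup_arr M X [a \<boxplus> e, b]"
    "shift 2 1 (tup_arr M X [a, b]) e = tup_arr M X [a, b \<boxplus> e]"
    using crd unfolding shift_def u by (simp_all del: tup_arr.simps)
qed

text \<open>
  The two coordinates are moved one after the other; the mixed second derivative comes with the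
  factor \<open>e\<^sup>2\<close>.
\<close>

lemma taylor2:
  assumes f: "src M f = X" "tgt M f = EE 2" and a: "tgt M a = L" "src M a = X" and b: "tgt M b = L" "src M b = X"
    and u: "tgt M u = L" "src M u = X" and v: "tgt M v = L" "src M v = X" and e: "nilsquare e" "src M e = X"
  shows "app L f (tup_arr M X [a \<boxplus> e \<boxtimes> u, b \<boxplus> e \<boxtimes> v]) = app L f (tup_arr M X [a, b])
    \<boxplus> e \<boxtimes> (u \<boxtimes> app L (pd 2 0 f) (tup_arr M X [a, b]) \<boxplus> v \<boxtimes> app L (pd 2 1 f) (tup_arr M X [a, b]))"
proof -
  let ?ab = "tup_arr M X [a, b]"
  have step: "app L g (shift 2 i x d) = app L g x \<boxplus> d \<boxtimes> app L (pd 2 i g) x"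
    if "src M g = X" "tgt M g = EE 2" "tgt M x = Rn 2" "src M x = X" "nilsquare d" "src M d = X" for g x d i
  proof -
    have "app L (g \<odot> ide M X) (shift 2 i x d) = app L (g \<odot> ide M X) x \<boxplus> d \<boxtimes> app L (pd 2 i g \<odot> ide M X) x"
      by (rule derivative_alongD[OF haspd_pd[OF that(2)]]) (use that in simp_all)
    then show ?thesis using that by simp
  qed
  have eu: "nilsquare (e \<boxtimes> u)" "nilsquare (e \<boxtimes> v)" "tgt M e = L"
    using e u v by simp_all
  have ab: "tgt M (tup_arr M X [a, b']) = Rn 2" "src M (tup_arr M X [a, b']) = X"
    if "tgt M b' = L" "src M b' = X" for b' using a that by simp_all
  have eb: "tgt M (b \<boxplus> e \<boxtimes> v) = L" "src M (b \<boxplus> e \<boxtimes> v) = X"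
    using b v e by simp_all
  have ty: "src M (e \<boxtimes> u) = X" "src M (e \<boxtimes> v) = X" using e u v by simp_all
  have 1: "app L f (tup_arr M X [a \<boxplus> e \<boxtimes> u, b \<boxplus> e \<boxtimes> v])
    = app L f (tup_arr M X [a, b \<boxplus> e \<boxtimes> v]) \<boxplus> (e \<boxtimes> u) \<boxtimes> app L (pd 2 0 f) (tup_arr M X [a, b \<boxplus> e \<boxtimes> v])"
    using step[OF f ab[OF eb] eu(1) ty(1), of 0]
      shift_pair(1)[OF a(1) eb(1) nilsquare_type[OF eu(1)] a(2) eb(2) ty(1)] by simp
  have 2: "app L g (tup_arr M X [a, b \<boxplus> e \<boxtimes> v])
    = app L g ?ab \<boxplus> (e \<boxtimes> v) \<boxtimes> app L (pd 2 1 g) ?ab" if "src M g = X" "tgt M g = EE 2" for g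
    using step[OF that ab[OF b] eu(2) ty(2), of 1]
      shift_pair(2)[OF a(1) b(1) nilsquare_type[OF eu(2)] a(2) b(2) ty(2)] by (simp del: tup_arr.simps)
  have f': "src M (pd 2 i f) = X" "tgt M (pd 2 i f) = EE 2" for i using f by simp_all
  have eq: "F \<boxplus> (e \<boxtimes> v) \<boxtimes> F2 \<boxplus> (e \<boxtimes> u) \<boxtimes> (F1 \<boxplus> (e \<boxtimes> v) \<boxtimes> F12)
    = (F \<boxplus> e \<boxtimes> (u \<boxtimes> F1 \<boxplus> v \<boxtimes> F2)) \<boxplus> (e \<boxtimes> e) \<boxtimes> (u \<boxtimes> (v \<boxtimes> F12))"
    if "src M F = X" "tgt M F = L" "src M F1 = X" "tgt M F1 = L" "src M F2 = X" "tgt M F2 = L" "src M F12 = X" "tgt M F12 = L"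
    for F F1 F2 F12
    by (rule line_atoms[of X "[e, u, v, F, F1, F2, F12]"])
      (use e(2) u v eu(3) that in \<open>simp_all add: val_fold algebra_simps\<close>)
  have tyF: "src M (app L g ?ab) = X" "tgt M (app L g ?ab) = L" if "src M g = X" "tgt M g = EE 2" for g
    using that ab[OF b] by (simp_all del: tup_arr.simps)
  have "src M (pd 2 1 (pd 2 0 f)) = X" "tgt M (pd 2 1 (pd 2 0 f)) = EE 2" using f by simp_all
  note ty' = tyF[OF f] tyF[OF f', of 0] tyF[OF f', of 1] tyF[OF this]
  show ?thesis
    unfolding 1 2[OF f] 2[OF f']
    by (rule nil_drop[OF eq[OF ty'] e(1)]) (use ty' u v e eu(3) in \<open>simp_all del: tup_arr.simps\<close>)
qed

section \<open>Weighted means\<close>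

text \<open>
  The value of a weight at the angles; in a weight \<open>w x\<close>, the variable \<open>x 0\<close> is the polar angle
  and \<open>x 1\<close> is the azimuth.
\<close>

definition wt where "wt w p q = val (src M q) [p, q] w"

lemma wt_type [simp]:
  assumes "elementary 2 w" "tgt M p = L" "tgt M q = L" "src M p = src M q"
  shows "src M (wt w p q) = src M q" "tgt M (wt w p q) = L"
  using assms val_type[of "[p, q]" "src M q" w] by (simp_all add: wt_def in_hom numeral_2_eq_2)

lemma wt_comp [simp]:
  assumes "elementary 2 w" "tgt M p = L" "tgt M q = L" "src M p = src M q" "tgt M k = src M q"
  shows "wt w p q \<odot> k = wt w (p \<odot> k) (q \<odot> k)"
proof -
  have "set [p, q] \<subseteq> hom M (src M q) L" using assms by (simp add: in_hom)
  from tup_arr_comp[OF this assms(5)] show ?thesis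
    using assms by (simp add: wt_def val_def numeral_2_eq_2)
qed

lemma wt_simps:
  assumes "tgt M p = L" "tgt M q = L" "src M p = src M q"
  shows "wt (\<lambda>x. x 0) p q = p" "wt (\<lambda>x. x (Suc 0)) p q = q" "wt (\<lambda>x. c) p q = const (src M q) c"
    "elementary 2 f \<Longrightarrow> elementary 2 g \<Longrightarrow> wt (\<lambda>x. f x + g x) p q = wt f p q \<boxplus> wt g p q"
    "elementary 2 f \<Longrightarrow> elementary 2 g \<Longrightarrow> wt (\<lambda>x. f x * g x) p q = wt f p q \<boxtimes> wt g p q"
    "elementary 2 f \<Longrightarrow> wt (\<lambda>x. - f x) p q = const (src M q) (- 1) \<boxtimes> wt f p q"
    "elementary 2 f \<Longrightarrow> wt (\<lambda>x. sin (f x)) p q = sine (wt f p q)"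
    "elementary 2 f \<Longrightarrow> wt (\<lambda>x. cos (f x)) p q = cosine (wt f p q)"
proof -
  have h: "set [p, q] \<subseteq> hom M (src M q) L" using assms by (simp add: in_hom)
  note fold = val_fold[OF h, simplified]
  show "wt (\<lambda>x. x 0) p q = p" "wt (\<lambda>x. x (Suc 0)) p q = q"
    using crd_tup_arr[OF h, of 2 0] crd_tup_arr[OF h, of 2 1]
    by (simp_all add: wt_def val_def crd_def numeral_2_eq_2)
  show "wt (\<lambda>x. c) p q = const (src M q) c"
    by (simp add: wt_def fold)
  assume f: "elementary 2 f"
  have "wt (\<lambda>x. - f x) p q = wt (\<lambda>x. - 1 * f x) p q" by simp
  then show "wt (\<lambda>x. - f x) p q = const (src M q) (- 1) \<boxtimes> wt f p q"
    using f fold(1)[of "- 1"] fold(3)[of "\<lambda>x. - 1" f] by (simp add: wt_def numeral_2_eq_2)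
  show "wt (\<lambda>x. sin (f x)) p q = sine (wt f p q)" "wt (\<lambda>x. cos (f x)) p q = cosine (wt f p q)"
    using f fold by (simp_all add: wt_def numeral_2_eq_2)
  assume g: "elementary 2 g"
  show "wt (\<lambda>x. f x + g x) p q = wt f p q \<boxplus> wt g p q" "wt (\<lambda>x. f x * g x) p q = wt f p q \<boxtimes> wt g p q"
    using f g fold by (simp_all add: wt_def numeral_2_eq_2)
qed

abbreviation integrand where
  "integrand t w g h p q \<equiv> wt w p q \<boxtimes> app L (g \<odot> h) (pt (t \<odot> h) p q)"

text \<open>
  With the weight \<open>sin (x 0)\<close> this is the integral for \<open>S\<^sup>t\<close> of the function \<open>g\<close>, extended
  constantly along the third coordinate. The other weights occur in derivatives of this
  integral.
\<close>

definition mean where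
  "mean X t w g = dbl X (integrand t w g)"

lemma natural2_mean:
  assumes "elementary 2 w" "src M t = X" "tgt M t = L" "src M g = X" "tgt M g = EE 2"
  shows "natural2 X (integrand t w g)"
  by (rule natural2I) (use assms in simp_all)

lemma mean_type [simp]:
  assumes "elementary 2 w" "src M t = X" "tgt M t = L" "src M g = X" "tgt M g = EE 2"
  shows "src M (mean X t w g) = X" "tgt M (mean X t w g) = L"
  unfolding mean_def using natural2_mean[OF assms] by simp_all

lemma mean_comp [simp]:
  assumes "elementary 2 w" "src M t = X" "tgt M t = L" "src M g = X" "tgt M g = EE 2" "tgt M k = X"
  shows "mean X t w g \<odot> k = mean (src M k) (t \<odot> k) w (g \<odot> k)"
  unfolding mean_def dbl_comp[OF natural2_mean[OF assms(1-5)] assms(6)]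
  by (rule dbl_cong) (use assms in simp)

lemma distrib:
  assumes "tgt M a = L" "tgt M b = L" "tgt M c = L" "src M a = X" "src M b = X" "src M c = X"
  shows "(a \<boxplus> b) \<boxtimes> c = a \<boxtimes> c \<boxplus> b \<boxtimes> c" "c \<boxtimes> (a \<boxplus> b) = c \<boxtimes> a \<boxplus> c \<boxtimes> b"
    "(a \<boxtimes> b) \<boxtimes> c = a \<boxtimes> (b \<boxtimes> c)"
  by (rule line_atoms[of X "[a, b, c]"]; use assms in \<open>simp add: val_fold algebra_simps\<close>)+

lemma mean_add_weight:
  assumes w: "elementary 2 w" "elementary 2 w'" and t: "src M t = X" "tgt M t = L" "src M g = X" "tgt M g = EE 2"
  shows "mean X t (\<lambda>x. w x + w' x) g = mean X t w g \<boxplus> mean X t w' g"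
  unfolding mean_def dbl_add[OF natural2_mean[OF w(1) t] natural2_mean[OF w(2) t], symmetric]
  by (rule dbl_cong) (use w t in \<open>simp add: wt_simps distrib(1)\<close>)

lemma mean_scale_weight:
  assumes w: "elementary 2 w" and t: "src M t = X" "tgt M t = L" "src M g = X" "tgt M g = EE 2"
  shows "mean X t (\<lambda>x. c * w x) g = const X c \<boxtimes> mean X t w g"
proof -
  have c: "src M (const X c) = X" "tgt M (const X c) = L" by simp_all
  show ?thesis
    unfolding mean_def dbl_scale[OF natural2_mean[OF w(1) t] c, symmetric]
    by (rule dbl_cong) (use w t in \<open>simp add: wt_simps distrib(3)\<close>)
qed

lemma mean_lap:
  assumes w: "elementary 2 w" and t: "src M t = X" "tgt M t = L" and g: "src M g = X" "tgt M g = EE 2"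
  shows "mean X t w (lap 2 g) = mean X t w (pd 2 0 (pd 2 0 g)) \<boxplus> mean X t w (pd 2 1 (pd 2 1 g))"
proof -
  have g': "src M (pd 2 i (pd 2 i g)) = X" "tgt M (pd 2 i (pd 2 i g)) = EE 2" for i
    using g by simp_all
  have u: "[0..<2] = [0, 1::nat]" by (simp add: upt_rec)
  show ?thesis
    unfolding mean_def dbl_add[OF natural2_mean[OF w(1) t g'] natural2_mean[OF w(1) t g'], symmetric]
    by (rule dbl_cong) (use w t g in \<open>simp add: app_lap_ide lap_sum_def u distrib(2)\<close>)
qed

text \<open>
  The form of the derivatives of the integrand with respect to the radius and the angles, by the
  chain rule in the plane.
\<close>

lemma integrand_flux:
  assumes N: "natural2 X N" and w: "elementary 2 w1" "elementary 2 w2" and t: "src M t = X" "tgt M t = L"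
    and g1: "src M g1 = X" "tgt M g1 = EE 2" and g2: "src M g2 = X" "tgt M g2 = EE 2" and c: "src M c = X" "tgt M c = L"
  shows natural2_flux:
      "natural2 X (\<lambda>h p q. N h p q \<boxplus> (c \<odot> h) \<boxtimes> (integrand t w1 g1 h p q \<boxplus> integrand t w2 g2 h p q))"
    and dbl_flux: "dbl X (\<lambda>h p q. N h p q \<boxplus> (c \<odot> h) \<boxtimes> (integrand t w1 g1 h p q \<boxplus> integrand t w2 g2 h p q))
      = dbl X N \<boxplus> c \<boxtimes> (mean X t w1 g1 \<boxplus> mean X t w2 g2)"
proof -
  note N12 = natural2_mean[OF w(1) t g1] natural2_mean[OF w(2) t g2]
  have s: "natural2 X (\<lambda>h p q. integrand t w1 g1 h p q \<boxplus> integrand t w2 g2 h p q)"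
    by (rule natural2I) (use w t g1 g2 in simp_all)
  have sc: "natural2 X (\<lambda>h p q. (c \<odot> h) \<boxtimes> (integrand t w1 g1 h p q \<boxplus> integrand t w2 g2 h p q))"
    by (rule natural2I) (use w t g1 g2 c in simp_all)
  show "natural2 X (\<lambda>h p q. N h p q \<boxplus> (c \<odot> h) \<boxtimes> (integrand t w1 g1 h p q \<boxplus> integrand t w2 g2 h p q))"
    by (rule natural2I) (use w t g1 g2 c in \<open>simp_all add: natural2_type[OF N] natural2_comp[OF N]\<close>)
  show "dbl X (\<lambda>h p q. N h p q \<boxplus> (c \<odot> h) \<boxtimes> (integrand t w1 g1 h p q \<boxplus> integrand t w2 g2 h p q))
      = dbl X N \<boxplus> c \<boxtimes> (mean X t w1 g1 \<boxplus> mean X t w2 g2)"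
    unfolding mean_def dbl_add[OF N sc] dbl_scale[OF s c] dbl_add[OF N12] ..
qed

text \<open>
  The derivative of the point in \<open>t\<close> is the projected unit vector \<open>(cos q sin p, sin q sin p)\<close>.
\<close>

lemma mean_plus:
  assumes w: "elementary 2 w" and t: "src M t = X" "tgt M t = L" and g: "src M g = X" "tgt M g = EE 2"
    and e: "nilsquare e" "src M e = X"
  shows "mean X (t \<boxplus> e) w g = mean X t w g \<boxplus> e \<boxtimes> (mean X t (\<lambda>x. w x * (cos (x 1) * sin (x 0))) (pd 2 0 g)
    \<boxplus> mean X t (\<lambda>x. w x * (sin (x 1) * sin (x 0))) (pd 2 1 g))"
proof -
  let ?w1 = "\<lambda>x. w x * (cos (x 1) * sin (x 0))" and ?w2 = "\<lambda>x. w x * (sin (x 1) * sin (x 0))"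
  have w12: "elementary 2 ?w1" "elementary 2 ?w2" using w by simp_all
  have g': "src M (pd 2 i g) = X" "tgt M (pd 2 i g) = EE 2" for i using g by simp_all
  have e': "tgt M e = L" using e by simp
  have eq: "w \<boxtimes> (F \<boxplus> e \<boxtimes> (a \<boxtimes> F1 \<boxplus> b \<boxtimes> F2)) = w \<boxtimes> F \<boxplus> e \<boxtimes> ((w \<boxtimes> a) \<boxtimes> F1 \<boxplus> (w \<boxtimes> b) \<boxtimes> F2)"
    if "elements Y [w, F, e, a, b, F1, F2]" for w F e a b F1 F2 Y
    by (rule line_atoms[OF that]) (simp_all add: val_fold algebra_simps)
  have "mean X (t \<boxplus> e) w g = dbl X (\<lambda>h p q. integrand t w g h p q
      \<boxplus> (e \<odot> h) \<boxtimes> (integrand t ?w1 (pd 2 0 g) h p q \<boxplus> integrand t ?w2 (pd 2 1 g) h p q))"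
    unfolding mean_def
  proof (rule dbl_cong)
    fix h p q assume h: "tgt M h = X" "tgt M p = L" "tgt M q = L" "src M h = src M q" "src M p = src M q"
    let ?Y = "src M q"
    let ?a = "cosine q \<boxtimes> sine p" and ?b = "sine q \<boxtimes> sine p"
    have ty: "src M (t \<odot> h) = ?Y" "tgt M (t \<odot> h) = L" "src M (e \<odot> h) = ?Y" "tgt M (e \<odot> h) = L" "nilsquare (e \<odot> h)"
      "src M ?a = ?Y" "tgt M ?a = L" "src M ?b = ?Y" "tgt M ?b = L" "src M (g \<odot> h) = ?Y" "tgt M (g \<odot> h) = EE 2"
      "src M ((t \<odot> h) \<boxtimes> ?a) = ?Y" "tgt M ((t \<odot> h) \<boxtimes> ?a) = L" "src M ((t \<odot> h) \<boxtimes> ?b) = ?Y" "tgt M ((t \<odot> h) \<boxtimes> ?b) = L"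
      using h t e e' g by simp_all
    have "pt ((t \<boxplus> e) \<odot> h) p q = tup_arr M ?Y [(t \<odot> h) \<boxtimes> ?a \<boxplus> (e \<odot> h) \<boxtimes> ?a, (t \<odot> h) \<boxtimes> ?b \<boxplus> (e \<odot> h) \<boxtimes> ?b]"
      using h t e e' ty by (simp add: pt_def distrib(1)[of _ _ _ ?Y])
    then have "app L (g \<odot> h) (pt ((t \<boxplus> e) \<odot> h) p q) = app L (g \<odot> h) (pt (t \<odot> h) p q) \<boxplus> (e \<odot> h) \<boxtimes>
      (?a \<boxtimes> app L (pd 2 0 (g \<odot> h)) (pt (t \<odot> h) p q) \<boxplus> ?b \<boxtimes> app L (pd 2 1 (g \<odot> h)) (pt (t \<odot> h) p q))"
      using taylor2[OF ty(10,11,13,12,15,14,7,6,9,8,5,3)] by (simp only: pt_def)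
    then show "integrand (t \<boxplus> e) w g h p q
      = integrand t w g h p q \<boxplus> (e \<odot> h) \<boxtimes> (integrand t ?w1 (pd 2 0 g) h p q \<boxplus> integrand t ?w2 (pd 2 1 g) h p q)"
      using h t e e' g w ty by (simp add: wt_simps) (rule eq[of ?Y], simp)
  qed
  then show ?thesis
    unfolding dbl_flux[OF natural2_mean[OF w t g] w12 t g' g' e(2) e'] by (simp only: mean_def)
qed


section \<open>The divergence theorem on the sphere\<close>

text \<open>The product rule.\<close>

lemma weighted_product:
  assumes "src M w = X" "src M w' = X" "src M F = X" "src M G = X" "src M e = X"
    "tgt M w = L" "tgt M w' = L" "tgt M F = L" "tgt M G = L" "nilsquare e"
  shows "(w \<boxplus> e \<boxtimes> w') \<boxtimes> (F \<boxplus> e \<boxtimes> G) = w \<boxtimes> F \<boxplus> e \<boxtimes> (w' \<boxtimes> F \<boxplus> w \<boxtimes> G)"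
proof -
  have e: "tgt M e = L" using assms by simp
  have "(w \<boxplus> e \<boxtimes> w') \<boxtimes> (F \<boxplus> e \<boxtimes> G) = (w \<boxtimes> F \<boxplus> e \<boxtimes> (w' \<boxtimes> F \<boxplus> w \<boxtimes> G)) \<boxplus> (e \<boxtimes> e) \<boxtimes> (w' \<boxtimes> G)"
    by (rule line_atoms[of X "[w, w', F, G, e]"]) (use assms(1-9) e in \<open>simp_all add: val_fold algebra_simps\<close>)
  then show ?thesis
    by (rule nil_drop[where X = X]) (use assms e in simp_all)
qed

text \<open>
  The change of the integrand when a change of the angles moves the point by \<open>e t (a, b)\<close>; it is
  used for each of the two angles.
\<close>

lemma integrand_shift:
  assumes t: "src M t = Y" "tgt M t = L" and g: "src M g = Y" "tgt M g = EE 2" and e: "nilsquare e" "src M e = Y"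
    and p: "tgt M p = L" "src M p = Y" and q: "tgt M q = L" "src M q = Y"
    and a: "src M a = Y" "tgt M a = L" and b: "src M b = Y" "tgt M b = L" and el: "elementary 2 w" "elementary 2 w'"
    and pt: "pt t p' q' = tup_arr M Y
      [t \<boxtimes> (cosine q \<boxtimes> sine p) \<boxplus> e \<boxtimes> (t \<boxtimes> a), t \<boxtimes> (sine q \<boxtimes> sine p) \<boxplus> e \<boxtimes> (t \<boxtimes> b)]"
    and w: "wt w p' q' = wt w p q \<boxplus> e \<boxtimes> wt w' p q"
    and w1: "wt w1 p q = wt w p q \<boxtimes> a" and w2: "wt w2 p q = wt w p q \<boxtimes> b"
  shows "wt w p' q' \<boxtimes> app L g (pt t p' q') = wt w p q \<boxtimes> app L g (pt t p q) \<boxplus> e \<boxtimes>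
    (wt w' p q \<boxtimes> app L g (pt t p q) \<boxplus> t \<boxtimes> (wt w1 p q \<boxtimes> app L (pd 2 0 g) (pt t p q) \<boxplus> wt w2 p q \<boxtimes> app L (pd 2 1 g) (pt t p q)))"
proof -
  let ?x = "t \<boxtimes> (cosine q \<boxtimes> sine p)" and ?y = "t \<boxtimes> (sine q \<boxtimes> sine p)"
  have ty: "tgt M ?x = L" "src M ?x = Y" "tgt M ?y = L" "src M ?y = Y"
    "tgt M (t \<boxtimes> a) = L" "src M (t \<boxtimes> a) = Y" "tgt M (t \<boxtimes> b) = L" "src M (t \<boxtimes> b) = Y" "tgt M e = L"
    using t p q a b e by simp_all
  have F: "app L g (pt t p' q') = app L g (pt t p q) \<boxplus> e \<boxtimes>
    ((t \<boxtimes> a) \<boxtimes> app L (pd 2 0 g) (pt t p q) \<boxplus> (t \<boxtimes> b) \<boxtimes> app L (pd 2 1 g) (pt t p q))"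
    using taylor2[OF g ty(1-8) e] unfolding pt unfolding pt_def q(2) .
  have eq: "w \<boxtimes> ((t \<boxtimes> a) \<boxtimes> F \<boxplus> (t \<boxtimes> b) \<boxtimes> G) = t \<boxtimes> ((w \<boxtimes> a) \<boxtimes> F \<boxplus> (w \<boxtimes> b) \<boxtimes> G)"
    if "elements Y [w, t, a, b, F, G]" for w t a b F G
    by (rule line_atoms[OF that]) (simp_all add: val_fold algebra_simps)
  have "wt w p q \<boxtimes> ((t \<boxtimes> a) \<boxtimes> app L (pd 2 0 g) (pt t p q) \<boxplus> (t \<boxtimes> b) \<boxtimes> app L (pd 2 1 g) (pt t p q))
    = t \<boxtimes> ((wt w p q \<boxtimes> a) \<boxtimes> app L (pd 2 0 g) (pt t p q) \<boxplus> (wt w p q \<boxtimes> b) \<boxtimes> app L (pd 2 1 g) (pt t p q))"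
    by (rule eq) (use el t g p q a b in simp)
  moreover have "(wt w p q \<boxplus> e \<boxtimes> wt w' p q) \<boxtimes> (app L g (pt t p q) \<boxplus> e \<boxtimes>
      ((t \<boxtimes> a) \<boxtimes> app L (pd 2 0 g) (pt t p q) \<boxplus> (t \<boxtimes> b) \<boxtimes> app L (pd 2 1 g) (pt t p q)))
    = wt w p q \<boxtimes> app L g (pt t p q) \<boxplus> e \<boxtimes> (wt w' p q \<boxtimes> app L g (pt t p q) \<boxplus> wt w p q \<boxtimes>
      ((t \<boxtimes> a) \<boxtimes> app L (pd 2 0 g) (pt t p q) \<boxplus> (t \<boxtimes> b) \<boxtimes> app L (pd 2 1 g) (pt t p q)))"
    by (rule weighted_product[of _ Y]) (use el t g e p q a b ty(9) in simp_all)
  ultimately show ?thesis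
    unfolding F w w1 w2 by simp
qed

text \<open>
  The integrand \<open>w g\<close> is periodic in the azimuth \<open>q\<close>, so its derivative has integral \<open>0\<close>. The
  derivative of the point is \<open>t (- sin q sin p, cos q sin p)\<close>.
\<close>

lemma mean_theta_derivative:
  assumes w: "elementary 2 w" "elementary 2 w'" and t: "src M t = X" "tgt M t = L" and g: "src M g = X" "tgt M g = EE 2"
    and der: "\<And>p q e. tgt M p = L \<Longrightarrow> tgt M q = L \<Longrightarrow> src M p = src M q \<Longrightarrow> src M e = src M q \<Longrightarrow> nilsquare e \<Longrightarrow>
      wt w p (q \<boxplus> e) = wt w p q \<boxplus> e \<boxtimes> wt w' p q"
    and periodic: "\<And>p. tgt M p = L \<Longrightarrow> wt w p (const (src M p) (2 * pi)) = wt w p (const (src M p) 0)"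
  shows "mean X t w' g \<boxplus> t \<boxtimes> (mean X t (\<lambda>x. w x * (- sin (x 1) * sin (x 0))) (pd 2 0 g)
    \<boxplus> mean X t (\<lambda>x. w x * (cos (x 1) * sin (x 0))) (pd 2 1 g)) = const X 0"
proof -
  let ?w1 = "\<lambda>x. w x * (- sin (x 1) * sin (x 0))" and ?w2 = "\<lambda>x. w x * (cos (x 1) * sin (x 0))"
  have w12: "elementary 2 ?w1" "elementary 2 ?w2" using w by simp_all
  have g': "src M (pd 2 i g) = X" "tgt M (pd 2 i g) = EE 2" for i using g by simp_all
  note N' = natural2_flux[OF natural2_mean[OF w(2) t g] w12 t g' g' t, of 0 1]
  have "dbl X (\<lambda>h p q. integrand t w' g h p q
      \<boxplus> (t \<odot> h) \<boxtimes> (integrand t ?w1 (pd 2 0 g) h p q \<boxplus> integrand t ?w2 (pd 2 1 g) h p q)) = const X 0"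
  proof (rule dbl_theta_derivative[OF natural2_mean[OF w(1) t g] N'])
    fix h p q e assume h: "tgt M h = X" "tgt M p = L" "tgt M q = L" "src M h = src M q" "src M p = src M q"
      and e: "src M e = src M q" "nilsquare e"
    let ?Y = "src M q" and ?t = "t \<odot> h"
    let ?a = "(const (src M q) (- 1) \<boxtimes> sine q) \<boxtimes> sine p" and ?b = "cosine q \<boxtimes> sine p"
    have et: "tgt M e = L" using e by simp
    have lin: "t \<boxtimes> ((c \<boxplus> e \<boxtimes> s) \<boxtimes> k) = t \<boxtimes> (c \<boxtimes> k) \<boxplus> e \<boxtimes> (t \<boxtimes> (s \<boxtimes> k))" if "elements Y [t, c, e, s, k]" for t c e s k Y
      by (rule line_atoms[OF that]) (simp_all add: val_fold algebra_simps)
    have neg: "const Y (- 1) \<boxtimes> (a \<boxtimes> (b \<boxtimes> c)) = a \<boxtimes> ((const Y (- 1) \<boxtimes> b) \<boxtimes> c)" if "elements Y [a, b, c]" for a b c Y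
      by (rule line_atoms[OF that]) (simp_all add: val_fold algebra_simps)
    have pdg: "pd 2 i g \<odot> h = pd 2 i (g \<odot> h)" for i using g h by simp
    show "integrand t w g h p (q \<boxplus> e) = integrand t w g h p q \<boxplus> e \<boxtimes> (integrand t w' g h p q
        \<boxplus> (t \<odot> h) \<boxtimes> (integrand t ?w1 (pd 2 0 g) h p q \<boxplus> integrand t ?w2 (pd 2 1 g) h p q))"
      unfolding pdg
    proof (rule integrand_shift[of _ ?Y])
      show "pt ?t p (q \<boxplus> e) = tup_arr M ?Y
          [?t \<boxtimes> (cosine q \<boxtimes> sine p) \<boxplus> e \<boxtimes> (?t \<boxtimes> ?a), ?t \<boxtimes> (sine q \<boxtimes> sine p) \<boxplus> e \<boxtimes> (?t \<boxtimes> ?b)]"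
        using h e et t by (simp add: pt_def sine_plus[OF h(3) refl e(2,1)] lin[of ?Y])
      show "wt w p (q \<boxplus> e) = wt w p q \<boxplus> e \<boxtimes> wt w' p q"
        by (rule der) (use h e in simp_all)
      show "wt ?w1 p q = wt w p q \<boxtimes> ?a" "wt ?w2 p q = wt w p q \<boxtimes> ?b"
        using w h by (simp_all add: wt_simps neg)
    qed (use h e t g w in simp_all)
  next
    fix h p assume h: "tgt M h = X" "tgt M p = L" "src M h = src M p"
    have "pt (t \<odot> h) p (const (src M p) (2 * pi)) = pt (t \<odot> h) p (const (src M p) 0)"
      by (simp add: pt_def const_fold)
    then show "integrand t w g h p (const (src M p) (2 * pi)) = integrand t w g h p (const (src M p) 0)"
      using periodic[OF h(2)] by simp
  qed
  then show ?thesis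
    unfolding dbl_flux[OF natural2_mean[OF w(2) t g] w12 t g' g' t] by (simp only: mean_def)
qed

text \<open>
  The weight vanishes at the poles, so the derivative of \<open>w g\<close> in the polar angle \<open>p\<close> has
  integral \<open>0\<close>. The derivative of the point is \<open>t (cos q cos p, sin q cos p)\<close>.
\<close>

lemma mean_phi_derivative:
  assumes w: "elementary 2 w" "elementary 2 w'" and t: "src M t = X" "tgt M t = L" and g: "src M g = X" "tgt M g = EE 2"
    and der: "\<And>p q e. tgt M p = L \<Longrightarrow> tgt M q = L \<Longrightarrow> src M p = src M q \<Longrightarrow> src M e = src M q \<Longrightarrow> nilsquare e \<Longrightarrow>
      wt w (p \<boxplus> e) q = wt w p q \<boxplus> e \<boxtimes> wt w' p q"
    and boundary: "\<And>q. tgt M q = L \<Longrightarrow> wt w (const (src M q) 0) q = const (src M q) 0"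
      "\<And>q. tgt M q = L \<Longrightarrow> wt w (const (src M q) pi) q = const (src M q) 0"
  shows "mean X t w' g \<boxplus> t \<boxtimes> (mean X t (\<lambda>x. w x * (cos (x 1) * cos (x 0))) (pd 2 0 g)
    \<boxplus> mean X t (\<lambda>x. w x * (sin (x 1) * cos (x 0))) (pd 2 1 g)) = const X 0"
proof -
  let ?w1 = "\<lambda>x. w x * (cos (x 1) * cos (x 0))" and ?w2 = "\<lambda>x. w x * (sin (x 1) * cos (x 0))"
  have w12: "elementary 2 ?w1" "elementary 2 ?w2" using w by simp_all
  have g': "src M (pd 2 i g) = X" "tgt M (pd 2 i g) = EE 2" for i using g by simp_all
  note N' = natural2_flux[OF natural2_mean[OF w(2) t g] w12 t g' g' t, of 0 1]
  have "dbl X (\<lambda>h p q. integrand t w' g h p q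
      \<boxplus> (t \<odot> h) \<boxtimes> (integrand t ?w1 (pd 2 0 g) h p q \<boxplus> integrand t ?w2 (pd 2 1 g) h p q)) = const X 0"
  proof (rule dbl_phi_derivative[OF natural2_mean[OF w(1) t g] N'])
    fix h p q e assume h: "tgt M h = X" "tgt M p = L" "tgt M q = L" "src M h = src M q" "src M p = src M q"
      and e: "src M e = src M q" "nilsquare e"
    let ?Y = "src M q" and ?t = "t \<odot> h"
    let ?a = "cosine q \<boxtimes> cosine p" and ?b = "sine q \<boxtimes> cosine p"
    have et: "tgt M e = L" using e by simp
    have lin: "t \<boxtimes> (k \<boxtimes> (c \<boxplus> e \<boxtimes> s)) = t \<boxtimes> (k \<boxtimes> c) \<boxplus> e \<boxtimes> (t \<boxtimes> (k \<boxtimes> s))" if "elements Y [t, c, e, s, k]" for t c e s k Y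
      by (rule line_atoms[OF that]) (simp_all add: val_fold algebra_simps)
    have pdg: "pd 2 i g \<odot> h = pd 2 i (g \<odot> h)" for i using g h by simp
    show "integrand t w g h (p \<boxplus> e) q = integrand t w g h p q \<boxplus> e \<boxtimes> (integrand t w' g h p q
        \<boxplus> (t \<odot> h) \<boxtimes> (integrand t ?w1 (pd 2 0 g) h p q \<boxplus> integrand t ?w2 (pd 2 1 g) h p q))"
      unfolding pdg
    proof (rule integrand_shift[of _ ?Y])
      show "pt ?t (p \<boxplus> e) q = tup_arr M ?Y
          [?t \<boxtimes> (cosine q \<boxtimes> sine p) \<boxplus> e \<boxtimes> (?t \<boxtimes> ?a), ?t \<boxtimes> (sine q \<boxtimes> sine p) \<boxplus> e \<boxtimes> (?t \<boxtimes> ?b)]"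
        using h e et t by (simp add: pt_def sine_plus[OF h(2,5) e(2,1)] lin[of ?Y])
      show "wt w (p \<boxplus> e) q = wt w p q \<boxplus> e \<boxtimes> wt w' p q"
        by (rule der) (use h e in simp_all)
      show "wt ?w1 p q = wt w p q \<boxtimes> ?a" "wt ?w2 p q = wt w p q \<boxtimes> ?b"
        using w h by (simp_all add: wt_simps)
    qed (use h e t g w in simp_all)
  next
    fix h q assume h: "tgt M h = X" "tgt M q = L" "src M h = src M q"
    show "integrand t w g h (const (src M q) 0) q = const (src M q) 0"
      "integrand t w g h (const (src M q) pi) q = const (src M q) 0"
      using h t g boundary[OF h(2)] by simp_all
  qed
  then show ?thesis
    unfolding dbl_flux[OF natural2_mean[OF w(2) t g] w12 t g' g' t] by (simp only: mean_def)
qed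

abbreviation (input) wS :: "(nat \<Rightarrow> real) \<Rightarrow> real" where "wS \<equiv> \<lambda>x. sin (x 0)"

text \<open>
  The first and the second derivative in \<open>t\<close> of the integral of \<open>f\<close> with the weight \<open>wS\<close>.
\<close>

definition rad where
  "rad X t f = mean X t (\<lambda>x. sin (x 0) * (cos (x 1) * sin (x 0))) (pd 2 0 f)
    \<boxplus> mean X t (\<lambda>x. sin (x 0) * (sin (x 1) * sin (x 0))) (pd 2 1 f)"

definition rad2 where
  "rad2 X t f = (mean X t (\<lambda>x. sin (x 0) * (cos (x 1) * sin (x 0)) * (cos (x 1) * sin (x 0))) (pd 2 0 (pd 2 0 f))
    \<boxplus> mean X t (\<lambda>x. sin (x 0) * (cos (x 1) * sin (x 0)) * (sin (x 1) * sin (x 0))) (pd 2 1 (pd 2 0 f)))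
    \<boxplus> (mean X t (\<lambda>x. sin (x 0) * (sin (x 1) * sin (x 0)) * (cos (x 1) * sin (x 0))) (pd 2 0 (pd 2 1 f))
    \<boxplus> mean X t (\<lambda>x. sin (x 0) * (sin (x 1) * sin (x 0)) * (sin (x 1) * sin (x 0))) (pd 2 1 (pd 2 1 f)))"

lemma rad_type [simp]:
  assumes "src M t = X" "tgt M t = L" "src M f = X" "tgt M f = EE 2"
  shows "src M (rad X t f) = X" "tgt M (rad X t f) = L" "src M (rad2 X t f) = X" "tgt M (rad2 X t f) = L"
  using assms by (simp_all add: rad_def rad2_def)

lemma rad_comp [simp]:
  assumes "src M t = X" "tgt M t = L" "src M f = X" "tgt M f = EE 2" "tgt M k = X"
  shows "rad X t f \<odot> k = rad (src M k) (t \<odot> k) (f \<odot> k)"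
  using assms by (simp add: rad_def)

lemma rad_plus:
  assumes t: "src M t = X" "tgt M t = L" and f: "src M f = X" "tgt M f = EE 2" and e: "nilsquare e" "src M e = X"
  shows "rad X (t \<boxplus> e) f = rad X t f \<boxplus> e \<boxtimes> rad2 X t f"
proof -
  have f': "src M (pd 2 i f) = X" "tgt M (pd 2 i f) = EE 2" for i using f by simp_all
  have et: "tgt M e = L" using e by simp
  have eq: "(a \<boxplus> e \<boxtimes> b) \<boxplus> (c \<boxplus> e \<boxtimes> d) = (a \<boxplus> c) \<boxplus> e \<boxtimes> (b \<boxplus> d)"
    if "src M a = X" "src M b = X" "src M c = X" "src M d = X" "tgt M a = L" "tgt M b = L" "tgt M c = L" "tgt M d = L" for a b c d
    by (rule line_atoms[of X "[a, b, c, d, e]"]) (use that e(2) et in \<open>simp_all add: val_fold algebra_simps\<close>)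
  have el: "elementary 2 (\<lambda>x. sin (x 0) * (cos (x 1) * sin (x 0)))" "elementary 2 (\<lambda>x. sin (x 0) * (sin (x 1) * sin (x 0)))"
    by simp_all
  show ?thesis
    unfolding rad_def rad2_def mean_plus[OF el(1) t f' e] mean_plus[OF el(2) t f' e]
    by (rule eq) (use t f in simp_all)
qed

text \<open>
  These are the weights for the tangential gradient. The unit vectors in the directions of the
  two angles project to \<open>u = (cos p cos q, cos p sin q)\<close> and \<open>v = (- sin q, cos q)\<close>; the weights
  are the components of \<open>sin p u\<close> and of \<open>v\<close>.
\<close>

lemma weight_derivatives:
  assumes "tgt M p = L" "tgt M q = L" "src M p = src M q" "src M e = src M q" "nilsquare e"
  shows "wt (\<lambda>x. sin (x 0) * cos (x 0) * cos (x 1)) (p \<boxplus> e) q = wt (\<lambda>x. sin (x 0) * cos (x 0) * cos (x 1)) p q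
      \<boxplus> e \<boxtimes> wt (\<lambda>x. (cos (x 0) * cos (x 0) + - (sin (x 0) * sin (x 0))) * cos (x 1)) p q"
    "wt (\<lambda>x. sin (x 0) * cos (x 0) * sin (x 1)) (p \<boxplus> e) q = wt (\<lambda>x. sin (x 0) * cos (x 0) * sin (x 1)) p q
      \<boxplus> e \<boxtimes> wt (\<lambda>x. (cos (x 0) * cos (x 0) + - (sin (x 0) * sin (x 0))) * sin (x 1)) p q"
    "wt (\<lambda>x. - sin (x 1)) p (q \<boxplus> e) = wt (\<lambda>x. - sin (x 1)) p q \<boxplus> e \<boxtimes> wt (\<lambda>x. - cos (x 1)) p q"
    "wt (\<lambda>x. cos (x 1)) p (q \<boxplus> e) = wt (\<lambda>x. cos (x 1)) p q \<boxplus> e \<boxtimes> wt (\<lambda>x. - sin (x 1)) p q"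
proof -
  let ?Y = "src M q"
  have et: "tgt M e = L" using assms by simp
  have eq: "((s \<boxplus> e \<boxtimes> c) \<boxtimes> (c \<boxplus> e \<boxtimes> (const Y (- 1) \<boxtimes> s))) \<boxtimes> k
    = (s \<boxtimes> c \<boxtimes> k) \<boxplus> e \<boxtimes> ((c \<boxtimes> c \<boxplus> const Y (- 1) \<boxtimes> (s \<boxtimes> s)) \<boxtimes> k)"
    if "src M s = Y" "src M c = Y" "src M k = Y" "tgt M s = L" "tgt M c = L" "tgt M k = L" "src M e = Y" "tgt M e = L" "nilsquare e"
    for s c k e Y
  proof -
    have "((s \<boxplus> e \<boxtimes> c) \<boxtimes> (c \<boxplus> e \<boxtimes> (const Y (- 1) \<boxtimes> s))) \<boxtimes> k
      = ((s \<boxtimes> c \<boxtimes> k) \<boxplus> e \<boxtimes> ((c \<boxtimes> c \<boxplus> const Y (- 1) \<boxtimes> (s \<boxtimes> s)) \<boxtimes> k)) \<boxplus> (e \<boxtimes> e) \<boxtimes> (const Y (- 1) \<boxtimes> (c \<boxtimes> s \<boxtimes> k))"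
      by (rule line_atoms[of Y "[s, c, k, e]"]) (use that(1-8) in \<open>simp_all add: val_fold algebra_simps\<close>)
    then show ?thesis
      by (rule nil_drop[where X = Y]) (use that in simp_all)
  qed
  have neg: "const Y (- 1) \<boxtimes> (s \<boxplus> e \<boxtimes> c) = const Y (- 1) \<boxtimes> s \<boxplus> e \<boxtimes> (const Y (- 1) \<boxtimes> c)"
    if "elements Y [s, c, e]" for s c e Y
    by (rule line_atoms[OF that]) (simp_all add: val_fold algebra_simps)
  note sp = sine_plus[OF assms(1,3,5,4)] sine_plus[OF assms(2) refl assms(5,4)]
  show "wt (\<lambda>x. sin (x 0) * cos (x 0) * cos (x 1)) (p \<boxplus> e) q = wt (\<lambda>x. sin (x 0) * cos (x 0) * cos (x 1)) p q
      \<boxplus> e \<boxtimes> wt (\<lambda>x. (cos (x 0) * cos (x 0) + - (sin (x 0) * sin (x 0))) * cos (x 1)) p q"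
    "wt (\<lambda>x. sin (x 0) * cos (x 0) * sin (x 1)) (p \<boxplus> e) q = wt (\<lambda>x. sin (x 0) * cos (x 0) * sin (x 1)) p q
      \<boxplus> e \<boxtimes> wt (\<lambda>x. (cos (x 0) * cos (x 0) + - (sin (x 0) * sin (x 0))) * sin (x 1)) p q"
    using assms et by (simp_all add: wt_simps sp eq[of _ ?Y] del: add_uminus_conv_diff)
  show "wt (\<lambda>x. - sin (x 1)) p (q \<boxplus> e) = wt (\<lambda>x. - sin (x 1)) p q \<boxplus> e \<boxtimes> wt (\<lambda>x. - cos (x 1)) p q"
    "wt (\<lambda>x. cos (x 1)) p (q \<boxplus> e) = wt (\<lambda>x. cos (x 1)) p q \<boxplus> e \<boxtimes> wt (\<lambda>x. - sin (x 1)) p q"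
    using assms et by (simp_all add: wt_simps sp neg[of ?Y])
qed

text \<open>
  The sum of the integrals of the derivative of \<open>sin p \<langle>\<nabla>f, u\<rangle>\<close> in \<open>p\<close> and the derivative of
  \<open>\<langle>\<nabla>f, v\<rangle>\<close> in \<open>q\<close>, with \<open>u\<close> and \<open>v\<close> as above, is \<open>0\<close>. Its terms with first derivatives of \<open>f\<close>
  are \<open>-2\<close> times the radial derivative. Its terms with second derivatives have the factor \<open>t\<close>;
  together with the second radial derivative they give the Laplace operator, because the radial
  and the two tangential unit vectors are an orthonormal basis.
\<close>

lemma sphere_divergence:
  assumes t: "src M t = X" "tgt M t = L" and f: "src M f = X" "tgt M f = EE 2"
  shows "t \<boxtimes> rad2 X t f \<boxplus> const X 2 \<boxtimes> rad X t f = t \<boxtimes> mean X t wS (lap 2 f)"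
proof -
  have f': "src M (pd 2 i f) = X" "tgt M (pd 2 i f) = EE 2"
    "src M (pd 2 i (pd 2 j f)) = X" "tgt M (pd 2 i (pd 2 j f)) = EE 2" for i j using f by simp_all
  let ?m = "\<lambda>w i j. mean X t w (pd 2 j (pd 2 i f))"
  let ?W1 = "\<lambda>x. sin (x 0) * cos (x 0) * cos (x 1)" and ?W2 = "\<lambda>x. sin (x 0) * cos (x 0) * sin (x 1)"
  let ?W1' = "\<lambda>x. (cos (x 0) * cos (x 0) + - (sin (x 0) * sin (x 0))) * cos (x 1)"
  let ?W2' = "\<lambda>x. (cos (x 0) * cos (x 0) + - (sin (x 0) * sin (x 0))) * sin (x 1)"
  let ?b11 = "\<lambda>x. ?W1 x * (cos (x 1) * cos (x 0))" and ?b12 = "\<lambda>x. ?W1 x * (sin (x 1) * cos (x 0))"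
  let ?b21 = "\<lambda>x. ?W2 x * (cos (x 1) * cos (x 0))" and ?b22 = "\<lambda>x. ?W2 x * (sin (x 1) * cos (x 0))"
  let ?c11 = "\<lambda>x. - sin (x 1) * (- sin (x 1) * sin (x 0))" and ?c12 = "\<lambda>x. - sin (x 1) * (cos (x 1) * sin (x 0))"
  let ?c21 = "\<lambda>x. cos (x 1) * (- sin (x 1) * sin (x 0))" and ?c22 = "\<lambda>x. cos (x 1) * (cos (x 1) * sin (x 0))"
  let ?h11 = "\<lambda>x. sin (x 0) * (cos (x 1) * sin (x 0)) * (cos (x 1) * sin (x 0))"
  let ?h12 = "\<lambda>x. sin (x 0) * (cos (x 1) * sin (x 0)) * (sin (x 1) * sin (x 0))"
  let ?h21 = "\<lambda>x. sin (x 0) * (sin (x 1) * sin (x 0)) * (cos (x 1) * sin (x 0))"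
  let ?h22 = "\<lambda>x. sin (x 0) * (sin (x 1) * sin (x 0)) * (sin (x 1) * sin (x 0))"
  let ?r1 = "\<lambda>x. sin (x 0) * (cos (x 1) * sin (x 0))" and ?r2 = "\<lambda>x. sin (x 0) * (sin (x 1) * sin (x 0))"
  \<comment> \<open>The weights \<open>?bij\<close>, \<open>?cij\<close> and \<open>?hij\<close> belong to the second derivatives in the directions of
    \<open>u\<close>, of \<open>v\<close> and of the radius. \<open>P1\<close> and \<open>P2\<close> integrate derivatives in \<open>p\<close>, \<open>T1\<close> and \<open>T2\<close> in
    \<open>q\<close>.\<close>
  have P1: "mean X t ?W1' (pd 2 0 f) \<boxplus> t \<boxtimes> (?m ?b11 0 0 \<boxplus> ?m ?b12 0 1) = const X 0"
    by (rule mean_phi_derivative[OF _ _ t f'(1,2) weight_derivatives(1)])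
      (assumption | simp add: wt_simps const_fold)+
  have P2: "mean X t ?W2' (pd 2 1 f) \<boxplus> t \<boxtimes> (?m ?b21 1 0 \<boxplus> ?m ?b22 1 1) = const X 0"
    by (rule mean_phi_derivative[OF _ _ t f'(1,2) weight_derivatives(2)])
      (assumption | simp add: wt_simps const_fold)+
  have T1: "mean X t (\<lambda>x. - cos (x 1)) (pd 2 0 f) \<boxplus> t \<boxtimes> (?m ?c11 0 0 \<boxplus> ?m ?c12 0 1) = const X 0"
    by (rule mean_theta_derivative[OF _ _ t f'(1,2) weight_derivatives(3)])
      (assumption | simp add: wt_simps const_fold)+
  have T2: "mean X t (\<lambda>x. - sin (x 1)) (pd 2 1 f) \<boxplus> t \<boxtimes> (?m ?c21 1 0 \<boxplus> ?m ?c22 1 1) = const X 0"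
    by (rule mean_theta_derivative[OF _ _ t f'(1,2) weight_derivatives(4)])
      (assumption | simp add: wt_simps const_fold)+
  have sum3: "mean X t a g \<boxplus> mean X t b g \<boxplus> mean X t c g = mean X t w g"
    if "elementary 2 a" "elementary 2 b" "elementary 2 c" "src M g = X" "tgt M g = EE 2" "\<And>x. a x + b x + c x = w x" for a b c w g
  proof -
    have "w = (\<lambda>x. (a x + b x) + c x)" using that(6) by auto
    then show ?thesis
      using that(1-5) t by (simp add: mean_add_weight)
  qed
  have zero: "mean X t (\<lambda>x. 0) g = const X 0" if "src M g = X" "tgt M g = EE 2" for g
    using mean_scale_weight[of "\<lambda>x. 0" t X g 0] t that by simp
  have sq: "cos u * cos u = 1 - sin u * sin u" for u :: real
    using sin_cos_squared_add[of u] by (simp add: power2_eq_square algebra_simps)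
  \<comment> \<open>The orthonormality relations: the sum of the weights of a second derivative is \<open>sin p\<close> on
    the diagonal and \<open>0\<close> off it.\<close>
  have s11: "?m ?b11 0 0 \<boxplus> ?m ?c11 0 0 \<boxplus> ?m ?h11 0 0 = ?m wS 0 0"
  proof (rule sum3)
    have "s * c * C * (C * c) + - S * (- S * s) + s * (C * s) * (C * s) = s"
      if "c * c = 1 - s * s" "C * C = 1 - S * S" for s c S C :: real
      using that by algebra
    note eq = this[OF sq sq]
    show "?b11 x + ?c11 x + ?h11 x = wS x" for x :: "nat \<Rightarrow> real"
      by (rule eq)
  qed (use f' in simp_all)
  have s22: "?m ?b22 1 1 \<boxplus> ?m ?c22 1 1 \<boxplus> ?m ?h22 1 1 = ?m wS 1 1"
  proof (rule sum3)
    have "s * c * S * (S * c) + C * (C * s) + s * (S * s) * (S * s) = s"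
      if "c * c = 1 - s * s" "C * C = 1 - S * S" for s c S C :: real
      using that by algebra
    note eq = this[OF sq sq]
    show "?b22 x + ?c22 x + ?h22 x = wS x" for x :: "nat \<Rightarrow> real"
      by (rule eq)
  qed (use f' in simp_all)
  have s12: "?m ?b12 0 1 \<boxplus> ?m ?c12 0 1 \<boxplus> ?m ?h12 0 1 = ?m (\<lambda>x. 0) 0 1"
  proof (rule sum3)
    have "s * c * C * (S * c) + - S * (C * s) + s * (C * s) * (S * s) = 0"
      if "c * c = 1 - s * s" for s c S C :: real
      using that by algebra
    note eq = this[OF sq]
    show "?b12 x + ?c12 x + ?h12 x = 0" for x :: "nat \<Rightarrow> real"
      by (rule eq)
  qed (use f' in simp_all)
  have s21: "?m ?b21 1 0 \<boxplus> ?m ?c21 1 0 \<boxplus> ?m ?h21 1 0 = ?m (\<lambda>x. 0) 1 0"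
  proof (rule sum3)
    have "s * c * S * (C * c) + C * (- S * s) + s * (S * s) * (C * s) = 0"
      if "c * c = 1 - s * s" for s c S C :: real
      using that by algebra
    note eq = this[OF sq]
    show "?b21 x + ?c21 x + ?h21 x = 0" for x :: "nat \<Rightarrow> real"
      by (rule eq)
  qed (use f' in simp_all)
  have r1: "mean X t ?W1' (pd 2 0 f) \<boxplus> mean X t (\<lambda>x. - cos (x 1)) (pd 2 0 f) \<boxplus> mean X t (\<lambda>x. 2 * ?r1 x) (pd 2 0 f)
    = mean X t (\<lambda>x. 0) (pd 2 0 f)"
  proof (rule sum3)
    have "(c * c + - (s * s)) * C + - C + 2 * (s * (C * s)) = 0" if "c * c = 1 - s * s" for s c C :: real
      using that by algebra
    note eq = this[OF sq]
    show "?W1' x + - cos (x 1) + 2 * ?r1 x = 0" for x :: "nat \<Rightarrow> real"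
      by (rule eq)
  qed (use f' in simp_all)
  have r2: "mean X t ?W2' (pd 2 1 f) \<boxplus> mean X t (\<lambda>x. - sin (x 1)) (pd 2 1 f) \<boxplus> mean X t (\<lambda>x. 2 * ?r2 x) (pd 2 1 f)
    = mean X t (\<lambda>x. 0) (pd 2 1 f)"
  proof (rule sum3)
    have "(c * c + - (s * s)) * C + - C + 2 * (s * (C * s)) = 0" if "c * c = 1 - s * s" for s c C :: real
      using that by algebra
    note eq = this[OF sq]
    show "?W2' x + - sin (x 1) + 2 * ?r2 x = 0" for x :: "nat \<Rightarrow> real"
      by (rule eq)
  qed (use f' in simp_all)
  have two: "mean X t (\<lambda>x. 2 * ?r1 x) (pd 2 0 f) = const X 2 \<boxtimes> mean X t ?r1 (pd 2 0 f)"
    "mean X t (\<lambda>x. 2 * ?r2 x) (pd 2 1 f) = const X 2 \<boxtimes> mean X t ?r2 (pd 2 1 f)"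
    by (rule mean_scale_weight; use t f' in simp)+
  \<comment> \<open>The sum of the four equations \<open>P\<close>, rearranged with \<open>S\<close> for the second and \<open>R\<close> for the first
    derivatives.\<close>
  have ring: "t \<boxtimes> ((h1 \<boxplus> h2) \<boxplus> (h3 \<boxplus> h4)) \<boxplus> const X 2 \<boxtimes> (r1 \<boxplus> r2)
      = t \<boxtimes> (s1 \<boxplus> s4)"
    if P: "a1 \<boxplus> t \<boxtimes> (b1 \<boxplus> b2) = const X 0" "a2 \<boxplus> t \<boxtimes> (b3 \<boxplus> b4) = const X 0"
        "a3 \<boxplus> t \<boxtimes> (c1 \<boxplus> c2) = const X 0" "a4 \<boxplus> t \<boxtimes> (c3 \<boxplus> c4) = const X 0"
      and S: "b1 \<boxplus> c1 \<boxplus> h1 = s1" "b2 \<boxplus> c2 \<boxplus> h2 = const X 0" "b3 \<boxplus> c3 \<boxplus> h3 = const X 0" "b4 \<boxplus> c4 \<boxplus> h4 = s4"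
      and R: "a1 \<boxplus> a3 \<boxplus> const X 2 \<boxtimes> r1 = const X 0" "a2 \<boxplus> a4 \<boxplus> const X 2 \<boxtimes> r2 = const X 0"
      and ty: "elements X [h1, h2, h3, h4, r1, r2, a1, a2, a3, a4, b1, b2, b3, b4, c1, c2, c3, c4]"
    for h1 h2 h3 h4 r1 r2 a1 a2 a3 a4 b1 b2 b3 b4 c1 c2 c3 c4 s1 s4
  proof -
    have "t \<boxtimes> ((h1 \<boxplus> h2) \<boxplus> (h3 \<boxplus> h4)) \<boxplus> const X 2 \<boxtimes> (r1 \<boxplus> r2)
      \<boxplus> ((a1 \<boxplus> t \<boxtimes> (b1 \<boxplus> b2)) \<boxplus> (a2 \<boxplus> t \<boxtimes> (b3 \<boxplus> b4)) \<boxplus> (a3 \<boxplus> t \<boxtimes> (c1 \<boxplus> c2)) \<boxplus> (a4 \<boxplus> t \<boxtimes> (c3 \<boxplus> c4)))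
      = t \<boxtimes> ((b1 \<boxplus> c1 \<boxplus> h1) \<boxplus> (b2 \<boxplus> c2 \<boxplus> h2) \<boxplus> (b3 \<boxplus> c3 \<boxplus> h3) \<boxplus> (b4 \<boxplus> c4 \<boxplus> h4))
        \<boxplus> ((a1 \<boxplus> a3 \<boxplus> const X 2 \<boxtimes> r1) \<boxplus> (a2 \<boxplus> a4 \<boxplus> const X 2 \<boxtimes> r2))"
      by (rule line_atoms[of X "[h1, h2, h3, h4, r1, r2, a1, a2, a3, a4, b1, b2, b3, b4, c1, c2, c3, c4, t]"])
        (use ty t in \<open>simp_all add: val_fold algebra_simps\<close>)
    moreover have "src M s1 = X" "tgt M s1 = L" "src M s4 = X" "tgt M s4 = L"
      using ty unfolding S(1,4)[symmetric] by simp_all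
    ultimately show ?thesis
      unfolding P S R using ty t by simp
  qed
  show ?thesis
    unfolding rad_def rad2_def
    by (subst mean_lap[OF _ t f], simp)
      (rule ring[OF P1 P2 T1 T2 s11 s12[unfolded zero[OF f'(3,4)]] s21[unfolded zero[OF f'(3,4)]] s22
        r1[unfolded two zero[OF f'(1,2)]] r2[unfolded two zero[OF f'(1,2)]]], use t f' in simp)
qed


section \<open>Integrals over the ball\<close>

lemma mean_wS_plus:
  assumes "src M t = X" "tgt M t = L" "src M f = X" "tgt M f = EE 2" "nilsquare e" "src M e = X"
  shows "mean X (t \<boxplus> e) wS f = mean X t wS f \<boxplus> e \<boxtimes> rad X t f"
  unfolding rad_def by (rule mean_plus) (use assms in simp_all)

text \<open>
  \<open>ball_mean\<close> is the integral for \<open>B\<^sup>t\<close> of the function \<open>g\<close>, extended constantly along the third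
  coordinate.
\<close>

definition ball_mean where
  "ball_mean X t g = itg X 0 1 (\<lambda>h s. (s \<boxtimes> s) \<boxtimes> mean (src M s) ((t \<odot> h) \<boxtimes> s) wS (g \<odot> h))"

text \<open>The derivative of \<open>ball_mean\<close> in \<open>t\<close>.\<close>

definition ball_rad where
  "ball_rad X t g = itg X 0 1 (\<lambda>h s. (s \<boxtimes> (s \<boxtimes> s)) \<boxtimes> rad (src M s) ((t \<odot> h) \<boxtimes> s) (g \<odot> h))"

lemma times_one: "src M a = X \<Longrightarrow> tgt M a = L \<Longrightarrow> a \<boxtimes> const X 1 = a"
  by (rule line_atoms[of X "[a]"]) (simp_all add: val_fold)

lemma natural_ball_mean:
  assumes "src M t = X" "tgt M t = L" "src M g = X" "tgt M g = EE 2"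
  shows "natural X L L (\<lambda>h s. (s \<boxtimes> s) \<boxtimes> mean (src M s) ((t \<odot> h) \<boxtimes> s) wS (g \<odot> h))"
  by (rule naturalI) (use assms in simp_all)

lemma natural_ball_rad:
  assumes "src M t = X" "tgt M t = L" "src M g = X" "tgt M g = EE 2"
  shows "natural X L L (\<lambda>h s. (s \<boxtimes> (s \<boxtimes> s)) \<boxtimes> rad (src M s) ((t \<odot> h) \<boxtimes> s) (g \<odot> h))"
  by (rule naturalI) (use assms in simp_all)

lemma ball_mean_type [simp]:
  assumes "src M t = X" "tgt M t = L" "src M g = X" "tgt M g = EE 2"
  shows "src M (ball_mean X t g) = X" "tgt M (ball_mean X t g) = L"
    "src M (ball_rad X t g) = X" "tgt M (ball_rad X t g) = L"
  using natural_ball_mean[OF assms] natural_ball_rad[OF assms] by (simp_all add: ball_mean_def ball_rad_def)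

lemma ball_mean_comp [simp]:
  assumes "src M t = X" "tgt M t = L" "src M g = X" "tgt M g = EE 2" "tgt M k = X"
  shows "ball_mean X t g \<odot> k = ball_mean (src M k) (t \<odot> k) (g \<odot> k)"
  unfolding ball_mean_def itg_comp[OF natural_ball_mean[OF assms(1-4)] assms(5)]
  by (rule itg_cong) (use assms in simp)

lemma times_plus:
  assumes "src M t = X" "src M s = X" "src M e = X" "tgt M t = L" "tgt M s = L" "tgt M e = L"
  shows "t \<boxtimes> (s \<boxplus> e) = t \<boxtimes> s \<boxplus> t \<boxtimes> e" "(s \<boxplus> e) \<boxtimes> t = s \<boxtimes> t \<boxplus> e \<boxtimes> t"
  by (rule line_atoms[of X "[t, s, e]"]; use assms in \<open>simp add: val_fold algebra_simps\<close>)+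

text \<open>
  The derivative of \<open>s\<^sup>2 rad (t s)\<close> in \<open>s\<close> is \<open>s (t s rad2 (t s) + 2 rad (t s))\<close>. By
  \<open>sphere_divergence\<close> at the radius \<open>t s\<close> this is \<open>t\<close> times the integrand of \<open>ball_mean\<close>. Now
  integrate from \<open>0\<close> to \<open>1\<close>.
\<close>

lemma rad_eq_ball_mean:
  assumes t: "src M t = X" "tgt M t = L" and f: "src M f = X" "tgt M f = EE 2"
  shows "rad X t f = t \<boxtimes> ball_mean X t (lap 2 f)"
proof -
  let ?G = "\<lambda>h s. (s \<boxtimes> s) \<boxtimes> rad (src M s) ((t \<odot> h) \<boxtimes> s) (f \<odot> h)"
  let ?B = "\<lambda>h s. (s \<boxtimes> s) \<boxtimes> mean (src M s) ((t \<odot> h) \<boxtimes> s) wS (lap 2 f \<odot> h)"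
  have lf: "src M (lap 2 f) = X" "tgt M (lap 2 f) = EE 2" using f by simp_all
  have "fder X ?G (\<lambda>h s. (t \<odot> h) \<boxtimes> ?B h s)"
  proof (rule fderI)
    show "natural X L L ?G"
      by (rule naturalI) (use t f in simp_all)
    show "natural X L L (\<lambda>h s. (t \<odot> h) \<boxtimes> ?B h s)"
      by (rule naturalI) (use t f in simp_all)
    fix h s e assume h: "tgt M h = X" "tgt M s = L" "src M h = src M s" "src M e = src M s" "nilsquare e"
    let ?Y = "src M s"
    let ?t = "t \<odot> h" and ?f = "f \<odot> h"
    let ?R = "rad ?Y (?t \<boxtimes> s) ?f" and ?H = "rad2 ?Y (?t \<boxtimes> s) ?f" and ?S = "mean ?Y (?t \<boxtimes> s) wS (lap 2 ?f)"
    have et: "tgt M e = L" using h by simp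
    have ty: "src M ?t = ?Y" "tgt M ?t = L" "src M ?f = ?Y" "tgt M ?f = EE 2" using h t f by simp_all
    then have ts: "src M (?t \<boxtimes> s) = ?Y" "tgt M (?t \<boxtimes> s) = L" using h by simp_all
    have te: "nilsquare (?t \<boxtimes> e)" "src M (?t \<boxtimes> e) = ?Y" using ty h by simp_all
    have "?t \<boxtimes> (s \<boxplus> e) = ?t \<boxtimes> s \<boxplus> ?t \<boxtimes> e"
      by (rule times_plus(1)[of _ ?Y]) (use ty h et in simp_all)
    then have 1: "rad ?Y (?t \<boxtimes> (s \<boxplus> e)) ?f = ?R \<boxplus> (?t \<boxtimes> e) \<boxtimes> ?H"
      using rad_plus[OF ts ty(3,4) te] by simp
    have eq: "((s \<boxplus> e) \<boxtimes> (s \<boxplus> e)) \<boxtimes> (R \<boxplus> (u \<boxtimes> e) \<boxtimes> H)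
      = ((s \<boxtimes> s) \<boxtimes> R \<boxplus> e \<boxtimes> (s \<boxtimes> ((u \<boxtimes> s) \<boxtimes> H \<boxplus> const ?Y 2 \<boxtimes> R)))
        \<boxplus> (e \<boxtimes> e) \<boxtimes> (R \<boxplus> const ?Y 2 \<boxtimes> s \<boxtimes> u \<boxtimes> H \<boxplus> e \<boxtimes> u \<boxtimes> H)"
      if "src M R = ?Y" "tgt M R = L" "src M H = ?Y" "tgt M H = L" "src M u = ?Y" "tgt M u = L"
        "src M s = Y" "src M e = Y" "?Y = Y" for R H u Y
      unfolding that(9)
      by (rule line_atoms[of Y "[s, e, R, H, u]"])
        (use that(1-6)[unfolded that(9)] that(7,8) h(2) et in \<open>simp_all add: val_fold algebra_simps\<close>)
    have 2: "((s \<boxplus> e) \<boxtimes> (s \<boxplus> e)) \<boxtimes> (?R \<boxplus> (?t \<boxtimes> e) \<boxtimes> ?H)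
      = (s \<boxtimes> s) \<boxtimes> ?R \<boxplus> e \<boxtimes> (s \<boxtimes> ((?t \<boxtimes> s) \<boxtimes> ?H \<boxplus> const ?Y 2 \<boxtimes> ?R))"
      by (rule nil_drop[OF eq[OF _ _ _ _ _ _ refl h(4) refl] h(5)]) (use ty ts h et in simp_all)
    have 3: "s \<boxtimes> ((?t \<boxtimes> s) \<boxtimes> ?S) = ?t \<boxtimes> ((s \<boxtimes> s) \<boxtimes> ?S)"
    proof -
      have "a \<boxtimes> ((u \<boxtimes> a) \<boxtimes> c) = u \<boxtimes> ((a \<boxtimes> a) \<boxtimes> c)"
        if "elements Y [a, u, c]" for a u c Y
        by (rule line_atoms[OF that]) (simp_all add: val_fold algebra_simps)
      from this[of ?Y s] show ?thesis using ty ts h by simp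
    qed
    have src: "src M (s \<boxplus> e) = ?Y" using h et by simp
    have lfh: "lap 2 f \<odot> h = lap 2 ?f" using f h by simp
    show "?G h (s \<boxplus> e) = ?G h s \<boxplus> e \<boxtimes> (?t \<boxtimes> ?B h s)"
      unfolding src 1 2 sphere_divergence[OF ts ty(3,4)] 3 lfh ..
  qed
  note F = this
  have "itg X 0 1 (\<lambda>h s. (t \<odot> h) \<boxtimes> ?B h s) = rad X (t \<boxtimes> const X 1) f"
    using itg_fder[OF F, of 0 1] itg_type[OF fder_natural(2)[OF F], of 0 1] t f by (simp add: const_fold)
  moreover have "t \<boxtimes> const X 1 = t"
    using t by (simp add: times_one)
  ultimately show ?thesis
    using itg_scale[OF natural_ball_mean[OF t lf] t, of 0 1] by (simp add: ball_mean_def)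
qed

lemma ball_mean_plus:
  assumes t: "src M t = X" "tgt M t = L" and g: "src M g = X" "tgt M g = EE 2" and e: "nilsquare e" "src M e = X"
  shows "ball_mean X (t \<boxplus> e) g = ball_mean X t g \<boxplus> e \<boxtimes> ball_rad X t g"
proof -
  let ?N = "\<lambda>h s. (s \<boxtimes> s) \<boxtimes> mean (src M s) ((t \<odot> h) \<boxtimes> s) wS (g \<odot> h)"
  let ?N' = "\<lambda>h s. (s \<boxtimes> (s \<boxtimes> s)) \<boxtimes> rad (src M s) ((t \<odot> h) \<boxtimes> s) (g \<odot> h)"
  have et: "tgt M e = L" using e by simp
  have N'': "natural X L L (\<lambda>h s. (e \<odot> h) \<boxtimes> ?N' h s)"
    by (rule naturalI) (use t g e et in simp_all)
  have "ball_mean X (t \<boxplus> e) g = itg X 0 1 (\<lambda>h s. ?N h s \<boxplus> (e \<odot> h) \<boxtimes> ?N' h s)"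
    unfolding ball_mean_def
  proof (rule itg_cong)
    fix h s assume h: "tgt M h = X" "tgt M s = L" "src M h = src M s"
    let ?Y = "src M s"
    let ?t = "t \<odot> h" and ?g = "g \<odot> h" and ?e = "e \<odot> h"
    have ty: "src M ?t = ?Y" "tgt M ?t = L" "src M ?g = ?Y" "tgt M ?g = EE 2" "src M ?e = ?Y" "nilsquare ?e" "tgt M ?e = L"
      using h t g e by simp_all
    then have ts: "src M (?t \<boxtimes> s) = ?Y" "tgt M (?t \<boxtimes> s) = L" "nilsquare (?e \<boxtimes> s)" "src M (?e \<boxtimes> s) = ?Y" using h by simp_all
    have "((t \<boxplus> e) \<odot> h) \<boxtimes> s = ?t \<boxtimes> s \<boxplus> ?e \<boxtimes> s"
      using t e et h ty by (simp add: times_plus(2)[of _ ?Y])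
    then have 1: "mean ?Y (((t \<boxplus> e) \<odot> h) \<boxtimes> s) wS ?g = mean ?Y (?t \<boxtimes> s) wS ?g \<boxplus> (?e \<boxtimes> s) \<boxtimes> rad ?Y (?t \<boxtimes> s) ?g"
      using mean_wS_plus[OF ts(1,2) ty(3,4) ts(3,4)] by simp
    have eq: "(s \<boxtimes> s) \<boxtimes> (m \<boxplus> (e \<boxtimes> s) \<boxtimes> R) = (s \<boxtimes> s) \<boxtimes> m \<boxplus> e \<boxtimes> ((s \<boxtimes> (s \<boxtimes> s)) \<boxtimes> R)"
      if "elements Y [s, m, e, R]" for s m e R Y
      by (rule line_atoms[OF that]) (simp_all add: val_fold algebra_simps)
    show "(s \<boxtimes> s) \<boxtimes> mean ?Y (((t \<boxplus> e) \<odot> h) \<boxtimes> s) wS ?g = ?N h s \<boxplus> ?e \<boxtimes> ?N' h s"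
      unfolding 1 by (rule eq[of ?Y]) (use ty ts h in simp_all)
  qed
  then show ?thesis
    unfolding itg_add[OF natural_ball_mean[OF t g] N''] itg_scale[OF natural_ball_rad[OF t g] e(2) et]
    by (simp add: ball_mean_def ball_rad_def)
qed

text \<open>
  Integrate from \<open>0\<close> to \<open>1\<close> the derivative in \<open>s\<close> of \<open>s\<^sup>3\<close> times the integral over the sphere
  with radius \<open>t s\<close>.
\<close>

lemma ball_mean_euler:
  assumes t: "src M t = X" "tgt M t = L" and g: "src M g = X" "tgt M g = EE 2"
  shows "const X 3 \<boxtimes> ball_mean X t g \<boxplus> t \<boxtimes> ball_rad X t g = mean X t wS g"
proof -
  let ?G = "\<lambda>h s. (s \<boxtimes> (s \<boxtimes> s)) \<boxtimes> mean (src M s) ((t \<odot> h) \<boxtimes> s) wS (g \<odot> h)"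
  let ?N = "\<lambda>h s. (s \<boxtimes> s) \<boxtimes> mean (src M s) ((t \<odot> h) \<boxtimes> s) wS (g \<odot> h)"
  let ?N' = "\<lambda>h s. (s \<boxtimes> (s \<boxtimes> s)) \<boxtimes> rad (src M s) ((t \<odot> h) \<boxtimes> s) (g \<odot> h)"
  have c3: "src M (const X 3) = X" "tgt M (const X 3) = L" by simp_all
  have N1: "natural X L L (\<lambda>h s. (const X 3 \<odot> h) \<boxtimes> ?N h s)"
    by (rule naturalI) (use t g in simp_all)
  have N2: "natural X L L (\<lambda>h s. (t \<odot> h) \<boxtimes> ?N' h s)"
    by (rule naturalI) (use t g in simp_all)
  have "fder X ?G (\<lambda>h s. (const X 3 \<odot> h) \<boxtimes> ?N h s \<boxplus> (t \<odot> h) \<boxtimes> ?N' h s)"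
  proof (rule fderI)
    show "natural X L L ?G"
      by (rule naturalI) (use t g in simp_all)
    show "natural X L L (\<lambda>h s. (const X 3 \<odot> h) \<boxtimes> ?N h s \<boxplus> (t \<odot> h) \<boxtimes> ?N' h s)"
      by (rule naturalI) (use t g in simp_all)
    fix h s e assume h: "tgt M h = X" "tgt M s = L" "src M h = src M s" "src M e = src M s" "nilsquare e"
    let ?Y = "src M s"
    let ?t = "t \<odot> h" and ?g = "g \<odot> h"
    let ?R = "rad ?Y (?t \<boxtimes> s) ?g" and ?S = "mean ?Y (?t \<boxtimes> s) wS ?g"
    have et: "tgt M e = L" using h by simp
    have ty: "src M ?t = ?Y" "tgt M ?t = L" "src M ?g = ?Y" "tgt M ?g = EE 2" using h t g by simp_all
    then have ts: "src M (?t \<boxtimes> s) = ?Y" "tgt M (?t \<boxtimes> s) = L" using h by simp_all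
    have te: "nilsquare (?t \<boxtimes> e)" "src M (?t \<boxtimes> e) = ?Y" using ty h by simp_all
    have "?t \<boxtimes> (s \<boxplus> e) = ?t \<boxtimes> s \<boxplus> ?t \<boxtimes> e"
      by (rule times_plus(1)[of _ ?Y]) (use ty h et in simp_all)
    then have 1: "mean ?Y (?t \<boxtimes> (s \<boxplus> e)) wS ?g = ?S \<boxplus> (?t \<boxtimes> e) \<boxtimes> ?R"
      using mean_wS_plus[OF ts ty(3,4) te] by simp
    have eq: "((s \<boxplus> e) \<boxtimes> ((s \<boxplus> e) \<boxtimes> (s \<boxplus> e))) \<boxtimes> (S \<boxplus> (u \<boxtimes> e) \<boxtimes> R)
      = ((s \<boxtimes> (s \<boxtimes> s)) \<boxtimes> S \<boxplus> e \<boxtimes> (const Y 3 \<boxtimes> ((s \<boxtimes> s) \<boxtimes> S) \<boxplus> u \<boxtimes> ((s \<boxtimes> (s \<boxtimes> s)) \<boxtimes> R)))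
        \<boxplus> (e \<boxtimes> e) \<boxtimes> ((const Y 3 \<boxtimes> s \<boxplus> e) \<boxtimes> S \<boxplus> u \<boxtimes> ((const Y 3 \<boxtimes> s \<boxtimes> s \<boxplus> const Y 3 \<boxtimes> s \<boxtimes> e \<boxplus> e \<boxtimes> e) \<boxtimes> R))"
      if "src M S = Y" "tgt M S = L" "src M R = Y" "tgt M R = L" "src M u = Y" "tgt M u = L"
        "src M s = Y" "src M e = Y" for S R u Y
      by (rule line_atoms[of Y "[s, e, S, R, u]"])
        (use that h(2) et in \<open>simp_all add: val_fold algebra_simps\<close>)
    have 2: "((s \<boxplus> e) \<boxtimes> ((s \<boxplus> e) \<boxtimes> (s \<boxplus> e))) \<boxtimes> (?S \<boxplus> (?t \<boxtimes> e) \<boxtimes> ?R)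
      = (s \<boxtimes> (s \<boxtimes> s)) \<boxtimes> ?S \<boxplus> e \<boxtimes> (const ?Y 3 \<boxtimes> ((s \<boxtimes> s) \<boxtimes> ?S) \<boxplus> ?t \<boxtimes> ((s \<boxtimes> (s \<boxtimes> s)) \<boxtimes> ?R))"
      by (rule nil_drop[OF eq[OF _ _ _ _ _ _ refl h(4)] h(5)]) (use ty ts h et in simp_all)
    have src: "src M (s \<boxplus> e) = ?Y" "const X 3 \<odot> h = const ?Y 3" using h et by simp_all
    show "?G h (s \<boxplus> e) = ?G h s \<boxplus> e \<boxtimes> ((const X 3 \<odot> h) \<boxtimes> ?N h s \<boxplus> ?t \<boxtimes> ?N' h s)"
      unfolding src 1 2 ..
  qed
  from itg_fder[OF this, of 0 1]
  have "itg X 0 1 (\<lambda>h s. (const X 3 \<odot> h) \<boxtimes> ?N h s \<boxplus> (t \<odot> h) \<boxtimes> ?N' h s) \<boxplus> const X 0 = mean X t wS g"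
    using t g by (simp add: const_fold times_one)
  then show ?thesis
    unfolding itg_add[OF N1 N2] itg_scale[OF natural_ball_mean[OF t g] c3] itg_scale[OF natural_ball_rad[OF t g] t]
    using t g by (simp add: ball_mean_def[symmetric] ball_rad_def[symmetric])
qed

text \<open>
  The area of the unit sphere, from antiderivatives of \<open>sin p\<close> in \<open>q\<close> and of \<open>2\<pi> sin p\<close> in \<open>p\<close>.
\<close>

lemma dbl_area: "dbl X (\<lambda>h p q. wt wS p q) = const X (4 * pi)"
proof -
  have nat2: "natural2 X (\<lambda>h p q. wt wS p q)"
    by (rule natural2I) simp_all
  have i: "inner (\<lambda>h p q. wt wS p q) 0 (2 * pi) h p = const (src M p) (2 * pi) \<boxtimes> sine p"
    if h: "tgt M h = X" "tgt M p = L" "src M h = src M p" for h p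
  proof -
    have "fder (src M p) (\<lambda>k q. q \<boxtimes> sine (p \<odot> k)) (\<lambda>k q. wt wS (p \<odot> k) q)"
    proof (rule fderI)
      show "natural (src M p) L L (\<lambda>k q. q \<boxtimes> sine (p \<odot> k))"
        by (rule naturalI) (use h in simp_all)
      show "natural (src M p) L L (\<lambda>k. wt wS (p \<odot> k))"
        by (rule naturalI) (use h in simp_all)
      fix k q e assume k: "tgt M k = src M p" "tgt M q = L" "src M k = src M q" "src M e = src M q" "nilsquare e"
      then show "(q \<boxplus> e) \<boxtimes> sine (p \<odot> k) = q \<boxtimes> sine (p \<odot> k) \<boxplus> e \<boxtimes> wt wS (p \<odot> k) q"
        using h by (simp add: wt_simps times_plus(2)[of _ "src M q"])
    qed
    from itg_fder[OF this, of 0 "2 * pi"] show ?thesis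
      using h natural_slice[OF nat2 h] by (simp add: inner_def)
  qed
  have "fder X (\<lambda>h p. const (src M p) (- 2 * pi) \<boxtimes> cosine p) (\<lambda>h p. const (src M p) (2 * pi) \<boxtimes> sine p)"
  proof (rule fderI)
    show "natural X L L (\<lambda>h p. const (src M p) (- 2 * pi) \<boxtimes> cosine p)"
      by (rule naturalI) simp_all
    show "natural X L L (\<lambda>h p. const (src M p) (2 * pi) \<boxtimes> sine p)"
      by (rule naturalI) simp_all
    fix h p e assume h: "tgt M h = X" "tgt M p = L" "src M h = src M p" "src M e = src M p" "nilsquare e"
    have eq: "const Y (- 2 * pi) \<boxtimes> (c \<boxplus> e \<boxtimes> (const Y (- 1) \<boxtimes> s)) = const Y (- 2 * pi) \<boxtimes> c \<boxplus> e \<boxtimes> (const Y (2 * pi) \<boxtimes> s)"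
      if "elements Y [e, s, c]" for c s e Y
      by (rule line_atoms[OF that]) (simp_all add: val_fold algebra_simps)
    have src: "src M (p \<boxplus> e) = src M p" using h by simp
    show "const (src M (p \<boxplus> e)) (- 2 * pi) \<boxtimes> cosine (p \<boxplus> e)
      = const (src M p) (- 2 * pi) \<boxtimes> cosine p \<boxplus> e \<boxtimes> (const (src M p) (2 * pi) \<boxtimes> sine p)"
      unfolding src sine_plus(2)[OF h(2) refl h(5,4)]
      by (rule eq) (use h in simp_all)
  qed
  note F = this
  have "itg X 0 pi (\<lambda>h p. const (src M p) (2 * pi) \<boxtimes> sine p) \<boxplus> const X (- 2 * pi) = const X (2 * pi)"
    using itg_fder[OF F, of 0 pi] by (simp add: const_fold)
  then have "const X (- 2 * pi) \<boxplus> itg X 0 pi (\<lambda>h p. const (src M p) (2 * pi) \<boxtimes> sine p) = const X (- 2 * pi) \<boxplus> const X (4 * pi)"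
    using plus_commute[of "itg X 0 pi (\<lambda>h p. const (src M p) (2 * pi) \<boxtimes> sine p)" X "const X (- 2 * pi)"] fder_natural(2)[OF F]
    by (simp add: const_fold)
  then have "itg X 0 pi (\<lambda>h p. const (src M p) (2 * pi) \<boxtimes> sine p) = const X (4 * pi)"
    by (rule plus_left_cancel) (use fder_natural(2)[OF F] in simp_all)
  moreover have "dbl X (\<lambda>h p q. wt wS p q) = itg X 0 pi (\<lambda>h p. const (src M p) (2 * pi) \<boxtimes> sine p)"
    unfolding dbl_def by (rule itg_cong) (rule i)
  ultimately show ?thesis by simp
qed

lemma times_commute:
  assumes "src M a = X" "src M b = X" "tgt M a = L" "tgt M b = L"
  shows "a \<boxtimes> b = b \<boxtimes> a"
  by (rule line_atoms[of X "[a, b]"]) (use assms in \<open>simp_all add: val_fold algebra_simps\<close>)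

lemma mean_at_zero:
  assumes f: "src M f = X" "tgt M f = EE 2"
  shows "mean X (const X 0) wS f = const X (4 * pi) \<boxtimes> app L f (tup_arr M X [const X 0, const X 0])"
proof -
  let ?c = "app L f (tup_arr M X [const X 0, const X 0])"
  have c: "src M ?c = X" "tgt M ?c = L" using f by simp_all
  have nat2: "natural2 X (\<lambda>h p q. wt wS p q)"
    by (rule natural2I) simp_all
  have "mean X (const X 0) wS f = dbl X (\<lambda>h p q. (?c \<odot> h) \<boxtimes> wt wS p q)"
    unfolding mean_def
  proof (rule dbl_cong)
    fix h p q assume h: "tgt M h = X" "tgt M p = L" "tgt M q = L" "src M h = src M q" "src M p = src M q"
    have "pt (const X 0 \<odot> h) p q = tup_arr M X [const X 0, const X 0] \<odot> h"
      using h by (simp add: pt_def)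
    then show "wt wS p q \<boxtimes> app L (f \<odot> h) (pt (const X 0 \<odot> h) p q) = (?c \<odot> h) \<boxtimes> wt wS p q"
      using h f by (simp add: times_commute[of "wt wS p q" "src M q"])
  qed
  also have "\<dots> = ?c \<boxtimes> const X (4 * pi)"
    unfolding dbl_scale[OF nat2 c] dbl_area ..
  finally show ?thesis
    using times_commute[OF c(1) _ c(2), of "const X (4 * pi)"] by simp
qed

section \<open>Linearity in the test function\<close>

text \<open>
  Linear combinations of test functions occur as denotations of lambda terms; only their values
  matter.
\<close>

definition pointwise where
  "pointwise n X s F \<longleftrightarrow> src M s = X \<and> tgt M s = EE n \<and>
     (\<forall>h x. tgt M h = X \<longrightarrow> tgt M x = Rn n \<longrightarrow> src M h = src M x \<longrightarrow> app L (s \<odot> h) x = F h x)"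

lemma mean_linear:
  assumes w: "elementary 2 w" and t: "src M t = X" "tgt M t = L" and f: "src M f = X" "tgt M f = EE 2" and g: "src M g = X" "tgt M g = EE 2"
    and a: "src M a = X" "tgt M a = L" and b: "src M b = X" "tgt M b = L"
    and s: "pointwise 2 X s (\<lambda>h x. (a \<odot> h) \<boxtimes> app L (f \<odot> h) x \<boxplus> (b \<odot> h) \<boxtimes> app L (g \<odot> h) x)"
  shows "mean X t w s = a \<boxtimes> mean X t w f \<boxplus> b \<boxtimes> mean X t w g"
proof -
  have eq: "u \<boxtimes> (a \<boxtimes> f \<boxplus> b \<boxtimes> g) = a \<boxtimes> (u \<boxtimes> f) \<boxplus> b \<boxtimes> (u \<boxtimes> g)" if "elements Y [u, a, b, f, g]" for u a b f g Y
    by (rule line_atoms[OF that]) (simp_all add: val_fold algebra_simps)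
  have N: "natural2 X (\<lambda>h p q. (a \<odot> h) \<boxtimes> integrand t w f h p q)" "natural2 X (\<lambda>h p q. (b \<odot> h) \<boxtimes> integrand t w g h p q)"
    by (rule natural2I; use w t f g a b in simp)+
  have "mean X t w s = dbl X (\<lambda>h p q. (a \<odot> h) \<boxtimes> integrand t w f h p q \<boxplus> (b \<odot> h) \<boxtimes> integrand t w g h p q)"
    unfolding mean_def
  proof (rule dbl_cong)
    fix h p q assume h: "tgt M h = X" "tgt M p = L" "tgt M q = L" "src M h = src M q" "src M p = src M q"
    have "app L (s \<odot> h) (pt (t \<odot> h) p q)
      = (a \<odot> h) \<boxtimes> app L (f \<odot> h) (pt (t \<odot> h) p q) \<boxplus> (b \<odot> h) \<boxtimes> app L (g \<odot> h) (pt (t \<odot> h) p q)"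
      using s[unfolded pointwise_def] h t by simp
    then show "integrand t w s h p q = (a \<odot> h) \<boxtimes> integrand t w f h p q \<boxplus> (b \<odot> h) \<boxtimes> integrand t w g h p q"
      by (simp only:) (rule eq[of "src M q"], use h w t f g a b in simp)
  qed
  then show ?thesis
    unfolding dbl_add[OF N] dbl_scale[OF natural2_mean[OF w t f] a] dbl_scale[OF natural2_mean[OF w t g] b]
    by (simp only: mean_def)
qed


section \<open>The sphere and ball distributions\<close>

lemma den_integral:
  assumes B: "stable B Line" and r: "env X r"
  shows "den M X r (integral_op \<cdot> Const u \<cdot> Const v \<cdot> Lam (x, Line) B)
    = itg X u v (\<lambda>h p. den M (src M p) ((\<lambda>w. r w \<odot> h)((x, Line) := p)) B)"
proof -
  have s1: "stable (integral_op \<cdot> Const u) (Fun Line (Fun (Fun Line Line) Line))" for u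
    by (rule stable_App[OF stable_integral_op stable_ops(1)])
  have s2: "stable (integral_op \<cdot> Const u \<cdot> Const v) (Fun (Fun Line Line) Line)" for u v
    by (rule stable_App[OF s1 stable_ops(1)])
  have l: "den M X r (Lam (x, Line) B) = lam X L (\<lambda>h p. den M (src M p) ((\<lambda>w. r w \<odot> h)((x, Line) := p)) B)"
    by (simp add: lam_def)
  have lt: "src M (den M X r (Lam (x, Line) B)) = X" "tgt M (den M X r (Lam (x, Line) B)) = expo M L L"
    using stable_type[OF stable_Lam[OF B, of x Line] r] by simp_all
  have "den M X r (integral_op \<cdot> Const u \<cdot> Const v \<cdot> Lam (x, Line) B)
    = integ (const X u) (const X v) (den M X r (Lam (x, Line) B))"
    using den_App[OF s2 stable_Lam[OF B] r, of u v x] den_App[OF s1 stable_ops(1) r, of u v]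
      den_App[OF stable_integral_op stable_ops(1) r, of u] den_integral_op(2)[OF r lt, of "const X u" "const X v"]
    by (simp del: den.simps(6,7))
  then show ?thesis
    by (simp only: l itg_def)
qed

text \<open>The coordinates are associated as in the terms for the distributions.\<close>

definition pt3 where
  "pt3 t p q = tup_arr M (src M q) [t \<boxtimes> cosine q \<boxtimes> sine p, t \<boxtimes> sine q \<boxtimes> sine p, t \<boxtimes> cosine p]"

lemma stable_integral:
  "stable B Line \<Longrightarrow> stable (integral_op \<cdot> Const u \<cdot> Const v \<cdot> Lam (x, Line) B) Line"
  by (rule stable_integral_op stable_intros | assumption)+

lemma den_sphere:
  shows stable_sphere: "stable sphere (Fun Line (Dist 3))"
    and "stable t Line \<Longrightarrow> env X r \<Longrightarrow> src M F = X \<Longrightarrow> tgt M F = EE 3 \<Longrightarrow>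
      app L (den M X r (sphere \<cdot> t)) F
        = dbl X (\<lambda>h p q. app L (F \<odot> h) (pt3 (den M X r t \<odot> h) p q) \<boxtimes> sine p)"
proof -
  let ?t = "(''t'', Line)" and ?f = "(''f'', Fun (vec 3) Line)" and ?p = "(''phi'', Line)" and ?q = "(''theta'', Line)"
  let ?I = "Var ?f \<cdot> tup [Var ?t \<otimes> Cos (Var ?q) \<otimes> Sin (Var ?p), Var ?t \<otimes> Sin (Var ?q) \<otimes> Sin (Var ?p), Var ?t \<otimes> Cos (Var ?p)]
    \<otimes> Sin (Var ?p)"
  have I: "stable ?I Line"
    by (rule stable_intros | simp)+
  note I' = stable_integral[OF I, of 0 "2 * pi" "''theta''"]
  note I'' = stable_integral[OF I', of 0 pi "''phi''"]
  show "stable sphere (Fun Line (Dist 3))"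
    unfolding sphere_def Let_def Dist_def by (rule stable_Lam I'')+
  assume t: "stable t Line" and r: "env X r" and F: "src M F = X" "tgt M F = EE 3"
  let ?a = "den M X r t"
  have a: "src M ?a = X" "tgt M ?a = L" using stable_type[OF t r] by simp_all
  let ?r = "r(?t := ?a, ?f := F)"
  have r': "env X ?r" using r a F by simp
  let ?G = "\<lambda>h p q. app L (F \<odot> h) (pt3 (?a \<odot> h) p q) \<boxtimes> sine p"
  have "app L (den M X r (sphere \<cdot> t)) F = den M X ?r
    (integral_op \<cdot> Const 0 \<cdot> Const pi \<cdot> Lam ?p (integral_op \<cdot> Const 0 \<cdot> Const (2 * pi) \<cdot> Lam ?q ?I))"
    using den_Lam_App[OF stable_Lam[OF I'', of "''f''" "Fun (vec 3) Line"] t r, of "''t''"]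
      app_Lam[OF I'', of X "r(?t := ?a)" F "Fun (vec 3) Line" "''f''"] r a F
    by (simp add: sphere_def Let_def del: den.simps)
  also have "\<dots> = dbl X ?G"
    unfolding den_integral[OF I' r'] dbl_def
  proof (rule itg_cong)
    fix h p assume h: "tgt M h = X" "tgt M p = L" "src M h = src M p"
    let ?r2 = "(\<lambda>w. ?r w \<odot> h)(?p := p)"
    have r2: "env (src M p) ?r2"
      using r' h by (simp del: fun_upd_apply)
    show "den M (src M p) ?r2 (integral_op \<cdot> Const 0 \<cdot> Const (2 * pi) \<cdot> Lam ?q ?I) = inner ?G 0 (2 * pi) h p"
      unfolding den_integral[OF I r2] inner_def
    proof (rule itg_cong)
      fix k q assume k: "tgt M k = src M p" "tgt M q = L" "src M k = src M q"
      show "den M (src M q) ((\<lambda>w. ?r2 w \<odot> k)(?q := q)) ?I = ?G (h \<odot> k) (p \<odot> k) q"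
        using h k a F by (simp add: den_tup app_fold pt3_def)
    qed
  qed
  finally show "app L (den M X r (sphere \<cdot> t)) F = dbl X ?G" .
qed

lemma den_ball:
  shows stable_ball: "stable ball (Fun Line (Dist 3))"
    and "stable t Line \<Longrightarrow> env X r \<Longrightarrow> src M F = X \<Longrightarrow> tgt M F = EE 3 \<Longrightarrow>
      app L (den M X r (ball \<cdot> t)) F = itg X 0 1 (\<lambda>h s. dbl (src M s) (\<lambda>k p q.
        app L (F \<odot> h \<odot> k) (pt3 ((den M X r t \<odot> h \<odot> k) \<boxtimes> (s \<odot> k)) p q) \<boxtimes> ((s \<odot> k) \<boxtimes> (s \<odot> k)) \<boxtimes> sine p))"
proof -
  let ?t = "(''t'', Line)" and ?f = "(''f'', Fun (vec 3) Line)" and ?p = "(''phi'', Line)" and ?q = "(''theta'', Line)"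
    and ?s = "(''s'', Line)"
  let ?I = "Var ?f \<cdot> tup [Var ?t \<otimes> Var ?s \<otimes> Cos (Var ?q) \<otimes> Sin (Var ?p), Var ?t \<otimes> Var ?s \<otimes> Sin (Var ?q) \<otimes> Sin (Var ?p),
      Var ?t \<otimes> Var ?s \<otimes> Cos (Var ?p)]
    \<otimes> (Var ?s \<otimes> Var ?s) \<otimes> Sin (Var ?p)"
  have I: "stable ?I Line"
    by (rule stable_intros | simp)+
  note I' = stable_integral[OF I, of 0 "2 * pi" "''theta''"]
  note I'' = stable_integral[OF I', of 0 pi "''phi''"]
  note I3 = stable_integral[OF I'', of 0 1 "''s''"]
  show "stable ball (Fun Line (Dist 3))"
    unfolding ball_def Let_def Dist_def by (rule stable_Lam I3)+
  assume t: "stable t Line" and r: "env X r" and F: "src M F = X" "tgt M F = EE 3"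
  let ?a = "den M X r t"
  have a: "src M ?a = X" "tgt M ?a = L" using stable_type[OF t r] by simp_all
  let ?r = "r(?t := ?a, ?f := F)"
  have r': "env X ?r" using r a F by simp
  let ?G = "\<lambda>h s k p q. app L (F \<odot> h \<odot> k) (pt3 ((?a \<odot> h \<odot> k) \<boxtimes> (s \<odot> k)) p q) \<boxtimes> ((s \<odot> k) \<boxtimes> (s \<odot> k)) \<boxtimes> sine p"
  have "app L (den M X r (ball \<cdot> t)) F = den M X ?r (integral_op \<cdot> Const 0 \<cdot> Const 1 \<cdot> Lam ?s
    (integral_op \<cdot> Const 0 \<cdot> Const pi \<cdot> Lam ?p (integral_op \<cdot> Const 0 \<cdot> Const (2 * pi) \<cdot> Lam ?q ?I)))"
    using den_Lam_App[OF stable_Lam[OF I3, of "''f''" "Fun (vec 3) Line"] t r, of "''t''"]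
      app_Lam[OF I3, of X "r(?t := ?a)" F "Fun (vec 3) Line" "''f''"] r a F
    by (simp add: ball_def Let_def del: den.simps)
  also have "\<dots> = itg X 0 1 (\<lambda>h s. dbl (src M s) (?G h s))"
    unfolding den_integral[OF I'' r']
  proof (rule itg_cong)
    fix g s assume g: "tgt M g = X" "tgt M s = L" "src M g = src M s"
    let ?r1 = "(\<lambda>w. ?r w \<odot> g)(?s := s)"
    have r1: "env (src M s) ?r1"
      using r' g by (simp del: fun_upd_apply)
    show "den M (src M s) ?r1 (integral_op \<cdot> Const 0 \<cdot> Const pi \<cdot> Lam ?p (integral_op \<cdot> Const 0 \<cdot> Const (2 * pi) \<cdot> Lam ?q ?I))
      = dbl (src M s) (?G g s)"
      unfolding den_integral[OF I' r1] dbl_def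
    proof (rule itg_cong)
      fix h p assume h: "tgt M h = src M s" "tgt M p = L" "src M h = src M p"
      let ?r2 = "(\<lambda>w. ?r1 w \<odot> h)(?p := p)"
      have r2: "env (src M p) ?r2"
        using r1 h by (simp del: fun_upd_apply)
      show "den M (src M p) ?r2 (integral_op \<cdot> Const 0 \<cdot> Const (2 * pi) \<cdot> Lam ?q ?I) = inner (?G g s) 0 (2 * pi) h p"
        unfolding den_integral[OF I r2] inner_def
      proof (rule itg_cong)
        fix k q assume k: "tgt M k = src M p" "tgt M q = L" "src M k = src M q"
        show "den M (src M q) ((\<lambda>w. ?r2 w \<odot> k)(?q := q)) ?I = ?G g s (h \<odot> k) (p \<odot> k) q"
          using g h k a F by (simp add: den_tup app_fold pt3_def)
      qed
    qed
  qed
  finally show "app L (den M X r (ball \<cdot> t)) F = itg X 0 1 (\<lambda>h s. dbl (src M s) (?G h s))" .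
qed

section \<open>Functions that do not depend on the third coordinate\<close>

definition pxy where "pxy x = tup_arr M (src M x) [crd 3 0 x, crd 3 1 x]"

lemma pxy_type [simp]:
  assumes "tgt M x = prd M L (prd M L (prd M L (one M)))"
  shows "src M (pxy x) = src M x" "tgt M (pxy x) = prd M L (prd M L (one M))"
  using assms by (simp_all add: pxy_def)

lemma pxy_comp [simp]:
  assumes "tgt M x = prd M L (prd M L (prd M L (one M)))" "tgt M k = src M x" shows "pxy x \<odot> k = pxy (x \<odot> k)"
  using assms by (simp add: pxy_def)

text \<open>The composite of \<open>f\<close> with the projection to the plane.\<close>

definition pull where "pull X f = lam X (Rn 3) (\<lambda>k x. app L (f \<odot> k) (pxy x))"

lemma natural_pull:
  assumes "src M f = X" "tgt M f = EE 2" shows "natural X (Rn 3) L (\<lambda>k x. app L (f \<odot> k) (pxy x))"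
  by (rule naturalI) (use assms in simp_all)

lemma pull_type [simp]:
  assumes "src M f = X" "tgt M f = EE 2" shows "src M (pull X f) = X" "tgt M (pull X f) = EE 3"
  using natural_pull[OF assms] by (simp_all add: pull_def del: Rn_simps)

lemma app_pull:
  assumes "src M f = X" "tgt M f = EE 2" "tgt M h = X" "tgt M x = Rn 3" "src M h = src M x"
  shows "app L (pull X f \<odot> h) x = app L (f \<odot> h) (pxy x)"
  unfolding pull_def using app_lam[OF natural_pull[OF assms(1,2)] assms(3,4,5)] .

lemma pull_comp [simp]:
  assumes "src M f = X" "tgt M f = EE 2" "tgt M k = X" shows "pull X f \<odot> k = pull (src M k) (f \<odot> k)"
  unfolding pull_def lam_comp[OF natural_pull[OF assms(1,2)] assms(3)]
  by (rule lam_cong) (use assms in simp)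

lemma app_proj_xy_pxy:
  assumes "env X r" "src M x = X" "tgt M x = Rn 3"
  shows "app (Rn 2) (den M X r proj_xy) x = pxy x"
proof -
  let ?x = "(''x'', vec 3)"
  have body: "stable (tup [coord 0 (Var ?x), coord 1 (Var ?x)]) (vec 2)"
    by (rule stable_intros | simp)+
  show ?thesis
    using assms app_Lam[OF body assms(1), of x "vec 3" "''x''"]
    by (simp add: proj_xy_def Let_def den_tup den_coord pxy_def del: den.simps(6,7))
qed

lemma den_push_proj_xy:
  assumes "stable l (Dist 3)" and r: "env X r" and f: "src M f = X" "tgt M f = EE 2"
  shows "app L (den M X r (push 3 2 \<cdot> proj_xy \<cdot> l)) f = app L (den M X r l) (pull X f)"
proof -
  have "lam X (Rn 3) (\<lambda>k x. app L (f \<odot> k) (app (Rn 2) (den M X r proj_xy \<odot> k) x)) = pull X f"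
    unfolding pull_def
  proof (rule lam_cong)
    fix k x assume k: "tgt M k = X" "tgt M x = Rn 3" "src M k = src M x"
    have "den M X r proj_xy \<odot> k = den M (src M x) (\<lambda>w. r w \<odot> k) proj_xy"
      using stable_comp[OF stable_proj_xy r k(1)] k(3) by simp
    moreover have "env (src M x) (\<lambda>w. r w \<odot> k)"
      using env_restrict[OF r k(1)] k(3) by simp
    ultimately show "app L (f \<odot> k) (app (Rn 2) (den M X r proj_xy \<odot> k) x) = app L (f \<odot> k) (pxy x)"
      using app_proj_xy_pxy[OF _ refl k(2)] by simp
  qed
  then show ?thesis
    using den_push[OF stable_proj_xy assms] by simp
qed

lemma crd_shift:
  assumes "tgt M x = Rn n" "src M e = src M x" "tgt M e = L" "j < n"
  shows "crd n j (shift n i x e) = (if j = i then crd n j x \<boxplus> e else crd n j x)"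
  unfolding shift_def using crd_tup_arr[OF shift_hom[OF assms(1-3), of i], of n j] assms(4) by simp

lemma pxy_shift:
  assumes x: "tgt M x = Rn 3" and e: "src M e = src M x" "tgt M e = L"
  shows "pxy (shift 3 0 x e) = shift 2 0 (pxy x) e" "pxy (shift 3 1 x e) = shift 2 1 (pxy x) e"
    "pxy (shift 3 2 x e) = pxy x"
proof -
  have c: "tgt M (crd 3 0 x) = L" "tgt M (crd 3 1 x) = L" "src M (crd 3 0 x) = src M x" "src M (crd 3 1 x) = src M x"
    using x by simp_all
  have s: "src M (shift 3 i x e) = src M x" for i
    using shift_type(1)[OF x e] .
  show "pxy (shift 3 0 x e) = shift 2 0 (pxy x) e"
    unfolding pxy_def s using shift_pair(1)[OF c(1,2) e(2) c(3,4) e(1)] crd_shift[OF x e, of 0 0] crd_shift[OF x e, of 1 0] by simp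
  show "pxy (shift 3 1 x e) = shift 2 1 (pxy x) e"
    unfolding pxy_def s using shift_pair(2)[OF c(1,2) e(2) c(3,4) e(1)] crd_shift[OF x e, of 0 1] crd_shift[OF x e, of 1 1] by simp
  show "pxy (shift 3 2 x e) = pxy x"
    unfolding pxy_def s using crd_shift[OF x e, of 0 2] crd_shift[OF x e, of 1 2] by simp
qed

text \<open>
  Moving one of the first two coordinates commutes with the projection, and moving the third one
  does not change it.
\<close>

lemma pd_pull:
  assumes f: "src M f = X" "tgt M f = EE 2"
  shows "pd 3 0 (pull X f) = pull X (pd 2 0 f)" "pd 3 1 (pull X f) = pull X (pd 2 1 f)"
    "pd 3 2 (pull X f) = lam X (Rn 3) (\<lambda>k x. const (src M x) 0)"
proof -
  have f': "src M (pd 2 i f) = X" "tgt M (pd 2 i f) = EE 2" for i using f by simp_all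
  have *: "haspd 3 j (pull X f) (pull X (pd 2 i f))"
    if j: "\<And>x e. tgt M x = Rn 3 \<Longrightarrow> src M e = src M x \<Longrightarrow> tgt M e = L \<Longrightarrow> pxy (shift 3 j x e) = shift 2 i (pxy x) e" for i j
    unfolding derivative_along_def
  proof (intro conjI allI impI)
    fix h x e assume "tgt M h = src M (pull X (pd 2 i f))" and h: "tgt M x = Rn 3" "src M h = src M x" "src M e = src M x" "nilsquare e"
    then have hX: "tgt M h = X" using f by simp
    have p: "tgt M (pxy x) = Rn 2" "src M h = src M (pxy x)" "src M e = src M (pxy x)" using h by simp_all
    have e: "tgt M e = L" using h by simp
    have "app L (f \<odot> h) (shift 2 i (pxy x) e) = app L (f \<odot> h) (pxy x) \<boxplus> e \<boxtimes> app L (pd 2 i f \<odot> h) (pxy x)"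
      by (rule derivative_alongD[OF haspd_pd[OF f(2)]]) (use hX h p f in simp_all)
    then show "app L (pull X f \<odot> h) (shift 3 j x e) = app L (pull X f \<odot> h) x \<boxplus> e \<boxtimes> app L (pull X (pd 2 i f) \<odot> h) x"
      using app_pull[OF f hX shift_type(2)[OF h(1,3) e]] app_pull[OF f hX h(1,2)] app_pull[OF f' hX h(1,2)]
        shift_type(1)[OF h(1,3) e] h j[OF h(1,3) e] by simp
  qed (use f f' in simp_all)
  show "pd 3 0 (pull X f) = pull X (pd 2 0 f)" "pd 3 1 (pull X f) = pull X (pd 2 1 f)"
    by (rule pd_eqI, rule *, rule pxy_shift, assumption+)+
  have nat: "natural X (Rn 3) L (\<lambda>k x. const (src M x) 0)"
    by (rule naturalI) simp_all
  have "haspd 3 2 (pull X f) (lam X (Rn 3) (\<lambda>k x. const (src M x) 0))"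
    unfolding derivative_along_def
  proof (intro conjI allI impI)
    fix h x e assume "tgt M h = src M (lam X (Rn 3) (\<lambda>k x. const (src M x) 0))"
      and h: "tgt M x = Rn 3" "src M h = src M x" "src M e = src M x" "nilsquare e"
    then have hX: "tgt M h = X" using nat by (simp del: Rn_simps)
    have e: "tgt M e = L" using h by simp
    have a: "src M (app L (f \<odot> h) (pxy x)) = src M x" "tgt M (app L (f \<odot> h) (pxy x)) = L" using f hX h by simp_all
    show "app L (pull X f \<odot> h) (shift 3 2 x e)
      = app L (pull X f \<odot> h) x \<boxplus> e \<boxtimes> app L (lam X (Rn 3) (\<lambda>k x. const (src M x) 0) \<odot> h) x"
      using app_pull[OF f hX shift_type(2)[OF h(1,3) e]] app_pull[OF f hX h(1,2)] app_lam[OF nat hX h(1,2)]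
        shift_type(1)[OF h(1,3) e] h pxy_shift(3)[OF h(1,3) e] e a by (simp del: Rn_simps)
  qed (use f nat in \<open>simp_all del: Rn_simps\<close>)
  then show "pd 3 2 (pull X f) = lam X (Rn 3) (\<lambda>k x. const (src M x) 0)"
    by (rule pd_eqI)
qed

lemma pd_zero:
  "pd n i (lam X (Rn n) (\<lambda>k x. const (src M x) 0)) = lam X (Rn n) (\<lambda>k x. const (src M x) 0)"
proof (rule pd_eqI)
  have nat: "natural X (Rn n) L (\<lambda>k x. const (src M x) 0)"
    by (rule naturalI) simp_all
  show "haspd n i (lam X (Rn n) (\<lambda>k x. const (src M x) 0)) (lam X (Rn n) (\<lambda>k x. const (src M x) 0))"
    unfolding derivative_along_def
  proof (intro conjI allI impI)
    fix h x e assume "tgt M h = src M (lam X (Rn n) (\<lambda>k x. const (src M x) 0))"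
      and h: "tgt M x = Rn n" "src M h = src M x" "src M e = src M x" "nilsquare e"
    then have hX: "tgt M h = X" using nat by simp
    have e: "tgt M e = L" using h by simp
    show "app L (lam X (Rn n) (\<lambda>k x. const (src M x) 0) \<odot> h) (shift n i x e)
      = app L (lam X (Rn n) (\<lambda>k x. const (src M x) 0) \<odot> h) x \<boxplus> e \<boxtimes> app L (lam X (Rn n) (\<lambda>k x. const (src M x) 0) \<odot> h) x"
      using app_lam[OF nat hX shift_type(2)[OF h(1,3) e]] app_lam[OF nat hX h(1,2)]
        shift_type(1)[OF h(1,3) e] h e by simp
  qed (use nat in simp_all)
qed

lemma lap_pull:
  assumes f: "src M f = X" "tgt M f = EE 2" shows "lap 3 (pull X f) = pull X (lap 2 f)"
proof (rule expo_eqI[of _ "Rn 3" L])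
  fix h x assume "tgt M h = src M (pull X (lap 2 f))" and h: "tgt M x = Rn 3" "src M h = src M x"
  then have hX: "tgt M h = X" using f by simp
  let ?f = "f \<odot> h" and ?Y = "src M x"
  have g: "src M ?f = ?Y" "tgt M ?f = EE 2" using f hX h by simp_all
  then have g': "src M (pd 2 i ?f) = ?Y" "tgt M (pd 2 i ?f) = EE 2" "src M (pd 2 i (pd 2 i ?f)) = ?Y" "tgt M (pd 2 i (pd 2 i ?f)) = EE 2" for i
    by simp_all
  have natY: "natural ?Y (Rn 3) L (\<lambda>k x. const (src M x) 0)"
    by (rule naturalI) simp_all
  have ap: "app L (pull ?Y g) x = app L g (pxy x)" if "src M g = ?Y" "tgt M g = EE 2" for g
    using app_pull[OF that, of "ide M ?Y" x] that h by simp
  have "lap 3 (pull X f) \<odot> h = lap 3 (pull ?Y ?f)"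
    using f hX h by simp
  then have "app L (lap 3 (pull X f) \<odot> h) x = lap_sum 3 [0..<3] (pull ?Y ?f) x"
    using app_lap_ide[of "pull ?Y ?f" 3 x] g h by simp
  also have "\<dots> = app L (pd 2 0 (pd 2 0 ?f)) (pxy x) \<boxplus> (app L (pd 2 1 (pd 2 1 ?f)) (pxy x) \<boxplus> const ?Y 0)"
  proof -
    have u: "[0..<3] = [0, 1, 2::nat]" by (simp add: upt_rec)
    show ?thesis
      unfolding u lap_sum_def
      using pd_pull[OF g] pd_pull(1)[OF g'(1,2)] pd_pull(2)[OF g'(1,2)] pd_zero[of 3 2 ?Y] ap[OF g'(3,4)]
        app_lam_ide[OF natY h(1) refl] by (simp del: Rn_simps)
  qed
  also have "\<dots> = lap_sum 2 [0..<2] ?f (pxy x)"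
  proof -
    have u: "[0..<2] = [0, 1::nat]" by (simp add: upt_rec)
    show ?thesis
      unfolding u lap_sum_def using h by simp
  qed
  also have "\<dots> = app L (lap 2 ?f) (pxy x)"
    using app_lap_ide[of ?f 2 "pxy x"] g h by simp
  also have "\<dots> = app L (pull X (lap 2 f) \<odot> h) x"
    using app_pull[of "lap 2 f" X h x] f hX h by simp
  finally show "app L (lap 3 (pull X f) \<odot> h) x = app L (pull X (lap 2 f) \<odot> h) x" .
qed (use f in simp_all)


lemma pxy_pt3:
  assumes "tgt M t = L" "tgt M p = L" "tgt M q = L" "src M t = src M q" "src M p = src M q"
  shows "pxy (pt3 t p q) = pt t p q"
proof -
  let ?as = "[t \<boxtimes> cosine q \<boxtimes> sine p, t \<boxtimes> sine q \<boxtimes> sine p, t \<boxtimes> cosine p]"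
  have as: "set ?as \<subseteq> hom M (src M q) L" using assms by (simp add: in_hom)
  have "src M (pt3 t p q) = src M q"
    unfolding pt3_def using tup_arr_type(1)[OF as] .
  then show ?thesis
    using crd_tup_arr[OF as, of 3 0] crd_tup_arr[OF as, of 3 1] assms
    by (simp add: pxy_def pt3_def pt_def distrib(3)[of _ _ _ "src M q"])
qed

lemma pt3_type [simp]:
  assumes "tgt M t = L" "tgt M p = L" "tgt M q = L" "src M t = src M q" "src M p = src M q"
  shows "src M (pt3 t p q) = src M q" "tgt M (pt3 t p q) = prd M L (prd M L (prd M L (one M)))"
  using assms by (simp_all add: pt3_def)

lemma sphere_pull:
  assumes t: "src M t = X" "tgt M t = L" and f: "src M f = X" "tgt M f = EE 2"
  shows "dbl X (\<lambda>h p q. app L (pull X f \<odot> h) (pt3 (t \<odot> h) p q) \<boxtimes> sine p) = mean X t wS f"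
  unfolding mean_def
proof (rule dbl_cong)
  fix h p q assume h: "tgt M h = X" "tgt M p = L" "tgt M q = L" "src M h = src M q" "src M p = src M q"
  have x: "tgt M (pt3 (t \<odot> h) p q) = Rn 3" "src M h = src M (pt3 (t \<odot> h) p q)" using h t by simp_all
  have "app L (pull X f \<odot> h) (pt3 (t \<odot> h) p q) = app L (f \<odot> h) (pt (t \<odot> h) p q)"
    unfolding app_pull[OF f h(1) x] by (subst pxy_pt3) (use h t in simp_all)
  then show "app L (pull X f \<odot> h) (pt3 (t \<odot> h) p q) \<boxtimes> sine p = wt wS p q \<boxtimes> app L (f \<odot> h) (pt (t \<odot> h) p q)"
    using h t f by (simp add: wt_simps times_commute[of "sine p" "src M q"])
qed

lemma ball_pull:
  assumes t: "src M t = X" "tgt M t = L" and f: "src M f = X" "tgt M f = EE 2"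
  shows "itg X 0 1 (\<lambda>h s. dbl (src M s) (\<lambda>k p q. app L (pull X f \<odot> h \<odot> k) (pt3 ((t \<odot> h \<odot> k) \<boxtimes> (s \<odot> k)) p q)
      \<boxtimes> ((s \<odot> k) \<boxtimes> (s \<odot> k)) \<boxtimes> sine p)) = ball_mean X t f"
  unfolding ball_mean_def
proof (rule itg_cong)
  fix h s assume h: "tgt M h = X" "tgt M s = L" "src M h = src M s"
  let ?Y = "src M s"
  let ?u = "(t \<odot> h) \<boxtimes> s" and ?f = "f \<odot> h"
  have u: "src M ?u = ?Y" "tgt M ?u = L" and g: "src M ?f = ?Y" "tgt M ?f = EE 2" and s: "src M (s \<boxtimes> s) = ?Y" "tgt M (s \<boxtimes> s) = L"
    using h t f by simp_all
  have "dbl ?Y (\<lambda>k p q. app L (pull X f \<odot> h \<odot> k) (pt3 ((t \<odot> h \<odot> k) \<boxtimes> (s \<odot> k)) p q) \<boxtimes> ((s \<odot> k) \<boxtimes> (s \<odot> k)) \<boxtimes> sine p)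
    = dbl ?Y (\<lambda>k p q. ((s \<boxtimes> s) \<odot> k) \<boxtimes> (wt wS p q \<boxtimes> app L (?f \<odot> k) (pt (?u \<odot> k) p q)))"
  proof (rule dbl_cong)
    fix k p q assume k: "tgt M k = ?Y" "tgt M p = L" "tgt M q = L" "src M k = src M q" "src M p = src M q"
    let ?x = "pt3 ((t \<odot> h \<odot> k) \<boxtimes> (s \<odot> k)) p q"
    have x: "tgt M ?x = Rn 3" "src M (h \<odot> k) = src M ?x" "tgt M (h \<odot> k) = X" using h k t by simp_all
    have "app L (pull X f \<odot> h \<odot> k) ?x = app L (f \<odot> h \<odot> k) (pt ((t \<odot> h \<odot> k) \<boxtimes> (s \<odot> k)) p q)"
      unfolding app_pull[OF f x(3,1,2)] by (subst pxy_pt3) (use h k t in simp_all)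
    moreover have "c \<boxtimes> a \<boxtimes> b = a \<boxtimes> (b \<boxtimes> c)"
      if "elements Y [a, b, c]" for a b c Y
      by (rule line_atoms[OF that]) (simp_all add: val_fold algebra_simps)
    note this[of "src M q"]
    ultimately show "app L (pull X f \<odot> h \<odot> k) ?x \<boxtimes> ((s \<odot> k) \<boxtimes> (s \<odot> k)) \<boxtimes> sine p
      = ((s \<boxtimes> s) \<odot> k) \<boxtimes> (wt wS p q \<boxtimes> app L (?f \<odot> k) (pt (?u \<odot> k) p q))"
      using h k t f by (simp add: wt_simps)
  qed
  also have "\<dots> = (s \<boxtimes> s) \<boxtimes> mean ?Y ?u wS ?f"
    unfolding mean_def by (rule dbl_scale[OF natural2_mean[OF _ u g] s]) simp
  finally show "dbl ?Y (\<lambda>k p q. app L (pull X f \<odot> h \<odot> k) (pt3 ((t \<odot> h \<odot> k) \<boxtimes> (s \<odot> k)) p q) \<boxtimes> ((s \<odot> k) \<boxtimes> (s \<odot> k)) \<boxtimes> sine p)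
    = (s \<boxtimes> s) \<boxtimes> mean ?Y ?u wS ?f" .
qed

section \<open>The two families\<close>

text \<open>The values at the test function \<open>f\<close> of the two families at time \<open>t\<close>.\<close>

definition Q1 where "Q1 X t f = const X (1 / (4 * pi)) \<boxtimes> (t \<boxtimes> mean X t wS f)"
definition Q2 where
  "Q2 X t f = const X (1 / (4 * pi)) \<boxtimes> (mean X t wS f \<boxplus> (t \<boxtimes> t) \<boxtimes> ball_mean X t (lap 2 f))"

lemma stable_families:
  "stable sphere_family (Fun Line (Dist 2))" "stable sphere_ball_family (Fun Line (Dist 2))"
  unfolding sphere_family_def sphere_ball_family_def
  by (rule stable_dist_scale stable_push stable_proj_xy stable_dist_add stable_sphere stable_ball stable_dist_laplace stable_intros)+

lemma den_sphere_family:
  assumes r: "env X r" and t: "src M t = X" "tgt M t = L" and f: "src M f = X" "tgt M f = EE 2"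
  shows "app L (app (DD 2) (den M X r sphere_family) t) f = Q1 X t f"
proof -
  let ?r = "r(time := t)"
  have r': "env X ?r" using r t by simp
  have s1: "stable (sphere \<cdot> Var time) (Dist 3)"
    by (rule stable_sphere stable_intros)+
  have s2: "stable (dist_scale 3 \<cdot> Var time \<cdot> (sphere \<cdot> Var time)) (Dist 3)"
    by (rule stable_sphere stable_dist_scale stable_intros)+
  have s3: "stable (push 3 2 \<cdot> proj_xy \<cdot> (dist_scale 3 \<cdot> Var time \<cdot> (sphere \<cdot> Var time))) (Dist 2)"
    by (rule stable_sphere stable_dist_scale stable_push stable_proj_xy stable_intros)+
  have s4: "stable (dist_scale 2 \<cdot> Const (1 / (4 * pi)) \<cdot> (push 3 2 \<cdot> proj_xy \<cdot> (dist_scale 3 \<cdot> Var time \<cdot> (sphere \<cdot> Var time)))) (Dist 2)"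
    by (rule stable_sphere stable_dist_scale stable_push stable_proj_xy stable_intros)+
  have p: "src M (pull X f) = X" "tgt M (pull X f) = EE 3" using f by simp_all
  have "app (DD 2) (den M X r sphere_family) t
    = den M X ?r (dist_scale 2 \<cdot> Const (1 / (4 * pi)) \<cdot> (push 3 2 \<cdot> proj_xy \<cdot> (dist_scale 3 \<cdot> Var time \<cdot> (sphere \<cdot> Var time))))"
    unfolding sphere_family_def by (rule app_Lam[OF s4 r]) (use t in simp_all)
  then show ?thesis
    using den_dist_scale[OF stable_ops(1) s3 r' f] den_push_proj_xy[OF s2 r' f] den_dist_scale[OF stable_Var s1 r' p]
      den_sphere(2)[OF stable_Var r' p] sphere_pull[OF t f]
    by (simp add: Q1_def)
qed

lemma den_sphere_ball_family:
  assumes r: "env X r" and t: "src M t = X" "tgt M t = L" and f: "src M f = X" "tgt M f = EE 2"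
  shows "app L (app (DD 2) (den M X r sphere_ball_family) t) f = Q2 X t f"
proof -
  let ?r = "r(time := t)"
  have r': "env X ?r" using r t by simp
  let ?b = "dist_laplace 3 \<cdot> (ball \<cdot> Var time)"
  let ?c = "dist_scale 3 \<cdot> (Var time \<otimes> Var time) \<cdot> ?b"
  let ?d = "dist_add 3 \<cdot> (sphere \<cdot> Var time) \<cdot> ?c"
  have s0: "stable (ball \<cdot> Var time) (Dist 3)" "stable (sphere \<cdot> Var time) (Dist 3)" "stable (Var time \<otimes> Var time) Line"
    by (rule stable_sphere stable_ball stable_intros)+
  have s1: "stable ?b (Dist 3)"
    by (rule stable_dist_laplace stable_ball stable_intros)+
  have s2: "stable ?c (Dist 3)"
    by (rule stable_dist_scale s1 stable_intros)+
  have s3: "stable ?d (Dist 3)"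
    by (rule stable_dist_add s2 s0 stable_intros)+
  have s4: "stable (push 3 2 \<cdot> proj_xy \<cdot> ?d) (Dist 2)"
    by (rule stable_push stable_proj_xy s3 stable_intros)+
  have s5: "stable (dist_scale 2 \<cdot> Const (1 / (4 * pi)) \<cdot> (push 3 2 \<cdot> proj_xy \<cdot> ?d)) (Dist 2)"
    by (rule stable_dist_scale s4 stable_intros)+
  have p: "src M (pull X f) = X" "tgt M (pull X f) = EE 3" using f by simp_all
  have lf: "src M (lap 2 f) = X" "tgt M (lap 2 f) = EE 2" using f by simp_all
  have pl: "src M (pull X (lap 2 f)) = X" "tgt M (pull X (lap 2 f)) = EE 3" using f by simp_all
  have "app (DD 2) (den M X r sphere_ball_family) t
    = den M X ?r (dist_scale 2 \<cdot> Const (1 / (4 * pi)) \<cdot> (push 3 2 \<cdot> proj_xy \<cdot> ?d))"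
    unfolding sphere_ball_family_def by (rule app_Lam[OF s5 r]) (use t in simp_all)
  then have "app L (app (DD 2) (den M X r sphere_ball_family) t) f
    = const X (1 / (4 * pi)) \<boxtimes> app L (den M X ?r ?d) (pull X f)"
    using den_dist_scale[OF stable_ops(1) s4 r' f] den_push_proj_xy[OF s3 r' f] by simp
  also have "app L (den M X ?r ?d) (pull X f) = app L (den M X ?r (sphere \<cdot> Var time)) (pull X f)
      \<boxplus> den M X ?r (Var time \<otimes> Var time) \<boxtimes> app L (den M X ?r ?b) (pull X f)"
    by (simp only: den_dist_add[OF s0(2) s2 r' p] den_dist_scale[OF s0(3) s1 r' p])
  also have "app L (den M X ?r (sphere \<cdot> Var time)) (pull X f) = mean X t wS f"
    using den_sphere(2)[OF stable_Var r' p] sphere_pull[OF t f] by simp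
  also have "app L (den M X ?r ?b) (pull X f) = ball_mean X t (lap 2 f)"
    using den_dist_laplace[OF s0(1) r' p] den_ball(2)[OF stable_Var r' pl] ball_pull[OF t lf] lap_pull[OF f] by simp
  also have "den M X ?r (Var time \<otimes> Var time) = t \<boxtimes> t"
    using t by simp
  finally show ?thesis
    by (simp only: Q2_def)
qed

lemma Q_type [simp]:
  assumes "src M t = X" "tgt M t = L" "src M f = X" "tgt M f = EE 2"
  shows "src M (Q1 X t f) = X" "tgt M (Q1 X t f) = L" "src M (Q2 X t f) = X" "tgt M (Q2 X t f) = L"
  using assms by (simp_all add: Q1_def Q2_def)

lemma Q_comp [simp]:
  assumes "src M t = X" "tgt M t = L" "src M f = X" "tgt M f = EE 2" "tgt M k = X"
  shows "Q1 X t f \<odot> k = Q1 (src M k) (t \<odot> k) (f \<odot> k)" "Q2 X t f \<odot> k = Q2 (src M k) (t \<odot> k) (f \<odot> k)"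
  using assms by (simp_all add: Q1_def Q2_def)

text \<open>
  By \<open>rad_eq_ball_mean\<close>, \<open>(t S)' = S + t S' = S + t\<^sup>2 B\<close>, where \<open>B\<close> belongs to the Laplacian of
  \<open>f\<close>.
\<close>

lemma Q1_plus:
  assumes t: "src M t = X" "tgt M t = L" and f: "src M f = X" "tgt M f = EE 2" and e: "src M e = X" "nilsquare e"
  shows "Q1 X (t \<boxplus> e) f = Q1 X t f \<boxplus> e \<boxtimes> Q2 X t f"
proof -
  have et: "tgt M e = L" using e by simp
  have eq: "const X c \<boxtimes> ((t \<boxplus> e) \<boxtimes> (m \<boxplus> e \<boxtimes> (t \<boxtimes> b)))
    = (const X c \<boxtimes> (t \<boxtimes> m) \<boxplus> e \<boxtimes> (const X c \<boxtimes> (m \<boxplus> (t \<boxtimes> t) \<boxtimes> b))) \<boxplus> (e \<boxtimes> e) \<boxtimes> (const X c \<boxtimes> (t \<boxtimes> b))"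
    if "src M m = X" "tgt M m = L" "src M b = X" "tgt M b = L" for m b c
    by (rule line_atoms[of X "[t, e, m, b]"]) (use that t e(1) et in \<open>simp_all add: val_fold algebra_simps\<close>)
  show ?thesis
    unfolding Q1_def Q2_def mean_wS_plus[OF t f e(2,1)] rad_eq_ball_mean[OF t f]
    by (rule nil_drop[OF eq e(2)]) (use t f e et in simp_all)
qed

text \<open>
  \<open>(S + t\<^sup>2 B)' = t B + 2 t B + t\<^sup>2 B' = t (3 B + t B')\<close>, and \<open>ball_mean_euler\<close> evaluates the
  bracket.
\<close>

lemma Q2_plus:
  assumes t: "src M t = X" "tgt M t = L" and f: "src M f = X" "tgt M f = EE 2" and e: "src M e = X" "nilsquare e"
  shows "Q2 X (t \<boxplus> e) f = Q2 X t f \<boxplus> e \<boxtimes> Q1 X t (lap 2 f)"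
proof -
  have et: "tgt M e = L" using e by simp
  have lf: "src M (lap 2 f) = X" "tgt M (lap 2 f) = EE 2" using f by simp_all
  have eq: "const X c \<boxtimes> ((m \<boxplus> e \<boxtimes> (t \<boxtimes> b)) \<boxplus> ((t \<boxplus> e) \<boxtimes> (t \<boxplus> e)) \<boxtimes> (b \<boxplus> e \<boxtimes> d))
    = (const X c \<boxtimes> (m \<boxplus> (t \<boxtimes> t) \<boxtimes> b) \<boxplus> e \<boxtimes> (const X c \<boxtimes> (t \<boxtimes> (const X 3 \<boxtimes> b \<boxplus> t \<boxtimes> d))))
      \<boxplus> (e \<boxtimes> e) \<boxtimes> (const X c \<boxtimes> (b \<boxplus> const X 2 \<boxtimes> t \<boxtimes> d \<boxplus> e \<boxtimes> d))"
    if "src M m = X" "tgt M m = L" "src M b = X" "tgt M b = L" "src M d = X" "tgt M d = L" for m b c d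
    by (rule line_atoms[of X "[t, e, m, b, d]"]) (use that t e(1) et in \<open>simp_all add: val_fold algebra_simps\<close>)
  show ?thesis
    unfolding Q1_def Q2_def mean_wS_plus[OF t f e(2,1)] rad_eq_ball_mean[OF t f] ball_mean_plus[OF t lf e(2,1)]
      ball_mean_euler[OF t lf, symmetric]
    by (rule nil_drop[OF eq e(2)]) (use t f e et in simp_all)
qed

section \<open>Solutions of the wave equation\<close>

text \<open>
  By uniqueness of slopes, the time derivative of a map into the distributions may be computed
  separately at each test function.
\<close>

lemma dot_act:
  assumes r: "env X r" and Q: "src M Q = X" "tgt M Q = expo M L (DD n)"
    and act: "\<And>h t f. tgt M h = X \<Longrightarrow> src M h = src M t \<Longrightarrow> tgt M t = L \<Longrightarrow> src M f = src M t \<Longrightarrow> tgt M f = EE n \<Longrightarrow>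
      app L (app (DD n) (Q \<odot> h) t) f = F (src M t) t f"
    and type: "\<And>Y t f. src M t = Y \<Longrightarrow> tgt M t = L \<Longrightarrow> src M f = Y \<Longrightarrow> tgt M f = EE n \<Longrightarrow> src M (F' Y t f) = Y \<and> tgt M (F' Y t f) = L"
    and comp: "\<And>Y t f k. src M t = Y \<Longrightarrow> tgt M t = L \<Longrightarrow> src M f = Y \<Longrightarrow> tgt M f = EE n \<Longrightarrow> tgt M k = Y \<Longrightarrow>
      F' Y t f \<odot> k = F' (src M k) (t \<odot> k) (f \<odot> k)"
    and plus: "\<And>Y t f e. src M t = Y \<Longrightarrow> tgt M t = L \<Longrightarrow> src M f = Y \<Longrightarrow> tgt M f = EE n \<Longrightarrow> src M e = Y \<Longrightarrow> nilsquare e \<Longrightarrow>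
      F Y (t \<boxplus> e) f = F Y t f \<boxplus> e \<boxtimes> F' Y t f"
    and h: "tgt M h = X" "src M h = src M t" "tgt M t = L" "src M f = src M t" "tgt M f = EE n"
  shows "app L (app (DD n) (app (expo M L (DD n)) (den M X r (dot n)) Q \<odot> h) t) f = F' (src M t) t f"
proof -
  let ?Y = "src M t" and ?D = "den M X r (dot n)"
  have D: "src M ?D = X" "tgt M ?D = expo M (expo M L (DD n)) (expo M L (DD n))"
    using stable_type[OF stable_dot r] by simp_all
  let ?m = "app (DD n) (app (expo M L (DD n)) ?D Q \<odot> h) t"
  have "velocity n ?Y (Q \<odot> h) t (app (DD n) (app (expo M L (DD n)) (den M ?Y (\<lambda>w. r w \<odot> h) (dot n)) (Q \<odot> h)) t)"
    by (rule den_dot(2)) (use env_restrict[OF r h(1)] Q h in simp_all)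
  then have v: "velocity n ?Y (Q \<odot> h) t ?m"
    using stable_comp[OF stable_dot r h(1)] D Q h by simp
  have "slope (src M f) (speed n (src M f) (Q \<odot> h \<odot> ide M ?Y) (t \<odot> ide M ?Y) f) (app L (?m \<odot> ide M ?Y) f)"
  proof -
    have "tgt M (ide M ?Y) = ?Y" "src M (ide M ?Y) = src M f" using h by simp_all
    then have "slope (src M f) (speed n (src M f) ((Q \<odot> h) \<odot> ide M ?Y) (t \<odot> ide M ?Y) f) (app L (?m \<odot> ide M ?Y) f)"
      using v[unfolded velocity_def] h(5) by blast
    then show ?thesis using Q h by simp
  qed
  moreover have "src M ?m = ?Y" using v by (simp add: velocity_def)
  ultimately have s1: "slope ?Y (speed n ?Y (Q \<odot> h) t f) (app L ?m f)"
    using Q h by simp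
  have s2: "slope ?Y (speed n ?Y (Q \<odot> h) t f) (F' ?Y t f)"
    unfolding slope_def speed_def
  proof (intro conjI allI impI)
    show "src M (F' ?Y t f) = ?Y" "tgt M (F' ?Y t f) = L"
      using type[OF refl h(3,4,5)] by simp_all
    fix k e assume k: "tgt M k = ?Y" "src M k = src M e" "nilsquare e"
    let ?Z = "src M e"
    have ty: "src M (t \<odot> k) = ?Z" "tgt M (t \<odot> k) = L" "src M (f \<odot> k) = ?Z" "tgt M (f \<odot> k) = EE n" "tgt M e = L"
      using h k by simp_all
    have a: "app L (app (DD n) (Q \<odot> h \<odot> k) u) (f \<odot> k) = F ?Z u (f \<odot> k)" if "src M u = ?Z" "tgt M u = L" for u
      using act[of "h \<odot> k" u "f \<odot> k"] that h k by simp
    have "app L (app (DD n) (Q \<odot> h \<odot> k) (t \<odot> k \<boxplus> e)) (f \<odot> k)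
      = app L (app (DD n) (Q \<odot> h \<odot> k) (t \<odot> k)) (f \<odot> k) \<boxplus> e \<boxtimes> F' ?Z (t \<odot> k) (f \<odot> k)"
      using a[of "t \<odot> k \<boxplus> e"] a[of "t \<odot> k"] plus[OF ty(1-4) refl k(3)] ty by simp
    then show "app L (app (DD n) ((Q \<odot> h) \<odot> k) (t \<odot> k \<boxplus> e)) (f \<odot> k)
      = app L (app (DD n) ((Q \<odot> h) \<odot> k) (t \<odot> k \<boxplus> const (src M e) 0)) (f \<odot> k) \<boxplus> e \<boxtimes> (F' ?Y t f \<odot> k)"
      using comp[OF refl h(3,4,5) k(1)] k(2) ty Q h k by simp
  qed
  show ?thesis
    by (rule slope_unique[OF natural_speed s1 s2]) (use Q h in simp_all)
qed

lemma forces_ForallI: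
  assumes "\<And>Y r. env Y r \<Longrightarrow> forces M Y r p" "env X r"
  shows "forces M X r (Forall v p)"
  using assms by (auto simp: in_hom simp del: fun_upd_apply)

text \<open>
  The wave equation for the values at test functions, as a first order system: \<open>F'\<close> is the
  derivative of \<open>F\<close>, and that of \<open>F'\<close> at \<open>f\<close> is \<open>F\<close> at the Laplacian of \<open>f\<close>.
\<close>

lemma wave_solutionI:
  assumes q: "stable q (Fun Line (Dist n))" and u: "stable u (Dist n)" and v: "stable v (Dist n)"
    and act: "\<And>X r t f. env X r \<Longrightarrow> src M t = X \<Longrightarrow> tgt M t = L \<Longrightarrow> src M f = X \<Longrightarrow> tgt M f = EE n \<Longrightarrow>
      app L (app (DD n) (den M X r q) t) f = F X t f"
    and type: "\<And>X t f. src M t = X \<Longrightarrow> tgt M t = L \<Longrightarrow> src M f = X \<Longrightarrow> tgt M f = EE n \<Longrightarrow> src M (F X t f) = X \<and> tgt M (F X t f) = L"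
    and type': "\<And>X t f. src M t = X \<Longrightarrow> tgt M t = L \<Longrightarrow> src M f = X \<Longrightarrow> tgt M f = EE n \<Longrightarrow> src M (F' X t f) = X \<and> tgt M (F' X t f) = L"
    and comp: "\<And>X t f k. src M t = X \<Longrightarrow> tgt M t = L \<Longrightarrow> src M f = X \<Longrightarrow> tgt M f = EE n \<Longrightarrow> tgt M k = X \<Longrightarrow>
      F X t f \<odot> k = F (src M k) (t \<odot> k) (f \<odot> k)"
    and comp': "\<And>X t f k. src M t = X \<Longrightarrow> tgt M t = L \<Longrightarrow> src M f = X \<Longrightarrow> tgt M f = EE n \<Longrightarrow> tgt M k = X \<Longrightarrow>
      F' X t f \<odot> k = F' (src M k) (t \<odot> k) (f \<odot> k)"
    and plus: "\<And>X t f e. src M t = X \<Longrightarrow> tgt M t = L \<Longrightarrow> src M f = X \<Longrightarrow> tgt M f = EE n \<Longrightarrow> src M e = X \<Longrightarrow> nilsquare e \<Longrightarrow>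
      F X (t \<boxplus> e) f = F X t f \<boxplus> e \<boxtimes> F' X t f"
    and plus': "\<And>X t f e. src M t = X \<Longrightarrow> tgt M t = L \<Longrightarrow> src M f = X \<Longrightarrow> tgt M f = EE n \<Longrightarrow> src M e = X \<Longrightarrow> nilsquare e \<Longrightarrow>
      F' X (t \<boxplus> e) f = F' X t f \<boxplus> e \<boxtimes> F X t (lap n f)"
    and init: "\<And>X r f. env X r \<Longrightarrow> src M f = X \<Longrightarrow> tgt M f = EE n \<Longrightarrow> app L (den M X r u) f = F X (const X 0) f"
    and init': "\<And>X r f. env X r \<Longrightarrow> src M f = X \<Longrightarrow> tgt M f = EE n \<Longrightarrow> app L (den M X r v) f = F' X (const X 0) f"
    and linear: "\<And>X t s f g a b. src M t = X \<Longrightarrow> tgt M t = L \<Longrightarrow> src M f = X \<Longrightarrow> tgt M f = EE n \<Longrightarrow> src M g = X \<Longrightarrow> tgt M g = EE n \<Longrightarrow>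
      src M a = X \<Longrightarrow> tgt M a = L \<Longrightarrow> src M b = X \<Longrightarrow> tgt M b = L \<Longrightarrow>
      pointwise n X s (\<lambda>h x. (a \<odot> h) \<boxtimes> app L (f \<odot> h) x \<boxplus> (b \<odot> h) \<boxtimes> app L (g \<odot> h) x) \<Longrightarrow>
      F X t s = a \<boxtimes> F X t f \<boxplus> b \<boxtimes> F X t g"
  shows "M \<Turnstile> wave_solution n q u v"
proof (rule validI)
  fix X r assume r: "env X r"
  have qt: "stable (q \<cdot> Var time) (Dist n)"
    by (rule stable_App[OF q stable_Var])
  have qt': "stable (q \<cdot> Var time) (Fun (Fun (vec n) Line) Line)"
    using qt by (simp add: Dist_def)
  have den_qt: "app L (den M X r (q \<cdot> Var time)) f = F X (r time) f"
    if "env X r" "src M f = X" "tgt M f = EE n" for X r f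
    using that den_App[OF q stable_Var that(1), of "''t''"] act[OF that(1) _ _ that(2,3), of "r time"]
    by (simp add: env_type)
  have den_qt_s: "den M X r (q \<cdot> Var time \<cdot> s) = F X (r time) (den M X r s)"
    if "env X r" "stable s (Fun (vec n) Line)" for X r s
    using den_App[OF qt' that(2,1)] den_qt[OF that(1), of "den M X r s"] stable_type[OF that(2,1)] by simp
  let ?f = "(''f'', Fun (vec n) Line)" and ?g = "(''g'', Fun (vec n) Line)" and ?a = "(''a'', Line)" and ?x = "(''x'', vec n)"
  have sf: "stable (Var ?f) (Fun (vec n) Line)" "stable (Var ?g) (Fun (vec n) Line)"
    by (rule stable_Var)+
  have lin: "forces M X r (linear_dist n (q \<cdot> Var time))" if r: "env X r" for X r
  proof -
    have s1: "stable (Var ?f \<cdot> Var ?x \<oplus> Var ?g \<cdot> Var ?x) Line" "stable (Var ?a \<otimes> (Var ?f \<cdot> Var ?x)) Line"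
      by (rule stable_intros)+
    note s2 = stable_Lam[OF s1(1), of "''x''" "vec n"] stable_Lam[OF s1(2), of "''x''" "vec n"]
    have pw: "pointwise n X (den M X r (Lam ?x (Var ?f \<cdot> Var ?x \<oplus> Var ?g \<cdot> Var ?x)))
        (\<lambda>h x. (const X 1 \<odot> h) \<boxtimes> app L (r ?f \<odot> h) x \<boxplus> (const X 1 \<odot> h) \<boxtimes> app L (r ?g \<odot> h) x)"
      and pw': "pointwise n X (den M X r (Lam ?x (Var ?a \<otimes> (Var ?f \<cdot> Var ?x))))
        (\<lambda>h x. (r ?a \<odot> h) \<boxtimes> app L (r ?f \<odot> h) x \<boxplus> (const X 0 \<odot> h) \<boxtimes> app L (r ?f \<odot> h) x)"
      if r: "env X r" for X r
    proof -
      have *: "pointwise n X (den M X r (Lam ?x B)) N"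
        if B: "stable B Line" and N: "\<And>h x. tgt M h = X \<Longrightarrow> tgt M x = Rn n \<Longrightarrow> src M h = src M x \<Longrightarrow>
          den M (src M x) ((\<lambda>w. r w \<odot> h)(?x := x)) B = N h x" for B N
        unfolding pointwise_def
      proof (intro conjI allI impI)
        fix h x assume h: "tgt M h = X" "tgt M x = Rn n" "src M h = src M x"
        have "env (src M x) (\<lambda>w. r w \<odot> h)" using env_restrict[OF r h(1)] h(3) by simp
        from app_Lam[OF B this refl, of "vec n" "''x''"] show "app L (den M X r (Lam ?x B) \<odot> h) x = N h x"
          using stable_comp[OF stable_Lam[OF B, of "''x''" "vec n"] r h(1)] h N[OF h] by (simp del: den.simps)
      qed (use stable_type[OF stable_Lam[OF B, of "''x''" "vec n"] r] in simp_all)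
      show "pointwise n X (den M X r (Lam ?x (Var ?f \<cdot> Var ?x \<oplus> Var ?g \<cdot> Var ?x)))
          (\<lambda>h x. (const X 1 \<odot> h) \<boxtimes> app L (r ?f \<odot> h) x \<boxplus> (const X 1 \<odot> h) \<boxtimes> app L (r ?g \<odot> h) x)"
        by (rule *[OF s1(1)]) (use r in \<open>simp add: app_fold env_type\<close>)
      show "pointwise n X (den M X r (Lam ?x (Var ?a \<otimes> (Var ?f \<cdot> Var ?x))))
          (\<lambda>h x. (r ?a \<odot> h) \<boxtimes> app L (r ?f \<odot> h) x \<boxplus> (const X 0 \<odot> h) \<boxtimes> app L (r ?f \<odot> h) x)"
        by (rule *[OF s1(2)]) (use r in \<open>simp add: app_fold env_type\<close>)
    qed
    have fr: "src M (F X (r time) (r ?f)) = X" "tgt M (F X (r time) (r ?f)) = L"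
        "src M (F X (r time) (r ?g)) = X" "tgt M (F X (r time) (r ?g)) = L" if "env X r" for X r
      using type[of "r time" X "r ?f"] type[of "r time" X "r ?g"] that by (simp_all add: env_type)
    have e1: "forces M X r (q \<cdot> Var time \<cdot> Lam ?x (Var ?f \<cdot> Var ?x \<oplus> Var ?g \<cdot> Var ?x)
        \<approx> q \<cdot> Var time \<cdot> Var ?f \<oplus> q \<cdot> Var time \<cdot> Var ?g)" if r: "env X r" for X r
      using den_qt_s[OF r s2(1)] den_qt_s[OF r sf(1)] den_qt_s[OF r sf(2)]
        linear[OF _ _ _ _ _ _ _ _ _ _ pw[OF r], of "r time"] fr[OF r] r
      by (simp add: env_type del: den.simps(6,7))
    have e2: "forces M X r (q \<cdot> Var time \<cdot> Lam ?x (Var ?a \<otimes> (Var ?f \<cdot> Var ?x))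
        \<approx> Var ?a \<otimes> (q \<cdot> Var time \<cdot> Var ?f))" if r: "env X r" for X r
      using den_qt_s[OF r s2(2)] den_qt_s[OF r sf(1)]
        linear[OF _ _ _ _ _ _ _ _ _ _ pw'[OF r], of "r time"] fr[OF r] r
      by (simp add: env_type del: den.simps(6,7))
    show ?thesis
      unfolding linear_dist_def Let_def forces.simps(2)
      by (intro conjI forces_ForallI[OF _ r] forces_ForallI) (assumption | rule e1 e2)+
  qed
  have Q: "src M (den M X r q) = X" "tgt M (den M X r q) = expo M L (DD n)" if "env X r" for X r
    using stable_type[OF q that] by simp_all
  have actq: "app L (app (DD n) (den M X r q \<odot> h) t) f = F (src M t) t f"
    if r: "env X r" and h: "tgt M h = X" "src M h = src M t" "tgt M t = L" "src M f = src M t" "tgt M f = EE n" for X r h t f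
  proof -
    have "env (src M t) (\<lambda>w. r w \<odot> h)" using env_restrict[OF r h(1)] h(2) by simp
    from act[OF this refl h(3,4,5)] show ?thesis
      using stable_comp[OF q r h(1)] h(2) by simp
  qed
  have sd: "stable (dot n \<cdot> q) (Fun Line (Dist n))" "stable (dot n \<cdot> (dot n \<cdot> q)) (Fun Line (Dist n))"
    by (rule stable_dot q stable_App)+
  have den_d: "den M X r (dot n \<cdot> q) = app (expo M L (DD n)) (den M X r (dot n)) (den M X r q)"
    "den M X r (dot n \<cdot> (dot n \<cdot> q)) = app (expo M L (DD n)) (den M X r (dot n)) (den M X r (dot n \<cdot> q))"
    if r: "env X r" for X r
    using den_App[OF stable_dot q r] den_App[OF stable_dot sd(1) r] by simp_all
  have act': "app L (app (DD n) (den M X r (dot n \<cdot> q) \<odot> h) t) f = F' (src M t) t f"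
    if r: "env X r" and h: "tgt M h = X" "src M h = src M t" "tgt M t = L" "src M f = src M t" "tgt M f = EE n" for X r h t f
    unfolding den_d[OF r] by (rule dot_act[OF r Q[OF r] actq[OF r] type' comp' plus h])
  have Q': "src M (den M X r (dot n \<cdot> q)) = X" "tgt M (den M X r (dot n \<cdot> q)) = expo M L (DD n)" if "env X r" for X r
    using stable_type[OF sd(1) that] by simp_all
  have act'': "app L (app (DD n) (den M X r (dot n \<cdot> (dot n \<cdot> q)) \<odot> h) t) f = F (src M t) t (lap n f)"
    if r: "env X r" and h: "tgt M h = X" "src M h = src M t" "tgt M t = L" "src M f = src M t" "tgt M f = EE n" for X r h t f
    unfolding den_d(2)[OF r]
    by (rule dot_act[OF r Q'[OF r] act'[OF r] _ _ plus' h]) (simp_all add: type comp)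
  have wave: "forces M X r (dot n \<cdot> (dot n \<cdot> q) \<cdot> Var time \<approx> dist_laplace n \<cdot> (q \<cdot> Var time))" if r: "env X r" for X r
  proof -
    let ?s = "dot n \<cdot> (dot n \<cdot> q) \<cdot> Var time" and ?s' = "dist_laplace n \<cdot> (q \<cdot> Var time)"
    have st: "stable ?s (Dist n)" "stable ?s' (Dist n)"
      by (rule stable_App[OF sd(2) stable_Var] stable_App[OF stable_dist_laplace qt])+
    have "den M X r ?s = den M X r ?s'"
    proof (rule expo_eqI[of _ "EE n" L])
      fix h f assume "tgt M h = src M (den M X r ?s')" and h: "tgt M f = EE n" "src M h = src M f"
      then have hX: "tgt M h = X" using stable_type[OF st(2) r] by simp
      have r': "env (src M f) (\<lambda>w. r w \<odot> h)" using env_restrict[OF r hX] h by simp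
      have "app L (den M X r ?s \<odot> h) f = app L (app (DD n) (den M X r (dot n \<cdot> (dot n \<cdot> q)) \<odot> h) (r time \<odot> h)) f"
        using den_App[OF sd(2) stable_Var r, of "''t''"] stable_type[OF sd(2) r] r hX h by (simp add: env_type del: den.simps(7))
      also have "\<dots> = F (src M f) (r time \<odot> h) (lap n f)"
        by (subst act''[OF r hX]) (use r hX h in \<open>simp_all add: env_type\<close>)
      also have "\<dots> = app L (den M X r ?s' \<odot> h) f"
        using stable_comp[OF st(2) r hX] den_dist_laplace[OF qt r' refl h(1)] den_qt[OF r', of "lap n f"] h by simp
      finally show "app L (den M X r ?s \<odot> h) f = app L (den M X r ?s' \<odot> h) f" .
    qed (use stable_type[OF st(1) r] stable_type[OF st(2) r] in \<open>simp_all add: obj_Dist\<close>)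
    then show ?thesis by simp
  qed
  \<comment> \<open>Both initial conditions compare two distributions at all test functions.\<close>
  have at_zero: "den M X r (s \<cdot> Const 0) = den M X r w"
    if s: "stable s (Fun Line (Dist n))" and w: "stable w (Dist n)"
      and act: "\<And>h t f. tgt M h = X \<Longrightarrow> src M h = src M t \<Longrightarrow> tgt M t = L \<Longrightarrow> src M f = src M t \<Longrightarrow> tgt M f = EE n \<Longrightarrow>
        app L (app (DD n) (den M X r s \<odot> h) t) f = G (src M t) t f"
      and init: "\<And>X r f. env X r \<Longrightarrow> src M f = X \<Longrightarrow> tgt M f = EE n \<Longrightarrow> app L (den M X r w) f = G X (const X 0) f"
    for s w G
  proof (rule expo_eqI[of _ "EE n" L])
    note st = stable_App[OF s stable_ops(1)]
    show "tgt M (den M X r (s \<cdot> Const 0)) = expo M (EE n) L" "tgt M (den M X r w) = expo M (EE n) L"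
      "src M (den M X r (s \<cdot> Const 0)) = src M (den M X r w)"
      using stable_type[OF st r] stable_type[OF w r] by (simp_all add: obj_Dist del: den.simps)
    fix h f assume "tgt M h = src M (den M X r w)" and h: "tgt M f = EE n" "src M h = src M f"
    then have hX: "tgt M h = X" using stable_type[OF w r] by simp
    have r': "env (src M f) (\<lambda>w. r w \<odot> h)" using env_restrict[OF r hX] h by simp
    have "app L (den M X r (s \<cdot> Const 0) \<odot> h) f = app L (app (DD n) (den M X r s \<odot> h) (const (src M f) 0)) f"
      using den_App[OF s stable_ops(1) r, of 0] stable_type[OF s r] r hX h by simp
    also have "\<dots> = app L (den M X r w \<odot> h) f"
      using act[of h "const (src M f) 0" f] init[OF r' refl h(1)] stable_comp[OF w r hX] hX h by simp
    finally show "app L (den M X r (s \<cdot> Const 0) \<odot> h) f = app L (den M X r w \<odot> h) f" .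
  qed
  show "forces M X r (wave_solution n q u v)"
    unfolding wave_solution_def Let_def forces.simps(2)
  proof (intro conjI)
    show "forces M X r (Forall time (linear_dist n (q \<cdot> Var time)))"
      by (rule forces_ForallI[OF lin r])
    show "forces M X r (Forall time (dot n \<cdot> (dot n \<cdot> q) \<cdot> Var time \<approx> dist_laplace n \<cdot> (q \<cdot> Var time)))"
      by (rule forces_ForallI[OF wave r])
    show "forces M X r (q \<cdot> Const 0 \<approx> u)"
      unfolding forces.simps(1) by (rule at_zero[OF q u actq[OF r] init])
    show "forces M X r (dot n \<cdot> q \<cdot> Const 0 \<approx> v)"
      unfolding forces.simps(1) by (rule at_zero[OF sd(1) v act'[OF r] init'])
  qed
qed

lemma Q1_linear:
  assumes t: "src M t = X" "tgt M t = L" and f: "src M f = X" "tgt M f = EE 2" and g: "src M g = X" "tgt M g = EE 2"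
    and a: "src M a = X" "tgt M a = L" and b: "src M b = X" "tgt M b = L"
    and s: "pointwise 2 X s (\<lambda>h x. (a \<odot> h) \<boxtimes> app L (f \<odot> h) x \<boxplus> (b \<odot> h) \<boxtimes> app L (g \<odot> h) x)"
  shows "Q1 X t s = a \<boxtimes> Q1 X t f \<boxplus> b \<boxtimes> Q1 X t g"
proof -
  have eq: "const X c \<boxtimes> (t \<boxtimes> (a \<boxtimes> m \<boxplus> b \<boxtimes> n)) = a \<boxtimes> (const X c \<boxtimes> (t \<boxtimes> m)) \<boxplus> b \<boxtimes> (const X c \<boxtimes> (t \<boxtimes> n))"
    if "elements X [t, a, b, m, n]" for m n c
    by (rule line_atoms[OF that]) (simp_all add: val_fold algebra_simps)
  show ?thesis
    unfolding Q1_def by (subst mean_linear[OF _ t f g a b s], simp) (rule eq, use t f g a b in simp)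
qed

lemma pointwise_type: "pointwise n X s N \<Longrightarrow> src M s = X" "pointwise n X s N \<Longrightarrow> tgt M s = EE n"
  by (simp_all add: pointwise_def)

lemma natural_Q1: 
  assumes "src M t = X" "tgt M t = L" "src M f = X" "tgt M f = EE 2"
  shows "natural X L L (\<lambda>h e. Q1 (src M e) (t \<odot> h \<boxplus> e) (f \<odot> h))"
  by (rule naturalI) (use assms in simp_all)

lemma slope_Q1:
  assumes t: "src M t = X" "tgt M t = L" and f: "src M f = X" "tgt M f = EE 2"
  shows "slope X (\<lambda>h e. Q1 (src M e) (t \<odot> h \<boxplus> e) (f \<odot> h)) (Q2 X t f)"
  unfolding slope_def
proof (intro conjI allI impI)
  fix h e assume h: "tgt M h = X" "src M h = src M e" "nilsquare e"
  have "Q1 (src M e) (t \<odot> h \<boxplus> e) (f \<odot> h) = Q1 (src M e) (t \<odot> h) (f \<odot> h) \<boxplus> e \<boxtimes> Q2 (src M e) (t \<odot> h) (f \<odot> h)"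
    by (rule Q1_plus) (use t f h in simp_all)
  then show "Q1 (src M e) (t \<odot> h \<boxplus> e) (f \<odot> h)
    = Q1 (src M (const (src M e) 0)) (t \<odot> h \<boxplus> const (src M e) 0) (f \<odot> h) \<boxplus> e \<boxtimes> (Q2 X t f \<odot> h)"
    using t f h by simp
qed (use t f in simp_all)

text \<open>
  Linearity passes from \<open>Q1\<close> to its derivative in time: both sides are slopes of the same
  family.
\<close>

lemma Q2_linear:
  assumes t: "src M t = X" "tgt M t = L" and f: "src M f = X" "tgt M f = EE 2" and g: "src M g = X" "tgt M g = EE 2"
    and a: "src M a = X" "tgt M a = L" and b: "src M b = X" "tgt M b = L"
    and s: "pointwise 2 X s (\<lambda>h x. (a \<odot> h) \<boxtimes> app L (f \<odot> h) x \<boxplus> (b \<odot> h) \<boxtimes> app L (g \<odot> h) x)"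
  shows "Q2 X t s = a \<boxtimes> Q2 X t f \<boxplus> b \<boxtimes> Q2 X t g"
proof (rule slope_unique[OF natural_Q1[OF t pointwise_type[OF s]] slope_Q1[OF t pointwise_type[OF s]]])
  have *: "Q1 Y u (s \<odot> h) = (a \<odot> h) \<boxtimes> Q1 Y u (f \<odot> h) \<boxplus> (b \<odot> h) \<boxtimes> Q1 Y u (g \<odot> h)"
    if h: "tgt M h = X" "src M h = Y" and u: "src M u = Y" "tgt M u = L" for h u Y
  proof (rule Q1_linear[OF u])
    show "pointwise 2 Y (s \<odot> h) (\<lambda>k x. ((a \<odot> h) \<odot> k) \<boxtimes> app L ((f \<odot> h) \<odot> k) x \<boxplus> ((b \<odot> h) \<odot> k) \<boxtimes> app L ((g \<odot> h) \<odot> k) x)"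
      unfolding pointwise_def
    proof (intro conjI allI impI)
      fix k x assume k: "tgt M k = Y" "tgt M x = Rn 2" "src M k = src M x"
      have "app L (s \<odot> h \<odot> k) x = (a \<odot> h \<odot> k) \<boxtimes> app L (f \<odot> h \<odot> k) x \<boxplus> (b \<odot> h \<odot> k) \<boxtimes> app L (g \<odot> h \<odot> k) x"
        using s[unfolded pointwise_def] h k by simp
      then show "app L ((s \<odot> h) \<odot> k) x
        = ((a \<odot> h) \<odot> k) \<boxtimes> app L ((f \<odot> h) \<odot> k) x \<boxplus> ((b \<odot> h) \<odot> k) \<boxtimes> app L ((g \<odot> h) \<odot> k) x"
        using h k f g a b pointwise_type[OF s] by simp
    qed (use h pointwise_type[OF s] in simp_all)
  qed (use h f g a b in simp_all)
  show "slope X (\<lambda>h e. Q1 (src M e) (t \<odot> h \<boxplus> e) (s \<odot> h)) (a \<boxtimes> Q2 X t f \<boxplus> b \<boxtimes> Q2 X t g)"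
    unfolding slope_def
  proof (intro conjI allI impI)
    fix h e assume h: "tgt M h = X" "src M h = src M e" "nilsquare e"
    let ?Y = "src M e" and ?t = "t \<odot> h" and ?f = "f \<odot> h" and ?g = "g \<odot> h" and ?a = "a \<odot> h" and ?b = "b \<odot> h"
    have et: "tgt M e = L" using h by simp
    have th: "src M ?t = ?Y" "tgt M ?t = L" "src M ?f = ?Y" "tgt M ?f = EE 2" "src M ?g = ?Y" "tgt M ?g = EE 2"
      "src M ?a = ?Y" "tgt M ?a = L" "src M ?b = ?Y" "tgt M ?b = L"
      using t f g a b h by simp_all
    have eq: "a \<boxtimes> (m \<boxplus> e \<boxtimes> m') \<boxplus> b \<boxtimes> (n \<boxplus> e \<boxtimes> n') = (a \<boxtimes> m \<boxplus> b \<boxtimes> n) \<boxplus> e \<boxtimes> (a \<boxtimes> m' \<boxplus> b \<boxtimes> n')"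
      if "elements Y [a, b, m, m', n, n', e]" for a b m m' n n' e Y
      by (rule line_atoms[OF that]) (simp_all add: val_fold algebra_simps)
    have "Q1 ?Y (?t \<boxplus> e) (s \<odot> h) = ?a \<boxtimes> Q1 ?Y (?t \<boxplus> e) ?f \<boxplus> ?b \<boxtimes> Q1 ?Y (?t \<boxplus> e) ?g"
      by (rule *) (use h th et in simp_all)
    also have "\<dots> = (?a \<boxtimes> Q1 ?Y ?t ?f \<boxplus> ?b \<boxtimes> Q1 ?Y ?t ?g) \<boxplus> e \<boxtimes> (?a \<boxtimes> Q2 ?Y ?t ?f \<boxplus> ?b \<boxtimes> Q2 ?Y ?t ?g)"
      unfolding Q1_plus[OF th(1-4) refl h(3)] Q1_plus[OF th(1,2,5,6) refl h(3)]
      by (rule eq[of ?Y]) (use th et in simp)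
    also have "?a \<boxtimes> Q1 ?Y ?t ?f \<boxplus> ?b \<boxtimes> Q1 ?Y ?t ?g = Q1 ?Y ?t (s \<odot> h)"
      by (rule *[symmetric]) (use h th in simp_all)
    finally show "Q1 ?Y (?t \<boxplus> e) (s \<odot> h)
      = Q1 (src M (const ?Y 0)) (?t \<boxplus> const ?Y 0) (s \<odot> h) \<boxplus> e \<boxtimes> ((a \<boxtimes> Q2 X t f \<boxplus> b \<boxtimes> Q2 X t g) \<odot> h)"
      using t f g a b h th by simp
  qed (use t f g a b in simp_all)
qed

lemma Q1_zero:
  assumes f: "src M f = X" "tgt M f = EE 2" shows "Q1 X (const X 0) f = const X 0"
  using f by (simp add: Q1_def)

lemma Q2_zero:
  assumes f: "src M f = X" "tgt M f = EE 2"
  shows "Q2 X (const X 0) f = app L f (tup_arr M X [const X 0, const X 0])"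
proof -
  have "c \<boxtimes> (d \<boxtimes> a) = (c \<boxtimes> d) \<boxtimes> a" if "src M a = X" "src M c = X" "src M d = X" "tgt M a = L" "tgt M c = L" "tgt M d = L" for a c d
    by (rule distrib(3)[symmetric]) (use that in simp_all)
  then show ?thesis
    using f by (simp add: Q2_def mean_at_zero const_fold)
qed

lemma sphere_family_solution: "M \<Turnstile> wave_solution 2 sphere_family (dist_zero 2) (dirac 2)"
proof (rule wave_solutionI[where F = Q1 and F' = Q2])
  show "app L (den M X r (dist_zero 2)) f = Q1 X (const X 0) f" if "env X r" "src M f = X" "tgt M f = EE 2" for X r f
    using den_dist_zero[OF that] Q1_zero[OF that(2,3)] by simp
  show "app L (den M X r (dirac 2)) f = Q2 X (const X 0) f" if "env X r" "src M f = X" "tgt M f = EE 2" for X r f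
    using den_dirac[OF that] Q2_zero[OF that(2,3)] by (simp add: numeral_2_eq_2)
qed (simp_all add: stable_families stable_dist_zero stable_dirac den_sphere_family Q1_plus Q2_plus Q1_linear)

lemma sphere_ball_family_solution: "M \<Turnstile> wave_solution 2 sphere_ball_family (dirac 2) (dist_zero 2)"
proof (rule wave_solutionI[where F = Q2 and F' = "\<lambda>X t f. Q1 X t (lap 2 f)"])
  show "app L (den M X r (dist_zero 2)) f = Q1 X (const X 0) (lap 2 f)" if "env X r" "src M f = X" "tgt M f = EE 2" for X r f
    using den_dist_zero[OF that] Q1_zero[of "lap 2 f" X] that by simp
  show "app L (den M X r (dirac 2)) f = Q2 X (const X 0) f" if "env X r" "src M f = X" "tgt M f = EE 2" for X r f
    using den_dirac[OF that] Q2_zero[OF that(2,3)] by (simp add: numeral_2_eq_2)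
  show "Q1 X (t \<boxplus> e) (lap 2 f) = Q1 X t (lap 2 f) \<boxplus> e \<boxtimes> Q2 X t (lap 2 f)"
    if "src M t = X" "tgt M t = L" "src M f = X" "tgt M f = EE 2" "src M e = X" "nilsquare e" for X t f e
    by (rule Q1_plus) (use that in simp_all)
qed (simp_all add: stable_families stable_dist_zero stable_dirac den_sphere_ball_family Q2_plus Q2_linear)

end

theorem theorem18:
  fixes M :: "('o, 'a) sdg_str"
  assumes "well_adapted_model M"
  shows "(M \<Turnstile> wave_solution 2 sphere_family (dist_zero 2) (dirac 2)) \<and>
         (M \<Turnstile> wave_solution 2 sphere_ball_family (dirac 2) (dist_zero 2))"
  using well_adapted_model.sphere_family_solution[OF assms]
    well_adapted_model.sphere_ball_family_solution[OF assms] ..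

end
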